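(* Let $Q$ be a continuous probability distribution on $[0,1]$. Let $\varepsilon_n\to0$ be positive numbers such that $\sqrt n\,\varepsilon_n^2$ converges to a finite limit, and let $A_{1n},A_{2n}$ be continuous probability distributions on $[0,1]$ with $$\frac{dA_{1n}}{dQ}(x)=1+\varepsilon_n h_n(x),\qquad \frac{dA_{2n}}{dQ}(x)=1-\varepsilon_n h_n(x),$$ where, for some $h\in L^2(Q)$, $\int_0^1 h\,dQ=0$ and $\int_0^1[h_n(x)-h(x)]^2\,dQ(x)\to0$. For each $n$ let $(X_i,Y_i)$, $1\le i\le n$, be i.i.d. pairs with independent components, with law $Q\times Q$ under the null hypothesis $H_0$ and with law $\mathbb{A}_n=A_{1n}\times A_{2n}$ under the alternative. Put $U_i=\max\{X_i,Y_i\}$, $V_i=\min\{X_i,Y_i\}$ and $(h\times h)(x,y)=h(x)h(y)$. Then, with the colour-blind linear statistics $\mathbb{R}_n^s(\varphi)$ and the notion of asymptotically most powerful statistic defined in the context: (i) the statistic $\mathbb{R}_n^s(h\times h)$ is the asymptotically most powerful one, among linear statistics $\mathbb{R}_n^s(\varphi)$, $\varphi\in L^2(Q\times Q)$, for testing $H_0$ against the sequence of alternatives $\mathbb{A}_n$, and it is of the form $$\mathbb{R}_n^s(h\times h)=\frac1{\sqrt n}\sum_{i=1}^n h(U_i)h(V_i)+o_P(1);$$ (ii) the distance in total variation between the asymptotic distributions of $\mathbb{R}_n^s(h\times h)$ under the null hypothesis and under the alternatives $\mathbb{A}_n$ is $$2N_{(0,1)}(T/2)-1,\qquad T=\lim_{n\to\infty}\sqrt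 n\,\varepsilon_n^2\,\|h\times h\|_{Q\times Q}.$$
   Context: $\|\cdot\|_{Q\times Q}$ is the norm of $L^2(Q\times Q)$. $N_{(0,1)}(x)$ is the standard normal distribution function. Empirical quantities: $\mathbb{P}_n(x,y)=\frac1n\sum_{i=1}^n\mathbf 1\{X_i\le x,\ Y_i\le y\}$, $P_{1n}(x)=\frac1n\sum_{i=1}^n\mathbf 1\{X_i\le x\}$, $P_{2n}(x)=\frac1n\sum_{i=1}^n\mathbf 1\{Y_i\le x\}$, $Q_n=(P_{1n}+P_{2n})/2$, and $$\mathbb{R}_n(x,y)=\sqrt n\,[\mathbb{P}_n(x,y)-Q_n(x)Q_n(y)].$$ The colour-blind empirical process on $0\le v\le u\le1$ is $\mathbb{R}_n^s(u,v)=\mathbb{R}_n(u,v)+\mathbb{R}_n(v,u)-\mathbb{R}_n(v,v)$, and for $\varphi\in L^2(Q\times Q)$ $$\mathbb{R}_n^s(\varphi)=\iint_{0\le v<u\le1}\varphi(u,v)\,d\mathbb{R}_n^s(u,v),$$ the integral being with respect to the signed measure on $\{v<u\}$ given by the planar (two-dimensional) increments of $(u,v)\mapsto\mathbb{R}_n^s(u,v)$. Asymptotic power convention: under $H_0$ and under the alternatives $\mathbb{A}_n$ each statistic $\mathbb{R}_n^s(\varphi)$ has a limiting distribution, Gaussian (possibly degenerate) with the same variance in both cases. The asymptotic power of the test based on $\mathbb{R}_n^s(\varphi)$ is measured by the total variation distance $\sup_C|F_0(C)-F_a(C)|$ between these two limiting distributions $F_0$ (under $H_0$) and $F_a$ (under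 $\mathbb{A}_n$), the supremum being over all Borel sets $C\subseteq\mathbb{R}$; this is the largest possible asymptotic difference between power and level. "Asymptotically most powerful" means that this distance is maximal over all linear statistics $\mathbb{R}_n^s(\varphi)$, $\varphi\in L^2(Q\times Q)$. The $o_P(1)$ statement is understood under both $H_0$ and $\mathbb{A}_n$. *)

theory Defs
  imports "HOL-Probability.Probability"
begin

section \<open>Distributions on the unit interval and square-integrable functions\<close>

definition continuous_distr_on_unit :: "real measure \<Rightarrow> bool" where
  "continuous_distr_on_unit Q \<longleftrightarrow>
     real_distribution Q \<and> measure Q {0..1} = 1 \<and> continuous_on UNIV (cdf Q)"

text \<open>Elements of $L^2$ are taken as representatives. For the statistics below the choice of the
  representative matters only on null events.\<close>

definition L2_space :: "'b measure \<Rightarrow> ('b \<Rightarrow> real) set" where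
  "L2_space M = {f \<in> borel_measurable M. integrable M (\<lambda>x. (f x)\<^sup>2)}"

definition L2_norm :: "'b measure \<Rightarrow> ('b \<Rightarrow> real) \<Rightarrow> real" where
  "L2_norm M f = sqrt (\<integral>x. (f x)\<^sup>2 \<partial>M)"

definition tensor_square :: "(real \<Rightarrow> real) \<Rightarrow> real \<times> real \<Rightarrow> real" where
  "tensor_square h = (\<lambda>(x, y). h x * h y)"


section \<open>The colour-blind empirical process and its linear statistics\<close>

text \<open>Deterministic data: \<open>x 1, \<dots>, x n\<close> and \<open>y 1, \<dots>, y n\<close> are the observed values.\<close>

definition emp_joint :: "nat \<Rightarrow> (nat \<Rightarrow> real) \<Rightarrow> (nat \<Rightarrow> real) \<Rightarrow> real \<Rightarrow> real \<Rightarrow> real" where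
  "emp_joint n x y s t = (1 / real n) * (\<Sum>i = 1..n. of_bool (x i \<le> s \<and> y i \<le> t))"

definition emp_marginal :: "nat \<Rightarrow> (nat \<Rightarrow> real) \<Rightarrow> real \<Rightarrow> real" where
  "emp_marginal n x s = (1 / real n) * (\<Sum>i = 1..n. of_bool (x i \<le> s))"

definition emp_pooled :: "nat \<Rightarrow> (nat \<Rightarrow> real) \<Rightarrow> (nat \<Rightarrow> real) \<Rightarrow> real \<Rightarrow> real" where
  "emp_pooled n x y s = (emp_marginal n x s + emp_marginal n y s) / 2"

definition emp_process :: "nat \<Rightarrow> (nat \<Rightarrow> real) \<Rightarrow> (nat \<Rightarrow> real) \<Rightarrow> real \<Rightarrow> real \<Rightarrow> real" where
  "emp_process n x y s t =
     sqrt (real n) * (emp_joint n x y s t - emp_pooled n x y s * emp_pooled n x y t)"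

definition cb_process :: "nat \<Rightarrow> (nat \<Rightarrow> real) \<Rightarrow> (nat \<Rightarrow> real) \<Rightarrow> real \<Rightarrow> real \<Rightarrow> real" where
  "cb_process n x y u v =
     emp_process n x y u v + emp_process n x y v u - emp_process n x y v v"

definition planar_increment ::
  "(real \<Rightarrow> real \<Rightarrow> real) \<Rightarrow> real \<Rightarrow> real \<Rightarrow> real \<Rightarrow> real \<Rightarrow> real" where
  "planar_increment F a b c d = F b d - F a d - F b c + F a c"

text \<open>A finite signed measure is given as a difference of two finite measures. Only rectangles
  \<open>(a,b] \<times> (c,d]\<close> contained in the region \<open>v < u\<close> are tested, that is, those with \<open>d \<le> a\<close>, and all
  four of their corners satisfy \<open>v \<le> u\<close>. Corners outside the unit square are allowed, so that
  mass on the edge \<open>v = 0\<close> is captured as well; there the process is given by the same formula.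
  These rectangles determine the signed measure on the Borel subsets of \<open>v < u\<close>.\<close>

definition increments_below_diagonal ::
  "(real \<Rightarrow> real \<Rightarrow> real) \<Rightarrow> (real \<times> real) measure \<Rightarrow> (real \<times> real) measure \<Rightarrow> bool" where
  "increments_below_diagonal F \<mu> \<nu> \<longleftrightarrow>
     finite_measure \<mu> \<and> finite_measure \<nu> \<and> sets \<mu> = sets borel \<and> sets \<nu> = sets borel \<and>
     (\<forall>a b c d. c \<le> d \<and> d \<le> a \<and> a \<le> b \<longrightarrow>
        measure \<mu> ({a<..b} \<times> {c<..d}) - measure \<nu> ({a<..b} \<times> {c<..d}) =
        planar_increment F a b c d)"

definition triangle :: "(real \<times> real) set" where
  "triangle = {(u, v). 0 \<le> v \<and> v < u \<and> u \<le> 1}"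

text \<open>The value does not depend on the chosen decomposition: integrability with respect to both
  parts is part of the condition.\<close>

definition triangle_integral :: "(real \<Rightarrow> real \<Rightarrow> real) \<Rightarrow> (real \<times> real \<Rightarrow> real) \<Rightarrow> real" where
  "triangle_integral F \<phi> = (THE I. \<exists>\<mu> \<nu>. increments_below_diagonal F \<mu> \<nu> \<and>
     set_integrable \<mu> triangle \<phi> \<and> set_integrable \<nu> triangle \<phi> \<and>
     I = (LINT p:triangle|\<mu>. \<phi> p) - (LINT p:triangle|\<nu>. \<phi> p))"

definition cb_statistic ::
  "nat \<Rightarrow> (nat \<Rightarrow> real) \<Rightarrow> (nat \<Rightarrow> real) \<Rightarrow> (real \<times> real \<Rightarrow> real) \<Rightarrow> real" where
  "cb_statistic n x y \<phi> = triangle_integral (cb_process n x y) \<phi>"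


section \<open>Sampling model\<close>

definition iid_pairs ::
  "'a measure \<Rightarrow> nat \<Rightarrow> (nat \<Rightarrow> 'a \<Rightarrow> real) \<Rightarrow> (nat \<Rightarrow> 'a \<Rightarrow> real) \<Rightarrow>
   real measure \<Rightarrow> real measure \<Rightarrow> bool" where
  "iid_pairs M n X Y A B \<longleftrightarrow>
     prob_space M \<and>
     prob_space.indep_vars M (\<lambda>_. borel \<Otimes>\<^sub>M borel) (\<lambda>i \<omega>. (X i \<omega>, Y i \<omega>)) {1..n} \<and>
     (\<forall>i\<in>{1..n}. distr M (borel \<Otimes>\<^sub>M borel) (\<lambda>\<omega>. (X i \<omega>, Y i \<omega>)) = A \<Otimes>\<^sub>M B)"

text \<open>The statistic as a sequence of functions on the sample spaces of a triangular array.\<close>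

definition cb_stat_seq ::
  "(nat \<Rightarrow> nat \<Rightarrow> 'a \<Rightarrow> real) \<Rightarrow> (nat \<Rightarrow> nat \<Rightarrow> 'a \<Rightarrow> real) \<Rightarrow> (real \<times> real \<Rightarrow> real) \<Rightarrow>
   nat \<Rightarrow> 'a \<Rightarrow> real" where
  "cb_stat_seq X Y \<phi> n \<omega> = cb_statistic n (\<lambda>i. X n i \<omega>) (\<lambda>i. Y n i \<omega>) \<phi>"

definition oP1 :: "(nat \<Rightarrow> 'a measure) \<Rightarrow> (nat \<Rightarrow> 'a \<Rightarrow> real) \<Rightarrow> bool" where
  "oP1 M Z \<longleftrightarrow> (\<forall>n. Z n \<in> borel_measurable (M n)) \<and>
     (\<forall>\<delta>>0. (\<lambda>n. measure (M n) {\<omega> \<in> space (M n). \<bar>Z n \<omega>\<bar> > \<delta>}) \<longlonglongrightarrow> 0)"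


section \<open>Asymptotic power\<close>

definition converges_in_law ::
  "(nat \<Rightarrow> 'a measure) \<Rightarrow> (nat \<Rightarrow> 'a \<Rightarrow> real) \<Rightarrow> real measure \<Rightarrow> bool" where
  "converges_in_law M S F \<longleftrightarrow> (\<forall>n. S n \<in> borel_measurable (M n)) \<and>
     weak_conv_m (\<lambda>n. distr (M n) borel (S n)) F"

text \<open>The library's normal density with standard deviation 0 is the zero function, so the
  degenerate case is treated separately.\<close>

definition gaussian :: "real \<Rightarrow> real \<Rightarrow> real measure" where
  "gaussian m \<sigma> = (if \<sigma> = 0 then return borel m else density lborel (normal_density m \<sigma>))"

definition tv_dist :: "real measure \<Rightarrow> real measure \<Rightarrow> real" where
  "tv_dist F G = (SUP C\<in>sets borel. \<bar>measure F C - measure G C\<bar>)"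

definition has_asymptotic_power ::
  "(nat \<Rightarrow> 'a measure) \<Rightarrow> (nat \<Rightarrow> 'a measure) \<Rightarrow> (nat \<Rightarrow> 'a \<Rightarrow> real) \<Rightarrow> real \<Rightarrow> bool" where
  "has_asymptotic_power M\<^sub>0 M\<^sub>a S d \<longleftrightarrow> (\<exists>m\<^sub>0 m\<^sub>a \<sigma>. \<sigma> \<ge> 0 \<and>
     converges_in_law M\<^sub>0 S (gaussian m\<^sub>0 \<sigma>) \<and> converges_in_law M\<^sub>a S (gaussian m\<^sub>a \<sigma>) \<and>
     d = tv_dist (gaussian m\<^sub>0 \<sigma>) (gaussian m\<^sub>a \<sigma>))"

definition asymptotically_most_powerful ::
  "(nat \<Rightarrow> 'a measure) \<Rightarrow> (nat \<Rightarrow> 'a measure) \<Rightarrow>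
   (nat \<Rightarrow> nat \<Rightarrow> 'a \<Rightarrow> real) \<Rightarrow> (nat \<Rightarrow> nat \<Rightarrow> 'a \<Rightarrow> real) \<Rightarrow>
   real measure \<Rightarrow> (real \<times> real \<Rightarrow> real) \<Rightarrow> bool" where
  "asymptotically_most_powerful M\<^sub>0 M\<^sub>a X Y Q \<psi> \<longleftrightarrow>
     \<psi> \<in> L2_space (Q \<Otimes>\<^sub>M Q) \<and>
     (\<exists>d. has_asymptotic_power M\<^sub>0 M\<^sub>a (cb_stat_seq X Y \<psi>) d \<and>
        (\<forall>\<phi> \<in> L2_space (Q \<Otimes>\<^sub>M Q).
           \<exists>d'. has_asymptotic_power M\<^sub>0 M\<^sub>a (cb_stat_seq X Y \<phi>) d' \<and> d' \<le> d))"

end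

theory Submission
  imports Defs
begin

text \<open>The signed measure behind a colour-blind statistic is a finite sum of point masses, so with
  \<open>f\<close> the restriction of \<open>\<phi>\<close> to the triangle, extended symmetrically across the diagonal, and \<open>W\<^sub>i = (X\<^sub>i, Y\<^sub>i)\<close>, the statistic is the sum of
  the \<open>f(W\<^sub>i)\<close> divided by \<open>sqrt n\<close>, minus \<open>sqrt n\<close> times the mean of \<open>f\<close> over all ordered pairs from the
  pooled sample (\<open>cb_statistic_eq\<close>).

  Subtracting the pooled mean cancels the part of \<open>f\<close> that depends on one coordinate only. Let \<open>k\<close> be the
  degenerate part of \<open>f\<close>. What remains is the sum of the \<open>k(W\<^sub>i)\<close> divided by \<open>sqrt n\<close>, plus lower order terms and
  a double sum of a degenerate kernel over distinct observations, whose terms are orthogonal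
  (\<open>degenerate_double_sum_second_moment\<close>). The two marginal laws of an alternative have densities
  \<open>1 + \<eta>\<close> and \<open>1 - \<eta>\<close>, \<open>\<eta> = \<epsilon>\<^sub>n h\<^sub>n\<close>. They add up to \<open>2 Q\<close>, and this does two things: degeneracy persists
  under the alternatives, and both densities are bounded by \<open>2\<close>, so second moments under \<open>Q\<close> suffice. Hence
  under both hypotheses the statistic is the sum of the \<open>k(W\<^sub>i)\<close> divided by \<open>sqrt n\<close>, up to order
  \<open>1 / sqrt n\<close> in mean (\<open>cb_statistic_remainder_bound\<close>).

  As \<open>k\<close> is symmetric, the law of a pair may be replaced by its symmetrisation, with density
  \<open>1 - \<epsilon>\<^sub>n\<^sup>2 h\<^sub>n(x) h\<^sub>n(y)\<close>. The labelled samples may well be asymptotically separable from the null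
  hypothesis, but for symmetric functions the perturbation is of the local order \<open>1 / sqrt n\<close>. With
  \<open>c = lim sqrt n \<epsilon>\<^sub>n\<^sup>2\<close>, expanding characteristic functions
  (\<open>perturbed_characteristic_power_limit\<close>, \<open>cb_statistic_limit_law\<close>) gives the limits \<open>N(0, \<sigma>\<^sup>2)\<close>
  under the null hypothesis and \<open>N(-b, \<sigma>\<^sup>2)\<close> under the alternatives, where \<open>\<sigma>\<close> is the norm of \<open>k\<close> and
  \<open>b\<close> is \<open>c\<close> times the inner product of \<open>k\<close> and \<open>h \<times> h\<close>.

  The total variation distance of two such Gaussian laws is an increasing function of \<open>\<bar>b\<bar> / \<sigma>\<close>
  (\<open>tv_dist_gaussian_zero_mean\<close>). By the Cauchy-Schwarz inequality this quotient is at most \<open>c\<close> times the norm of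
  \<open>h \<times> h\<close>, that is \<open>T\<close>, and \<open>\<phi> = h \<times> h\<close> attains it, because then \<open>k = h \<times> h\<close> almost everywhere
  (\<open>degenerate_part_tensor_square\<close>).\<close>

section \<open>The colour-blind statistic as an explicit double sum\<close>

text \<open>The statistic sees a pair only through its unordered version, so the integrand enters only
  through its restriction to the triangle, reflected in the diagonal.\<close>

definition fold_triangle :: "(real \<times> real \<Rightarrow> real) \<Rightarrow> real \<times> real \<Rightarrow> real" where
  "fold_triangle \<phi> = (\<lambda>(x, y). indicator triangle (x, y) * \<phi> (x, y) + indicator triangle (y, x) * \<phi> (y, x))"

text \<open>Pooling the \<open>2n\<close> coordinates turns the integral of \<open>f\<close> with respect to the squared pooled measure
  into a double sum of this quantity over pairs of observations.\<close>

definition pair_sum :: "(real \<times> real \<Rightarrow> real) \<Rightarrow> real \<times> real \<Rightarrow> real \<times> real \<Rightarrow> real" where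
  "pair_sum f w w' = f (fst w, fst w') + f (fst w, snd w') + f (snd w, fst w') + f (snd w, snd w')"

text \<open>Both parts of the signed measure are finite sums of point masses of equal weight.\<close>

definition atoms :: "'i set \<Rightarrow> real \<Rightarrow> ('i \<Rightarrow> real \<times> real) \<Rightarrow> (real \<times> real) measure" where
  "atoms I w p = distr (point_measure I (\<lambda>_. ennreal w)) borel p"

lemma atoms_measurable: "p \<in> point_measure I g \<rightarrow>\<^sub>M borel"
  by (simp add: measurable_def space_point_measure sets_point_measure)

lemma finite_measure_atoms:
  assumes "finite I" shows "finite_measure (atoms I w p)"
proof -
  have "finite_measure (point_measure I (\<lambda>_. ennreal w))"
    by (rule finite_measureI) (simp add: space_point_measure emeasure_point_measure_finite assms ennreal_mult_eq_top_iff)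
  then show ?thesis
    unfolding atoms_def by (rule finite_measure.finite_measure_distr) (rule atoms_measurable)
qed

lemma sets_atoms: "sets (atoms I w p) = sets borel"
  by (simp add: atoms_def)

lemma atoms_integral:
  fixes g :: "real \<times> real \<Rightarrow> real"
  assumes "finite I" "0 \<le> w" and g: "g \<in> borel_measurable borel"
  shows "integrable (atoms I w p) g" "integral\<^sup>L (atoms I w p) g = w * (\<Sum>i\<in>I. g (p i))"
  unfolding atoms_def
   apply (subst integrable_distr_eq[OF atoms_measurable g])
   apply (rule integrable_point_measure_finite[OF assms(1)])
  apply (subst integral_distr[OF atoms_measurable g])
  apply (subst lebesgue_integral_point_measure_finite)
  using assms by (auto simp: sum_distrib_left)

lemma atoms_measure:
  assumes "finite I" "0 \<le> w" and A: "A \<in> sets borel"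
  shows "measure (atoms I w p) A = w * (\<Sum>i\<in>I. indicator A (p i))"
proof -
  have "measure (atoms I w p) A = integral\<^sup>L (atoms I w p) (indicator A)"
    using A by (simp add: sets_atoms)
  also have "\<dots> = w * (\<Sum>i\<in>I. indicator A (p i))"
    by (rule atoms_integral) (use assms in auto)
  finally show ?thesis .
qed

text \<open>The term \<open>R\<^sub>n(v, v)\<close> depends on \<open>v\<close> alone and has no planar increments. What remains is the
  empirical measure of the pairs and of the reflected pairs, minus twice the square of the pooled
  measure, whose increments over rectangles factorise.\<close>

lemma planar_increment_cb_process:
  assumes ab: "a \<le> b" and cd: "c \<le> d"
  shows "planar_increment (cb_process n x y) a b c d =
    (\<Sum>i = 1..n. indicator ({a<..b} \<times> {c<..d}) (x i, y i) + indicator ({a<..b} \<times> {c<..d}) (y i, x i)) / sqrt n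
    - (\<Sum>i = 1..n. \<Sum>j = 1..n. pair_sum (indicator ({a<..b} \<times> {c<..d})) (x i, y i) (x j, y j))
        / (2 * real n * sqrt n)"
proof (cases "n = 0")
  case True
  then show ?thesis by (simp add: planar_increment_def cb_process_def emp_process_def)
next
  case False
  \<comment> \<open>The increment of the indicator of \<open>u \<le> t\<close> over \<open>(s, t]\<close>; both the joint and the pooled distribution functions are linear in such indicators.\<close>
  define I where "I s t u = (of_bool (u \<le> t) - of_bool (u \<le> s) :: real)" for s t u :: real
  have ind: "indicator ({a<..b} \<times> {c<..d}) (u, v) = I a b u * I c d v" for u v
    using ab cd by (auto simp: I_def indicator_def)
  have joint: "emp_joint n x y b d - emp_joint n x y a d - emp_joint n x y b c + emp_joint n x y a c
      = (\<Sum>i = 1..n. I a b (x i) * I c d (y i)) / n" for x y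
    by (simp add: emp_joint_def I_def of_bool_conj algebra_simps sum.distrib sum_subtractf
        flip: add_divide_distrib diff_divide_distrib)
  define q where "q s t = (\<Sum>i = 1..n. I s t (x i) + I s t (y i))" for s t
  have pooled: "emp_pooled n x y t - emp_pooled n x y s = q s t / (2 * real n)" for s t
    by (simp add: emp_pooled_def emp_marginal_def I_def q_def algebra_simps sum.distrib sum_subtractf
        add_divide_distrib diff_divide_distrib)
  define E where "E s t = emp_joint n x y s t" for s t
  define E' where "E' s t = E t s" for s t
  have E': "E' s t = emp_joint n y x s t" for s t
    by (simp add: E'_def E_def emp_joint_def conj_commute)
  define r where "r = emp_pooled n x y"
  have "planar_increment (cb_process n x y) a b c d = sqrt n *
     ((E b d - E a d - E b c + E a c) + (E' b d - E' a d - E' b c + E' a c)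
      - 2 * (r b - r a) * (r d - r c))"
    unfolding planar_increment_def cb_process_def emp_process_def E_def[symmetric] E'_def
      r_def[symmetric] by (simp add: algebra_simps)
  also have "\<dots> = sqrt n * ((\<Sum>i = 1..n. I a b (x i) * I c d (y i)) / n + (\<Sum>i = 1..n. I a b (y i) * I c d (x i)) / n
      - 2 * (q a b / (2 * real n)) * (q c d / (2 * real n)))"
    unfolding E' unfolding E_def joint r_def pooled by simp
  also have "\<dots> = sqrt n / n * (\<Sum>i = 1..n. I a b (x i) * I c d (y i) + I a b (y i) * I c d (x i))
      - sqrt n / n * (q a b * q c d) / (2 * real n)"
    by (simp add: field_simps sum.distrib) (simp add: add_divide_distrib)
  also have "q a b * q c d = (\<Sum>i = 1..n. \<Sum>j = 1..n. pair_sum (indicator ({a<..b} \<times> {c<..d})) (x i, y i) (x j, y j))"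
    unfolding q_def sum_product pair_sum_def fst_conv snd_conv ind
    by (intro sum.cong refl) (simp add: algebra_simps)
  also have "sqrt n / n = 1 / sqrt n"
    by (simp add: sqrt_divide_self_eq inverse_eq_divide)
  finally show ?thesis unfolding ind by simp
qed

text \<open>Planar increments are prescribed on half-open rectangles, which form a generator stable under
  intersections.\<close>

lemma borel_real_pair_eq_Ioc:
  "sets (borel :: (real \<times> real) measure) = sigma_sets UNIV
    {A \<times> B | A B. A \<in> range (\<lambda>(a, b). {a<..b::real}) \<and> B \<in> range (\<lambda>(a, b). {a<..b::real})}"
proof -
  have "\<exists>E\<subseteq>range (\<lambda>(a, b). {a<..b::real}). countable E \<and> UNIV = \<Union>E"
  proof (intro exI conjI)
    show "UNIV = \<Union>(range (\<lambda>k::nat. {- real k<..real k}))"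
    proof (intro equalityI subsetI)
      fix x :: real
      obtain k :: nat where "\<bar>x\<bar> < real k" using reals_Archimedean2 by blast
      then have "x \<in> {- real k<..real k}" by auto
      then show "x \<in> \<Union>(range (\<lambda>k::nat. {- real k<..real k}))" by blast
    qed simp
  qed auto
  then have "(borel :: (real \<times> real) measure) = sigma (UNIV \<times> UNIV)
      {A \<times> B | A B. A \<in> range (\<lambda>(a, b). {a<..b::real}) \<and> B \<in> range (\<lambda>(a, b). {a<..b::real})}"
    unfolding borel_prod[symmetric] by (subst (1 2) borel_sigma_sets_Ioc, subst sigma_prod) auto
  from arg_cong[OF this, of sets] show ?thesis by (subst (asm) sets_measure_of) auto
qed

definition below_diagonal :: "(real \<times> real) set" where
  "below_diagonal = {(u, v). v < u}"

text \<open>Uniqueness of the signed measure is first shown on a quadrant \<open>{q<..} \<times> {..q}\<close>: it lies below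
  the diagonal, and its intersection with any half-open rectangle is again a half-open rectangle
  below the diagonal, so a Dynkin argument applies. Differences of measures are avoided by moving the
  negative parts to the other side.\<close>

lemma measure_sum_eq_on_quadrant:
  fixes \<mu> \<nu> \<mu>' \<nu>' :: "(real \<times> real) measure" and q :: real
  assumes fin: "finite_measure \<mu>" "finite_measure \<nu>" "finite_measure \<mu>'" "finite_measure \<nu>'"
    and s: "sets \<mu> = sets borel" "sets \<nu> = sets borel" "sets \<mu>' = sets borel" "sets \<nu>' = sets borel"
    and rect: "\<And>a b c d. c \<le> d \<Longrightarrow> d \<le> a \<Longrightarrow> a \<le> b \<Longrightarrow>
      measure \<mu> ({a<..b} \<times> {c<..d}) + measure \<nu> ({a<..b} \<times> {c<..d}) =
      measure \<mu>' ({a<..b} \<times> {c<..d}) + measure \<nu>' ({a<..b} \<times> {c<..d})"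
    and A: "A \<in> sets borel"
  defines "B \<equiv> {q<..} \<times> {..q}"
  shows "measure \<mu> (A \<inter> B) + measure \<nu> (A \<inter> B) = measure \<mu>' (A \<inter> B) + measure \<nu>' (A \<inter> B)"
proof -
  have B: "B \<in> sets borel"
    unfolding B_def by (intro borel_Times) auto
  note [simp] = s
  define R where "R k = {q<..q + real k} \<times> {q - real k<..q}" for k :: nat
  have UR: "(\<Union>k. R k) = B"
  proof safe
    fix u v assume "(u, v) \<in> B"
    moreover obtain k :: nat where "max (u - q) (q - v) < real k" using reals_Archimedean2 by blast
    ultimately show "(u, v) \<in> (\<Union>k. R k)" by (auto simp: B_def R_def intro!: exI[of _ k])
  qed (auto simp: B_def R_def)
  have limR: "(\<lambda>k. measure M (R k)) \<longlonglongrightarrow> measure M B" if "finite_measure M" "sets M = sets borel" for M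
    unfolding UR[symmetric] using that(1)
  proof (rule finite_measure.finite_Lim_measure_incseq)
    show "range R \<subseteq> sets M" unfolding that(2) by (auto simp: R_def intro!: borel_Times)
    show "incseq R" by (auto simp: R_def incseq_def)
  qed
  have B_eq: "measure \<mu> B + measure \<nu> B = measure \<mu>' B + measure \<nu>' B"
  proof (rule LIMSEQ_unique)
    show "(\<lambda>k. measure \<mu> (R k) + measure \<nu> (R k)) \<longlonglongrightarrow> measure \<mu> B + measure \<nu> B"
      by (intro tendsto_add limR fin s)
    have "measure \<mu> (R k) + measure \<nu> (R k) = measure \<mu>' (R k) + measure \<nu>' (R k)" for k
      unfolding R_def by (rule rect) auto
    then show "(\<lambda>k. measure \<mu> (R k) + measure \<nu> (R k)) \<longlonglongrightarrow> measure \<mu>' B + measure \<nu>' B"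
      by (simp, intro tendsto_add limR fin s)
  qed
  have "Int_stable ({C \<times> D | C D. C \<in> range (\<lambda>(a, b). {a<..b::real}) \<and> D \<in> range (\<lambda>(a, b). {a<..b::real})} :: (real \<times> real) set set)" (is "Int_stable ?G")
  proof (rule Int_stableI)
    fix R R' assume "R \<in> ?G" "R' \<in> ?G"
    then obtain a b c d a' b' c' d' where "R = {a<..b} \<times> {c<..d}" "R' = {a'<..b'} \<times> {c'<..d'}" by auto
    then have "R \<inter> R' = {max a a'<..min b b'} \<times> {max c c'<..min d d'}" by auto
    then show "R \<inter> R' \<in> ?G" by force
  qed
  moreover have "?G \<subseteq> Pow UNIV" by simp
  ultimately show ?thesis using A[unfolded borel_real_pair_eq_Ioc]
  proof (induction rule: sigma_sets_induct_disjoint)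
    case (basic A)
    then obtain a b c d where "A = {a<..b} \<times> {c<..d}" by auto
    then have AB: "A \<inter> B = {max a q<..b} \<times> {c<..min d q}" by (auto simp: B_def)
    show ?case
    proof (cases "c \<le> min d q \<and> max a q \<le> b")
      case True
      then show ?thesis unfolding AB by (intro rect) auto
    next
      case False
      then have "A \<inter> B = {}" unfolding AB by auto
      then show ?thesis by simp
    qed
  next
    case (compl A)
    then have A: "A \<in> sets borel" by (simp add: borel_real_pair_eq_Ioc)
    have *: "measure M ((UNIV - A) \<inter> B) = measure M B - measure M (A \<inter> B)"
      if "finite_measure M" "sets M = sets borel" for M
    proof -
      have "(UNIV - A) \<inter> B = B - A \<inter> B" by auto
      then show ?thesis using that A B by (simp add: finite_measure.finite_measure_Diff)
    qed
    show ?case using compl B_eq by (simp add: * fin)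
  next
    case (union A)
    then have A: "A i \<in> sets borel" for i by (auto simp: borel_real_pair_eq_Ioc)
    have *: "(\<lambda>i. measure M (A i \<inter> B)) sums measure M ((\<Union>i. A i) \<inter> B)"
      if "finite_measure M" "sets M = sets borel" for M
    proof -
      have "(\<lambda>i. measure M (A i \<inter> B)) sums measure M (\<Union>i. A i \<inter> B)"
        using that A B union(1)
        by (intro finite_measure.finite_measure_UNION) (auto simp: disjoint_family_on_def, blast)
      also have "(\<Union>i. A i \<inter> B) = (\<Union>i. A i) \<inter> B" by blast
      finally show ?thesis .
    qed
    have "(\<lambda>i. measure \<mu> (A i \<inter> B) + measure \<nu> (A i \<inter> B)) sums
        (measure \<mu> ((\<Union>i. A i) \<inter> B) + measure \<nu> ((\<Union>i. A i) \<inter> B))"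
      by (intro sums_add * fin s)
    moreover have "(\<lambda>i. measure \<mu> (A i \<inter> B) + measure \<nu> (A i \<inter> B)) sums
        (measure \<mu>' ((\<Union>i. A i) \<inter> B) + measure \<nu>' ((\<Union>i. A i) \<inter> B))"
      unfolding union by (intro sums_add * fin s)
    ultimately show ?case by (rule sums_unique2)
  qed auto
qed

text \<open>The open half-plane \<open>v < u\<close> is the countable union of the quadrants with rational corner, since
  a rational number separates \<open>v\<close> from \<open>u\<close>.\<close>

lemma measure_sum_eq_below_diagonal:
  fixes \<mu> \<nu> \<mu>' \<nu>' :: "(real \<times> real) measure"
  assumes fin: "finite_measure \<mu>" "finite_measure \<nu>" "finite_measure \<mu>'" "finite_measure \<nu>'"
    and s: "sets \<mu> = sets borel" "sets \<nu> = sets borel" "sets \<mu>' = sets borel" "sets \<nu>' = sets borel"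
    and rect: "\<And>a b c d. c \<le> d \<Longrightarrow> d \<le> a \<Longrightarrow> a \<le> b \<Longrightarrow>
      measure \<mu> ({a<..b} \<times> {c<..d}) + measure \<nu> ({a<..b} \<times> {c<..d}) =
      measure \<mu>' ({a<..b} \<times> {c<..d}) + measure \<nu>' ({a<..b} \<times> {c<..d})"
    and A: "A \<in> sets borel" "A \<subseteq> below_diagonal"
  shows "measure \<mu> A + measure \<nu> A = measure \<mu>' A + measure \<nu>' A"
proof -
  note [simp] = s
  define q :: "nat \<Rightarrow> real" where "q k = from_nat_into \<rat> k" for k
  define B where "B k = {q k<..} \<times> {..q k}" for k
  have B: "B k \<in> sets borel" for k
    unfolding B_def by (intro borel_Times) auto
  have "\<rat> \<noteq> ({} :: real set)" using Rats_0 by auto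
  then have range_q: "range q = \<rat>"
    unfolding q_def[abs_def] by (intro range_from_nat_into countable_rat)
  have "below_diagonal = (\<Union>k. B k)"
  proof safe
    fix u v assume "(u, v) \<in> below_diagonal"
    then obtain r where "r \<in> \<rat>" "v < r" "r < u"
      using Rats_dense_in_real by (auto simp: below_diagonal_def)
    then obtain k where "r = q k" using range_q by (metis imageE)
    then show "(u, v) \<in> (\<Union>k. B k)" using \<open>v < r\<close> \<open>r < u\<close> by (auto simp: B_def intro!: exI[of _ k])
  qed (auto simp: B_def below_diagonal_def)
  then have A_eq: "A = (\<Union>k. A \<inter> disjointed B k)"
    using A(2) UN_disjointed_eq[of B] by auto
  have D: "disjointed B k \<in> sets borel" for k
    using sets.range_disjointed_sets[of B borel] B by auto
  have *: "(\<lambda>k. measure M (A \<inter> disjointed B k)) sums measure M A"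
    if "finite_measure M" "sets M = sets borel" for M
    apply (subst (2) A_eq)
    using that A(1) D disjoint_family_disjointed[of B]
    by (intro finite_measure.finite_measure_UNION) (auto simp: disjoint_family_on_def, blast)
  have eq: "measure \<mu> (A \<inter> disjointed B k) + measure \<nu> (A \<inter> disjointed B k) =
      measure \<mu>' (A \<inter> disjointed B k) + measure \<nu>' (A \<inter> disjointed B k)" for k
  proof -
    have "disjointed B k \<subseteq> B k" by (rule disjointed_subset)
    then have "A \<inter> disjointed B k = (A \<inter> disjointed B k) \<inter> ({q k<..} \<times> {..q k})"
      by (auto simp: B_def)
    then show ?thesis
      using measure_sum_eq_on_quadrant[OF fin s rect, of "A \<inter> disjointed B k" "q k"] A(1) D by auto
  qed
  have "(\<lambda>k. measure \<mu> (A \<inter> disjointed B k) + measure \<nu> (A \<inter> disjointed B k)) sums (measure \<mu> A + measure \<nu> A)"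
    by (intro sums_add * fin s)
  moreover have "(\<lambda>k. measure \<mu> (A \<inter> disjointed B k) + measure \<nu> (A \<inter> disjointed B k)) sums (measure \<mu>' A + measure \<nu>' A)"
    unfolding eq by (intro sums_add * fin s)
  ultimately show ?thesis by (rule sums_unique2)
qed

text \<open>The identity passes from sets to nonnegative functions by the standard induction. Integrability then
  allows positive and negative parts to be subtracted.\<close>

lemma set_integral_sum_eq:
  fixes \<mu> \<nu> \<mu>' \<nu>' :: "'b measure" and \<phi> :: "'b \<Rightarrow> real"
  assumes fin: "finite_measure \<mu>" "finite_measure \<nu>" "finite_measure \<mu>'" "finite_measure \<nu>'"
    and s: "sets \<mu> = sets S" "sets \<nu> = sets S" "sets \<mu>' = sets S" "sets \<nu>' = sets S"
    and eq: "\<And>A. A \<in> sets S \<Longrightarrow> A \<subseteq> R \<Longrightarrow> measure \<mu> A + measure \<nu> A = measure \<mu>' A + measure \<nu>' A"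
    and R: "R \<in> sets S" and \<phi>: "\<phi> \<in> borel_measurable S"
    and int: "set_integrable \<mu> R \<phi>" "set_integrable \<nu> R \<phi>" "set_integrable \<mu>' R \<phi>" "set_integrable \<nu>' R \<phi>"
  shows "(LINT p:R|\<mu>. \<phi> p) + (LINT p:R|\<nu>. \<phi> p) = (LINT p:R|\<mu>'. \<phi> p) + (LINT p:R|\<nu>'. \<phi> p)"
proof -
  let ?I = "\<lambda>M f. \<integral>\<^sup>+x. f x * indicator R x \<partial>M"
  have sp: "space \<mu> = space S" "space \<nu> = space S" "space \<mu>' = space S" "space \<nu>' = space S"
    using s[THEN sets_eq_imp_space_eq] by simp_all
  have nn: "?I \<mu> f + ?I \<nu> f
      = ?I \<mu>' f + ?I \<nu>' f"
    if "f \<in> borel_measurable S" for f :: "'b \<Rightarrow> ennreal"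
    using that
  proof (induction rule: borel_measurable_induct)
    case (cong f g)
    have "?I M f = ?I M g" if "space M = space S" for M
      using that cong by (intro nn_integral_cong) auto
    then show ?case using cong sp by simp
  next
    case (set A)
    have "(\<integral>\<^sup>+x. indicator A x * indicator R x \<partial>M) = emeasure M (A \<inter> R)" if "sets M = sets S" for M
      using that set R by (simp flip: indicator_inter_arith)
    moreover have "emeasure \<mu> (A \<inter> R) + emeasure \<nu> (A \<inter> R) = emeasure \<mu>' (A \<inter> R) + emeasure \<nu>' (A \<inter> R)"
      using eq[of "A \<inter> R"] set R
      by (simp add: finite_measure.emeasure_eq_measure[OF fin(1)] finite_measure.emeasure_eq_measure[OF fin(2)]
          finite_measure.emeasure_eq_measure[OF fin(3)] finite_measure.emeasure_eq_measure[OF fin(4)]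
          flip: ennreal_plus)
    ultimately show ?case using s by simp
  next
    case (mult u c)
    have "(\<integral>\<^sup>+x. c * u x * indicator R x \<partial>M) = c * ?I M u" if "sets M = sets S" for M
    proof -
      have [measurable]: "u \<in> borel_measurable M" "R \<in> sets M"
        using mult that R by (auto cong: measurable_cong_sets)
      show ?thesis by (simp add: mult.assoc nn_integral_cmult)
    qed
    then show ?case using mult.IH s by (simp flip: distrib_left)
  next
    case (add u v)
    have "(\<integral>\<^sup>+x. (v x + u x) * indicator R x \<partial>M) = ?I M v + ?I M u"
      if "sets M = sets S" for M
    proof -
      have [measurable]: "u \<in> borel_measurable M" "v \<in> borel_measurable M" "R \<in> sets M"
        using add that R by (auto cong: measurable_cong_sets)
      show ?thesis by (simp add: distrib_right nn_integral_add)
    qed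
    then show ?case using add.IH s by (simp add: add_ac)
  next
    case (seq U)
    have "(\<lambda>i. \<integral>\<^sup>+x. U i x * indicator R x \<partial>M) \<longlonglongrightarrow> ?I M (SUP i. U i)"
      if "sets M = sets S" for M
    proof -
      have [measurable]: "\<And>i. U i \<in> borel_measurable M" "R \<in> sets M"
        using seq that R by (auto cong: measurable_cong_sets)
      show ?thesis
      proof (rule nn_integral_LIMSEQ)
        show "incseq (\<lambda>i x. U i x * indicator R x)"
          using \<open>incseq U\<close> by (auto simp: incseq_def le_fun_def intro!: mult_right_mono)
        show "(\<lambda>i. U i x * indicator R x) \<longlonglongrightarrow> (SUP i. U i) x * indicator R x" for x
        proof -
          have "incseq (\<lambda>i. U i x)" using \<open>incseq U\<close> by (auto simp: incseq_def le_fun_def)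
          from LIMSEQ_SUP[OF this] show ?thesis
            by (cases "x \<in> R") (auto simp: SUP_apply image_image)
        qed
      qed auto
    qed
    note lim = this
    show ?case
    proof (rule LIMSEQ_unique)
      show "(\<lambda>i. ?I \<mu> (U i) + ?I \<nu> (U i)) \<longlonglongrightarrow>
        ?I \<mu> (SUP i. U i) + ?I \<nu> (SUP i. U i)"
        by (intro tendsto_add lim s)
      show "(\<lambda>i. ?I \<mu> (U i) + ?I \<nu> (U i)) \<longlonglongrightarrow>
        ?I \<mu>' (SUP i. U i) + ?I \<nu>' (SUP i. U i)"
        unfolding seq.IH by (intro tendsto_add lim s)
    qed
  qed
  have split: "(LINT p:R|M. \<phi> p) = enn2real (?I M (\<lambda>x. ennreal (\<phi> x)))
      - enn2real (?I M (\<lambda>x. ennreal (- \<phi> x)))" (is ?P1)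
    and finp: "?I M (\<lambda>x. ennreal (\<phi> x)) < top"
    and finn: "?I M (\<lambda>x. ennreal (- \<phi> x)) < top" (is ?P2)
    if "set_integrable M R \<phi>" for M
  proof -
    have i: "integrable M (\<lambda>x. indicator R x * \<phi> x)" using that by (simp add: set_integrable_def)
    have p: "ennreal (indicator R x * \<phi> x) = ennreal (\<phi> x) * indicator R x"
      "ennreal (- (indicator R x * \<phi> x)) = ennreal (- \<phi> x) * indicator R x" for x
      by (auto split: split_indicator)
    show ?P1
      using real_lebesgue_integral_def[OF i] by (simp add: set_lebesgue_integral_def p)
    show "?I M (\<lambda>x. ennreal (\<phi> x)) < top"
      ?P2
      using real_integrable_def[THEN iffD1, OF i] by (auto simp: p less_top)
  qed
  have "enn2real (?I \<mu> f) + enn2real (?I \<nu> f)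
      = enn2real (?I \<mu>' f) + enn2real (?I \<nu>' f)"
    if "f = (\<lambda>x. ennreal (\<phi> x)) \<or> f = (\<lambda>x. ennreal (- \<phi> x))" for f
  proof -
    have "f \<in> borel_measurable S" using that \<phi> by auto
    moreover have "?I M f < top" if "set_integrable M R \<phi>" for M
      using finp[OF that] finn[OF that] \<open>f = _ \<or> f = _\<close> by auto
    ultimately show ?thesis using nn[of f] int by (simp flip: enn2real_plus)
  qed
  from this[of "\<lambda>x. ennreal (\<phi> x)"] this[of "\<lambda>x. ennreal (- \<phi> x)"] show ?thesis
    by (simp add: split int)
qed

lemma triangle_sets: "triangle \<in> sets borel"
proof -
  have [measurable]: "fst \<in> borel_measurable (borel :: (real \<times> real) measure)"
    "snd \<in> borel_measurable (borel :: (real \<times> real) measure)"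
    by (intro borel_measurable_continuous_onI continuous_intros)+
  have "triangle = {p. 0 \<le> snd p \<and> snd p < fst p \<and> fst p \<le> (1::real)}" by (auto simp: triangle_def)
  also have "\<dots> \<in> sets borel" by measurable
  finally show ?thesis .
qed

text \<open>Two decompositions \<open>(\<mu>, \<nu>)\<close> and \<open>(\<mu>', \<nu>')\<close> with the same increments satisfy
  \<open>\<mu> + \<nu>' = \<mu>' + \<nu>\<close> below the diagonal, so the value of the integral can be read off from any
  decomposition at hand.\<close>

lemma triangle_integral_eq:
  assumes inc: "increments_below_diagonal F \<mu> \<nu>"
    and int: "set_integrable \<mu> triangle \<phi>" "set_integrable \<nu> triangle \<phi>"
    and \<phi>: "\<phi> \<in> borel_measurable borel"
  shows "triangle_integral F \<phi> = (LINT p:triangle|\<mu>. \<phi> p) - (LINT p:triangle|\<nu>. \<phi> p)"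
  unfolding triangle_integral_def
proof (rule the_equality)
  show "\<exists>\<mu>' \<nu>'. increments_below_diagonal F \<mu>' \<nu>' \<and> set_integrable \<mu>' triangle \<phi> \<and> set_integrable \<nu>' triangle \<phi> \<and>
    (LINT p:triangle|\<mu>. \<phi> p) - (LINT p:triangle|\<nu>. \<phi> p) = (LINT p:triangle|\<mu>'. \<phi> p) - (LINT p:triangle|\<nu>'. \<phi> p)"
    using assms by blast
next
  fix I
  assume "\<exists>\<mu>' \<nu>'. increments_below_diagonal F \<mu>' \<nu>' \<and> set_integrable \<mu>' triangle \<phi> \<and> set_integrable \<nu>' triangle \<phi> \<and>
    I = (LINT p:triangle|\<mu>'. \<phi> p) - (LINT p:triangle|\<nu>'. \<phi> p)"
  then obtain \<mu>' \<nu>' where inc': "increments_below_diagonal F \<mu>' \<nu>'"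
    and int': "set_integrable \<mu>' triangle \<phi>" "set_integrable \<nu>' triangle \<phi>"
    and I: "I = (LINT p:triangle|\<mu>'. \<phi> p) - (LINT p:triangle|\<nu>'. \<phi> p)" by blast
  have fin: "finite_measure \<mu>" "finite_measure \<nu>" "finite_measure \<mu>'" "finite_measure \<nu>'"
    and s: "sets \<mu> = sets borel" "sets \<nu> = sets borel" "sets \<mu>' = sets borel" "sets \<nu>' = sets borel"
    using inc inc' by (simp_all add: increments_below_diagonal_def)
  have "(LINT p:triangle|\<mu>. \<phi> p) + (LINT p:triangle|\<nu>'. \<phi> p) = (LINT p:triangle|\<mu>'. \<phi> p) + (LINT p:triangle|\<nu>. \<phi> p)"
  proof (rule set_integral_sum_eq[where S = borel])
    fix A :: "(real \<times> real) set" assume "A \<in> sets borel" "A \<subseteq> triangle"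
    moreover have "triangle \<subseteq> below_diagonal" by (auto simp: triangle_def below_diagonal_def)
    ultimately have A: "A \<in> sets borel" "A \<subseteq> below_diagonal" by auto
    have rect: "measure \<mu> ({a<..b} \<times> {c<..d}) + measure \<nu>' ({a<..b} \<times> {c<..d}) =
        measure \<mu>' ({a<..b} \<times> {c<..d}) + measure \<nu> ({a<..b} \<times> {c<..d})"
      if "c \<le> d" "d \<le> a" "a \<le> b" for a b c d
    proof -
      have "measure \<mu> ({a<..b} \<times> {c<..d}) - measure \<nu> ({a<..b} \<times> {c<..d}) = planar_increment F a b c d"
        "measure \<mu>' ({a<..b} \<times> {c<..d}) - measure \<nu>' ({a<..b} \<times> {c<..d}) = planar_increment F a b c d"
        using inc inc' that by (simp_all add: increments_below_diagonal_def)
      then show ?thesis by linarith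
    qed
    show "measure \<mu> A + measure \<nu>' A = measure \<mu>' A + measure \<nu> A"
      by (rule measure_sum_eq_below_diagonal[OF fin(1,4,3,2) s(1,4,3,2) rect A])
  qed (rule fin s \<phi> int int' triangle_sets)+
  then show "I = (LINT p:triangle|\<mu>. \<phi> p) - (LINT p:triangle|\<nu>. \<phi> p)" using I by simp
qed

lemma fold_triangle_measurable:
  assumes "\<phi> \<in> borel_measurable borel"
  shows "fold_triangle \<phi> \<in> borel_measurable borel"
proof -
  have swap: "(\<lambda>p :: real \<times> real. (snd p, fst p)) \<in> borel \<rightarrow>\<^sub>M borel"
    by (intro borel_measurable_continuous_onI continuous_intros)
  have g: "(\<lambda>p. indicator triangle p * \<phi> p) \<in> borel_measurable borel"
    using assms triangle_sets by measurable
  have "fold_triangle \<phi> = (\<lambda>p. indicator triangle p * \<phi> p + indicator triangle (snd p, fst p) * \<phi> (snd p, fst p))"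
    by (auto simp: fold_triangle_def)
  also have "\<dots> \<in> borel_measurable borel"
    by (intro borel_measurable_add g measurable_compose[OF swap g])
  finally show ?thesis .
qed

text \<open>The atoms of the signed measure give the statistic as an explicit function of the data. The
  identity holds for every data set, with ties or with values outside the unit interval, so that
  measurability of the statistic and its symmetry in each pair can be read off.\<close>

lemma cb_statistic_eq:
  assumes \<phi>: "\<phi> \<in> borel_measurable borel"
  defines "f \<equiv> fold_triangle \<phi>"
  shows "cb_statistic n x y \<phi> = (\<Sum>i = 1..n. f (x i, y i)) / sqrt n
    - (\<Sum>i = 1..n. \<Sum>j = 1..n. pair_sum f (x i, y i) (x j, y j)) / (4 * real n * sqrt n)"
proof -
  define I where "I = {1..n} \<times> (UNIV :: bool set)"
  define z where "z = (\<lambda>(i, b). if b then x i else y i)"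
  define p where "p = (\<lambda>(i, b). if b then (x i, y i) else (y i, x i))"
  define p' where "p' = (\<lambda>(a, b). (z a, z b))"
  define \<mu> where "\<mu> = atoms I (1 / sqrt n) p"
  define \<nu> where "\<nu> = atoms (I \<times> I) (1 / (2 * real n * sqrt n)) p'"
  have fin: "finite I" "finite (I \<times> I)" by (simp_all add: I_def)
  have w: "0 \<le> 1 / sqrt n" "0 \<le> 1 / (2 * real n * sqrt n)" by simp_all
  have sum\<mu>: "(\<Sum>a\<in>I. g (p a)) = (\<Sum>i = 1..n. g (x i, y i) + g (y i, x i))" for g :: "real \<times> real \<Rightarrow> real"
    unfolding I_def p_def by (simp add: sum.cartesian_product' UNIV_bool add.commute)
  have sum\<nu>: "(\<Sum>c\<in>I \<times> I. g (p' c)) = (\<Sum>i = 1..n. \<Sum>j = 1..n. pair_sum g (x i, y i) (x j, y j))"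
    for g :: "real \<times> real \<Rightarrow> real"
    unfolding I_def p'_def z_def pair_sum_def
    by (simp add: sum.cartesian_product' UNIV_bool sum.distrib algebra_simps)
  have inc: "increments_below_diagonal (cb_process n x y) \<mu> \<nu>"
    unfolding increments_below_diagonal_def
  proof (intro conjI allI impI)
    fix a b c d :: real assume "c \<le> d \<and> d \<le> a \<and> a \<le> b"
    moreover have R: "{a<..b} \<times> {c<..d} \<in> sets borel" by (intro borel_Times) auto
    ultimately show "measure \<mu> ({a<..b} \<times> {c<..d}) - measure \<nu> ({a<..b} \<times> {c<..d}) =
        planar_increment (cb_process n x y) a b c d"
      unfolding \<mu>_def \<nu>_def atoms_measure[OF fin(1) w(1) R] atoms_measure[OF fin(2) w(2) R]
        sum\<mu> sum\<nu> by (simp add: planar_increment_cb_process)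
  qed (simp_all add: \<mu>_def \<nu>_def finite_measure_atoms fin sets_atoms)
  define g where "g = (\<lambda>q. indicator triangle q * \<phi> q)"
  have g: "g \<in> borel_measurable borel"
    unfolding g_def using \<phi> triangle_sets by measurable
  have "set_integrable \<mu> triangle \<phi>" "set_integrable \<nu> triangle \<phi>"
    unfolding set_integrable_def \<mu>_def \<nu>_def using atoms_integral(1)[OF fin(1) w(1) g] atoms_integral(1)[OF fin(2) w(2) g]
    by (simp_all add: g_def)
  then have "cb_statistic n x y \<phi> = (LINT q:triangle|\<mu>. \<phi> q) - (LINT q:triangle|\<nu>. \<phi> q)"
    unfolding cb_statistic_def by (intro triangle_integral_eq inc \<phi>)
  also have "\<dots> = integral\<^sup>L \<mu> g - integral\<^sup>L \<nu> g"
    by (simp add: set_lebesgue_integral_def g_def)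
  also have "\<dots> = (\<Sum>i = 1..n. g (x i, y i) + g (y i, x i)) / sqrt n
     - (\<Sum>i = 1..n. \<Sum>j = 1..n. pair_sum g (x i, y i) (x j, y j)) / (2 * real n * sqrt n)"
    unfolding \<mu>_def \<nu>_def atoms_integral(2)[OF fin(1) w(1) g] atoms_integral(2)[OF fin(2) w(2) g] sum\<mu> sum\<nu> by simp
  also have "(\<Sum>i = 1..n. g (x i, y i) + g (y i, x i)) = (\<Sum>i = 1..n. f (x i, y i))"
    by (simp add: f_def fold_triangle_def g_def)
  finally have eq: "cb_statistic n x y \<phi> = (\<Sum>i = 1..n. f (x i, y i)) / sqrt n
     - (\<Sum>i = 1..n. \<Sum>j = 1..n. pair_sum g (x i, y i) (x j, y j)) / (2 * real n * sqrt n)" .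
  have "(\<Sum>i = 1..n. \<Sum>j = 1..n. pair_sum f (x i, y i) (x j, y j))
     = 2 * (\<Sum>i = 1..n. \<Sum>j = 1..n. pair_sum g (x i, y i) (x j, y j))"
  proof -
    have f: "f (u, v) = g (u, v) + g (v, u)" for u v by (simp add: f_def fold_triangle_def g_def)
    have "pair_sum f w w' = pair_sum g w w' + pair_sum g w' w" for w w'
      by (simp add: pair_sum_def f)
    then have "(\<Sum>i = 1..n. \<Sum>j = 1..n. pair_sum f (x i, y i) (x j, y j))
      = (\<Sum>i = 1..n. \<Sum>j = 1..n. pair_sum g (x i, y i) (x j, y j)) + (\<Sum>i = 1..n. \<Sum>j = 1..n. pair_sum g (x j, y j) (x i, y i))"
      by (simp add: sum.distrib)
    also have "(\<Sum>i = 1..n. \<Sum>j = 1..n. pair_sum g (x j, y j) (x i, y i)) = (\<Sum>i = 1..n. \<Sum>j = 1..n. pair_sum g (x i, y i) (x j, y j))"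
      by (rule sum.swap)
    finally show ?thesis by simp
  qed
  then show ?thesis unfolding eq by simp
qed

section \<open>Square-integrable functions\<close>

lemma square_integrable_mult:
  fixes f g :: "'b \<Rightarrow> real"
  assumes f: "f \<in> borel_measurable M" "integrable M (\<lambda>x. (f x)\<^sup>2)"
    and g: "g \<in> borel_measurable M" "integrable M (\<lambda>x. (g x)\<^sup>2)"
  shows "integrable M (\<lambda>x. f x * g x)"
proof (rule Bochner_Integration.integrable_bound[where f = "\<lambda>x. (f x)\<^sup>2 + (g x)\<^sup>2"])
  have "\<bar>x * y\<bar> \<le> x\<^sup>2 + y\<^sup>2" for x y :: real
  proof -
    have "2 * (\<bar>x\<bar> * \<bar>y\<bar>) \<le> x\<^sup>2 + y\<^sup>2" using sum_squares_bound[of "\<bar>x\<bar>" "\<bar>y\<bar>"] by simp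
    moreover have "0 \<le> \<bar>x\<bar> * \<bar>y\<bar>" by simp
    ultimately show ?thesis unfolding abs_mult by linarith
  qed
  then show "AE x in M. norm (f x * g x) \<le> norm ((f x)\<^sup>2 + (g x)\<^sup>2)" by auto
qed (use f g in auto)

lemma square_integrable_add:
  fixes f g :: "'b \<Rightarrow> real"
  assumes f: "f \<in> borel_measurable M" "integrable M (\<lambda>x. (f x)\<^sup>2)"
    and g: "g \<in> borel_measurable M" "integrable M (\<lambda>x. (g x)\<^sup>2)"
  shows "integrable M (\<lambda>x. (f x + g x)\<^sup>2)"
proof -
  have "integrable M (\<lambda>x. (f x)\<^sup>2 + (g x)\<^sup>2 + 2 * (f x * g x))"
    using square_integrable_mult[OF assms] f g by simp
  then show ?thesis by (simp add: power2_sum mult.assoc)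
qed

lemma square_integrable_diff:
  fixes f g :: "'b \<Rightarrow> real"
  assumes f: "f \<in> borel_measurable M" "integrable M (\<lambda>x. (f x)\<^sup>2)"
    and g: "g \<in> borel_measurable M" "integrable M (\<lambda>x. (g x)\<^sup>2)"
  shows "integrable M (\<lambda>x. (f x - g x)\<^sup>2)"
  using square_integrable_add[OF f, of "\<lambda>x. - g x"] g by simp

lemma integral_abs_mult_le_L2_norm:
  fixes f g :: "'b \<Rightarrow> real"
  assumes f: "f \<in> borel_measurable M" "integrable M (\<lambda>x. (f x)\<^sup>2)"
    and g: "g \<in> borel_measurable M" "integrable M (\<lambda>x. (g x)\<^sup>2)"
  shows "(\<integral>x. \<bar>f x * g x\<bar> \<partial>M) \<le> L2_norm M f * L2_norm M g"
proof -
  have e: "ennreal \<bar>f x\<bar> ^ 2 = ennreal ((f x)\<^sup>2)" "ennreal \<bar>g x\<bar> ^ 2 = ennreal ((g x)\<^sup>2)"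
    "ennreal \<bar>f x\<bar> * ennreal \<bar>g x\<bar> = ennreal \<bar>f x * g x\<bar>" for x
    by (simp_all add: ennreal_power abs_mult ennreal_mult)
  have i: "integrable M (\<lambda>x. \<bar>f x * g x\<bar>)" using square_integrable_mult[OF assms] by simp
  have "(\<integral>\<^sup>+x. ennreal \<bar>f x\<bar> * ennreal \<bar>g x\<bar> \<partial>M)\<^sup>2
      \<le> (\<integral>\<^sup>+x. ennreal \<bar>f x\<bar> ^ 2 \<partial>M) * (\<integral>\<^sup>+x. ennreal \<bar>g x\<bar> ^ 2 \<partial>M)"
    using f g by (intro Cauchy_Schwarz_nn_integral) auto
  then have "ennreal ((\<integral>x. \<bar>f x * g x\<bar> \<partial>M)\<^sup>2) \<le> ennreal ((\<integral>x. (f x)\<^sup>2 \<partial>M) * (\<integral>x. (g x)\<^sup>2 \<partial>M))"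
    unfolding e using i f g by (simp add: nn_integral_eq_integral ennreal_power ennreal_mult)
  then have "(\<integral>x. \<bar>f x * g x\<bar> \<partial>M)\<^sup>2 \<le> (\<integral>x. (f x)\<^sup>2 \<partial>M) * (\<integral>x. (g x)\<^sup>2 \<partial>M)"
    by (subst (asm) ennreal_le_iff) (auto intro!: mult_nonneg_nonneg)
  then have "sqrt ((\<integral>x. \<bar>f x * g x\<bar> \<partial>M)\<^sup>2) \<le> sqrt ((\<integral>x. (f x)\<^sup>2 \<partial>M) * (\<integral>x. (g x)\<^sup>2 \<partial>M))"
    by (rule real_sqrt_le_mono)
  then show ?thesis by (simp add: L2_norm_def real_sqrt_mult)
qed

section \<open>Double sums of degenerate kernels\<close>

lemma (in prob_space) indep_vars_distr_pair:
  assumes ind: "indep_vars (\<lambda>_. S) W I" and ij: "i \<in> I" "j \<in> I" "i \<noteq> j"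
    and law: "distr M S (W i) = P" "distr M S (W j) = P"
  shows "distr M (P \<Otimes>\<^sub>M P) (\<lambda>z. (W i z, W j z)) = P \<Otimes>\<^sub>M P"
proof -
  have "indep_var (PiM {i} (\<lambda>_. S)) (\<lambda>z. restrict (\<lambda>l. W l z) {i}) (PiM {j} (\<lambda>_. S)) (\<lambda>z. restrict (\<lambda>l. W l z) {j})"
    using ij by (intro indep_var_restrict[OF ind]) auto
  from indep_var_compose[OF this measurable_component_singleton[of i] measurable_component_singleton[of j]]
  have "indep_var S (W i) S (W j)" by (simp add: comp_def)
  then have "distr M S (W i) \<Otimes>\<^sub>M distr M S (W j) = distr M (S \<Otimes>\<^sub>M S) (\<lambda>z. (W i z, W j z))"
    by (simp add: indep_var_distribution_eq)
  moreover have "sets (P \<Otimes>\<^sub>M P) = sets (S \<Otimes>\<^sub>M S)"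
    by (intro sets_pair_measure_cong) (simp_all flip: law(1))
  then have "distr M (S \<Otimes>\<^sub>M S) (\<lambda>z. (W i z, W j z)) = distr M (P \<Otimes>\<^sub>M P) (\<lambda>z. (W i z, W j z))"
    by (intro distr_cong) auto
  ultimately show ?thesis by (simp add: law)
qed

text \<open>If the index \<open>i\<close> occurs only once among \<open>i, j, k, l\<close>, integrating out the observation with that
  index first annihilates the product, by degeneracy of the kernel.\<close>

lemma (in prob_space) degenerate_kernel_orthogonal:
  fixes K :: "'c \<Rightarrow> 'c \<Rightarrow> real"
  assumes ind: "indep_vars (\<lambda>_. S) W I" and I: "i \<in> I" "j \<in> I" "k \<in> I" "l \<in> I"
    and i: "i \<notin> {j, k, l}"
    and law: "\<And>m. m \<in> I \<Longrightarrow> distr M S (W m) = P"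
    and K: "case_prod K \<in> borel_measurable (P \<Otimes>\<^sub>M P)"
    and deg: "AE w in P. (\<integral>w'. K w' w \<partial>P) = 0"
    and int: "integrable M (\<lambda>z. K (W i z) (W j z) * K (W k z) (W l z))"
  shows "(\<integral>z. K (W i z) (W j z) * K (W k z) (W l z) \<partial>M) = 0"
proof -
  have W: "W m \<in> M \<rightarrow>\<^sub>M S" if "m \<in> I" for m using ind that by (simp add: indep_vars_def)
  have sP: "sets P = sets S" using law[OF I(1)] by (metis sets_distr)
  define J where "J = {j, k, l}"
  have iJ: "i \<in> {i}" "j \<in> J" "k \<in> J" "l \<in> J" by (simp_all add: J_def)
  define V where "V B z = restrict (\<lambda>m. W m z) B" for B z
  define N where "N B = distr M (PiM B (\<lambda>_. S)) (V B)" for B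
  have V: "V B \<in> M \<rightarrow>\<^sub>M PiM B (\<lambda>_. S)" if "B \<subseteq> I" for B
    unfolding V_def[abs_def] using W that by (intro measurable_restrict) auto
  have sub: "{i} \<subseteq> I" "J \<subseteq> I" using I by (auto simp: J_def)
  have cmp: "(\<lambda>v. v m) \<in> N B \<rightarrow>\<^sub>M P" if "m \<in> B" for m B
    unfolding N_def using measurable_component_singleton[OF that, of "\<lambda>_. S"] sP by (simp cong: measurable_cong_sets)
  have margin: "distr (N B) P (\<lambda>v. v m) = P" if "m \<in> B" "B \<subseteq> I" for m B
  proof -
    have "distr (N B) P (\<lambda>v. v m) = distr M P ((\<lambda>v. v m) \<circ> V B)"
      unfolding N_def using V[OF that(2)] cmp[OF that(1), unfolded N_def] by (intro distr_distr) (auto cong: measurable_cong_sets)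
    also have "\<dots> = distr M S (W m)"
      using that sP by (intro distr_cong) (auto simp: V_def)
    finally show ?thesis using law that by auto
  qed
  interpret P: prob_space P
    using law[OF I(1)] prob_space_distr[OF W[OF I(1)]] by simp
  interpret N1: prob_space "N {i}" unfolding N_def by (rule prob_space_distr[OF V[OF sub(1)]])
  interpret N: prob_space "N J" unfolding N_def by (rule prob_space_distr[OF V[OF sub(2)]])
  interpret NN: pair_prob_space "N {i}" "N J" ..
  have "indep_var (PiM {i} (\<lambda>_. S)) (V {i}) (PiM J (\<lambda>_. S)) (V J)"
    unfolding V_def[abs_def] using I i by (intro indep_var_restrict[OF ind]) (auto simp: J_def)
  then have NN: "distr M (PiM {i} (\<lambda>_. S) \<Otimes>\<^sub>M PiM J (\<lambda>_. S)) (\<lambda>z. (V {i} z, V J z)) = N {i} \<Otimes>\<^sub>M N J"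
    by (simp add: indep_var_distribution_eq N_def)
  define F where "F u v = K (u i) (v j) * K (v k) (v l)" for u v
  have Fm: "case_prod F \<in> borel_measurable (N {i} \<Otimes>\<^sub>M N J)"
  proof -
    have "case_prod F = (\<lambda>p. case_prod K (fst p i, snd p j) * case_prod K (snd p k, snd p l))"
      by (auto simp: F_def)
    also have "\<dots> \<in> borel_measurable (N {i} \<Otimes>\<^sub>M N J)"
      by (intro borel_measurable_times measurable_compose[OF _ K] measurable_Pair
          measurable_compose[OF measurable_fst cmp] measurable_compose[OF measurable_snd cmp] iJ)
    finally show ?thesis .
  qed
  have sNN: "sets (N {i} \<Otimes>\<^sub>M N J) = sets (PiM {i} (\<lambda>_. S) \<Otimes>\<^sub>M PiM J (\<lambda>_. S))"
    by (intro sets_pair_measure_cong) (simp_all add: N_def)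
  have Fm': "case_prod F \<in> borel_measurable (PiM {i} (\<lambda>_. S) \<Otimes>\<^sub>M PiM J (\<lambda>_. S))"
    using Fm measurable_cong_sets[OF sNN refl] by blast
  have pm: "(\<lambda>z. (V {i} z, V J z)) \<in> M \<rightarrow>\<^sub>M PiM {i} (\<lambda>_. S) \<Otimes>\<^sub>M PiM J (\<lambda>_. S)"
    by (intro measurable_Pair V sub)
  have Fe: "case_prod F (V {i} z, V J z) = K (W i z) (W j z) * K (W k z) (W l z)" for z
    by (simp add: F_def V_def J_def)
  have Fi: "integrable (N {i} \<Otimes>\<^sub>M N J) (case_prod F)"
    unfolding NN[symmetric] using int by (simp only: integrable_distr_eq[OF pm Fm'] Fe)
  have zero: "AE v in N J. (\<integral>u. F u v \<partial>N {i}) = 0"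
  proof -
    have "AE w in distr (N J) P (\<lambda>v. v j). (\<integral>w'. K w' w \<partial>P) = 0"
      unfolding margin[OF iJ(2) sub(2)] by (rule deg)
    from AE_distrD[OF cmp[OF iJ(2)] this] AE_space show ?thesis
    proof eventually_elim
      case (elim v)
      have "v j \<in> space P" using measurable_space[OF cmp[OF iJ(2)]] elim by auto
      then have "(\<lambda>w. K w (v j)) \<in> borel_measurable P"
        using measurable_Pair1[OF K] by simp
      then have "(\<integral>u. K (u i) (v j) \<partial>N {i}) = (\<integral>w. K w (v j) \<partial>distr (N {i}) P (\<lambda>u. u i))"
        by (subst integral_distr[OF cmp]) auto
      also have "\<dots> = 0" unfolding margin[OF iJ(1) sub(1)] by (rule elim)
      finally show ?case by (simp add: F_def)
    qed
  qed
  have "(\<integral>z. K (W i z) (W j z) * K (W k z) (W l z) \<partial>M) = integral\<^sup>L (N {i} \<Otimes>\<^sub>M N J) (case_prod F)"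
    unfolding NN[symmetric] by (simp only: integral_distr[OF pm Fm'] Fe)
  also have "\<dots> = (\<integral>v. (\<integral>u. F u v \<partial>N {i}) \<partial>N J)" by (rule NN.integral_snd[OF Fi, symmetric])
  also have "\<dots> = 0" using zero by (rule integral_eq_zero_AE)
  finally show ?thesis .
qed

text \<open>For two distinct unordered pairs of indices, some index of one is missing from the other, so
  the corresponding terms are orthogonal. Hence the second moment is of the order of the number of
  terms, \<open>n\<^sup>2\<close>, rather than of its square.\<close>

lemma (in prob_space) degenerate_double_sum_second_moment:
  fixes K :: "'c \<Rightarrow> 'c \<Rightarrow> real" and I :: "nat set"
  assumes ind: "indep_vars (\<lambda>_. S) W I" and fin: "finite I"
    and law: "\<And>m. m \<in> I \<Longrightarrow> distr M S (W m) = P"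
    and sq: "integrable (P \<Otimes>\<^sub>M P) (\<lambda>(w, w'). (K w w')\<^sup>2)"
    and K: "case_prod K \<in> borel_measurable (P \<Otimes>\<^sub>M P)"
    and sym: "\<And>w w'. K w w' = K w' w"
    and deg: "AE w in P. (\<integral>w'. K w w' \<partial>P) = 0"
  shows "integrable M (\<lambda>z. (\<Sum>i\<in>I. \<Sum>j\<in>I - {i}. K (W i z) (W j z))\<^sup>2)"
    and "(\<integral>z. (\<Sum>i\<in>I. \<Sum>j\<in>I - {i}. K (W i z) (W j z))\<^sup>2 \<partial>M)
      \<le> 4 * (real (card I))\<^sup>2 * (\<integral>(w, w'). (K w w')\<^sup>2 \<partial>(P \<Otimes>\<^sub>M P))"
proof -
  let ?D = "\<lambda>z. \<Sum>i\<in>I. \<Sum>j\<in>I - {i}. K (W i z) (W j z)"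
  define s where "s = (\<integral>(w, w'). (K w w')\<^sup>2 \<partial>(P \<Otimes>\<^sub>M P))"
  define L where "L = {(i, j). i \<in> I \<and> j \<in> I \<and> i < j}"
  define T where "T a z = K (W (fst a) z) (W (snd a) z)" for a z
  have finL: "finite L" by (rule finite_subset[of _ "I \<times> I"]) (auto simp: L_def fin)
  have W: "W m \<in> M \<rightarrow>\<^sub>M S" if "m \<in> I" for m using ind that by (simp add: indep_vars_def)
  have pairm: "(\<lambda>z. (W i z, W j z)) \<in> M \<rightarrow>\<^sub>M P \<Otimes>\<^sub>M P" if "i \<in> I" "j \<in> I" for i j
  proof -
    have "sets P = sets S" using law[OF that(1)] by (metis sets_distr)
    then show ?thesis using W that by (intro measurable_Pair) (auto cong: measurable_cong_sets)
  qed
  have Tm: "T a \<in> borel_measurable M" if "a \<in> L" for a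
    using measurable_compose[OF pairm K, of "fst a" "snd a"] that by (auto simp: T_def[abs_def] L_def)
  \<comment> \<open>Two different observations are independent, so each term has the second moment of the kernel under the product law.\<close>
  have T2: "integrable M (\<lambda>z. (T a z)\<^sup>2)" "(\<integral>z. (T a z)\<^sup>2 \<partial>M) = s" (is ?P1) if "a \<in> L" for a
  proof -
    have a: "fst a \<in> I" "snd a \<in> I" "fst a \<noteq> snd a" using that by (auto simp: L_def)
    note d = indep_vars_distr_pair[OF ind a law law, OF a(1,2)]
    have m: "(\<lambda>(w, w'). (K w w')\<^sup>2) \<in> borel_measurable (P \<Otimes>\<^sub>M P)" using sq by auto
    show "integrable M (\<lambda>z. (T a z)\<^sup>2)"
      using integrable_distr_eq[OF pairm[OF a(1,2)] m] sq unfolding d by (simp add: T_def)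
    show ?P1
      using integral_distr[OF pairm[OF a(1,2)] m] unfolding d by (simp add: T_def s_def)
  qed
  have Tprod: "integrable M (\<lambda>z. T a z * T b z)" if "a \<in> L" "b \<in> L" for a b
    by (rule square_integrable_mult[OF Tm[OF that(1)] T2(1)[OF that(1)] Tm[OF that(2)] T2(1)[OF that(2)]])
  have deg': "AE w in P. (\<integral>w'. K w' w \<partial>P) = 0" using deg by (simp add: sym[of _ w for w])
  have orth: "(\<integral>z. T a z * T b z \<partial>M) = 0" if ab: "a \<in> L" "b \<in> L" "a \<noteq> b" for a b
  proof -
    obtain i j k l where e: "a = (i, j)" "b = (k, l)" by fastforce
    have I: "i \<in> I" "j \<in> I" "k \<in> I" "l \<in> I" and lt: "i < j" "k < l" using ab by (auto simp: e L_def)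
    have "i \<notin> {j, k, l} \<or> j \<notin> {i, k, l}" using ab lt by (auto simp: e)
    then show ?thesis
    proof
      assume "i \<notin> {j, k, l}"
      from degenerate_kernel_orthogonal[OF ind I this law K deg'] Tprod[OF ab(1,2)]
      show ?thesis by (simp add: T_def e)
    next
      assume j: "j \<notin> {i, k, l}"
      have "T a z * T b z = K (W j z) (W i z) * K (W k z) (W l z)" for z
        unfolding T_def e fst_conv snd_conv sym[of "W i z" "W j z"] ..
      with degenerate_kernel_orthogonal[OF ind I(2,1,3,4) j law K deg'] Tprod[OF ab(1,2)]
      show ?thesis by simp
    qed
  qed
  \<comment> \<open>By symmetry of the kernel each unordered pair of indices occurs twice.\<close>
  have half: "?D z = 2 * (\<Sum>a\<in>L. T a z)" for z
  proof -
    have "?D z = (\<Sum>a\<in>Sigma I (\<lambda>i. I - {i}). T a z)"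
      using fin by (subst sum.Sigma) (auto simp: T_def case_prod_beta)
    also have "Sigma I (\<lambda>i. I - {i}) = L \<union> prod.swap ` L"
    proof (intro equalityI subsetI)
      fix a assume "a \<in> Sigma I (\<lambda>i. I - {i})"
      then obtain i j where a: "a = (i, j)" "i \<in> I" "j \<in> I" "i \<noteq> j" by auto
      show "a \<in> L \<union> prod.swap ` L"
      proof (cases "i < j")
        case False
        then have "(j, i) \<in> L" using a by (auto simp: L_def)
        then show ?thesis using a(1) by (auto intro!: image_eqI[of _ _ "(j, i)"])
      qed (use a in \<open>auto simp: L_def\<close>)
    qed (auto simp: L_def)
    also have "(\<Sum>a\<in>L \<union> prod.swap ` L. T a z) = (\<Sum>a\<in>L. T a z) + (\<Sum>a\<in>prod.swap ` L. T a z)"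
      using finL by (intro sum.union_disjoint) (auto simp: L_def)
    also have "(\<Sum>a\<in>prod.swap ` L. T a z) = (\<Sum>a\<in>L. T a z)"
      by (subst sum.reindex) (auto simp: T_def sym intro!: sum.cong)
    finally show ?thesis by simp
  qed
  have expand: "(?D z)\<^sup>2 = 4 * (\<Sum>a\<in>L. \<Sum>b\<in>L. T a z * T b z)" for z
    unfolding half by (simp add: power2_eq_square sum_product)
  show "integrable M (\<lambda>z. (?D z)\<^sup>2)"
    unfolding expand by (intro integrable_mult_right Bochner_Integration.integrable_sum Tprod)
  have "(\<integral>z. (?D z)\<^sup>2 \<partial>M)
      = 4 * (\<Sum>a\<in>L. \<Sum>b\<in>L. \<integral>z. T a z * T b z \<partial>M)"
    unfolding expand by (simp add: Tprod)
  also have "(\<Sum>a\<in>L. \<Sum>b\<in>L. \<integral>z. T a z * T b z \<partial>M) = (\<Sum>a\<in>L. \<Sum>b\<in>L. if a = b then s else 0)"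
    using orth T2 by (intro sum.cong refl) (auto simp: power2_eq_square)
  also have "\<dots> = card L * s" using finL by simp
  also have "4 * (card L * s) \<le> 4 * (real (card I))\<^sup>2 * s"
  proof -
    have "card L \<le> card (I \<times> I)" by (rule card_mono) (auto simp: L_def fin)
    then have "real (card L) \<le> (real (card I))\<^sup>2"
      by (simp add: card_cartesian_product power2_eq_square flip: of_nat_mult)
    moreover have "0 \<le> s" unfolding s_def by (intro integral_nonneg_AE) auto
    ultimately show ?thesis by (simp add: mult_right_mono)
  qed
  finally show "(\<integral>z. (?D z)\<^sup>2 \<partial>M)
      \<le> 4 * (real (card I))\<^sup>2 * (\<integral>(w, w'). (K w w')\<^sup>2 \<partial>(P \<Otimes>\<^sub>M P))"
    by (simp add: s_def)
qed

section \<open>Centring and the degenerate part of a kernel\<close>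

definition marginal_mean :: "real measure \<Rightarrow> (real \<times> real \<Rightarrow> real) \<Rightarrow> real \<Rightarrow> real" where
  "marginal_mean Q f x = (\<integral>y. f (x, y) \<partial>Q)"

text \<open>For a symmetric kernel, the Hoeffding projection onto the functions with vanishing conditional
  means given either coordinate.\<close>

definition degenerate_part :: "real measure \<Rightarrow> (real \<times> real \<Rightarrow> real) \<Rightarrow> real \<times> real \<Rightarrow> real" where
  "degenerate_part Q f = (\<lambda>(x, y). f (x, y) - marginal_mean Q f x - marginal_mean Q f y + integral\<^sup>L (Q \<Otimes>\<^sub>M Q) f)"

lemma sets_pair_borel:
  fixes A B :: "real measure"
  assumes "sets A = sets borel" "sets B = sets borel"
  shows "sets (A \<Otimes>\<^sub>M B) = sets (borel :: (real \<times> real) measure)"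
  unfolding borel_prod[symmetric] by (rule sets_pair_measure_cong[OF assms])

text \<open>Jensen's inequality, applied to almost every section.\<close>

lemma marginal_mean_square_integrable:
  assumes Q: "prob_space Q" "sets Q = sets borel"
    and f: "f \<in> borel_measurable borel" "integrable (Q \<Otimes>\<^sub>M Q) (\<lambda>p. (f p)\<^sup>2)"
  shows "marginal_mean Q f \<in> borel_measurable Q" "integrable Q (\<lambda>x. (marginal_mean Q f x)\<^sup>2)"
proof -
  interpret Q: prob_space Q by fact
  interpret QQ: pair_prob_space Q Q ..
  have fm[measurable]: "f \<in> borel_measurable (Q \<Otimes>\<^sub>M Q)"
    using f(1) by (simp cong: measurable_cong_sets add: sets_pair_borel Q)
  show m: "marginal_mean Q f \<in> borel_measurable Q"
    unfolding marginal_mean_def[abs_def] by measurable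
  have i2: "integrable Q (\<lambda>x. \<integral>y. (f (x, y))\<^sup>2 \<partial>Q)" by (rule QQ.integrable_fst'[OF f(2)])
  show "integrable Q (\<lambda>x. (marginal_mean Q f x)\<^sup>2)"
  proof (rule Bochner_Integration.integrable_bound[OF i2])
    show "AE x in Q. norm ((marginal_mean Q f x)\<^sup>2) \<le> norm (\<integral>y. (f (x, y))\<^sup>2 \<partial>Q)"
      using QQ.AE_integrable_fst'[OF f(2)] AE_space
    proof eventually_elim
      case (elim x)
      have fx: "(\<lambda>y. f (x, y)) \<in> borel_measurable Q" using elim by measurable
      from Q.square_integrable_imp_integrable[OF fx elim(1)] have "integrable Q (\<lambda>y. f (x, y))" .
      from Q.variance_eq[OF this elim(1)] have "(marginal_mean Q f x)\<^sup>2 \<le> (\<integral>y. (f (x, y))\<^sup>2 \<partial>Q)"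
        using Q.variance_positive[of "\<lambda>y. f (x, y)"] by (simp add: marginal_mean_def)
      then show ?case by simp
    qed
  qed (use m in simp)
qed

lemma degenerate_part_properties:
  assumes Q: "prob_space Q" "sets Q = sets borel"
    and f: "f \<in> borel_measurable borel" "integrable (Q \<Otimes>\<^sub>M Q) (\<lambda>p. (f p)\<^sup>2)"
    and sym: "\<And>x y. f (x, y) = f (y, x)"
  shows "degenerate_part Q f \<in> borel_measurable borel" (is ?P1)
    and "integrable (Q \<Otimes>\<^sub>M Q) (\<lambda>p. (degenerate_part Q f p)\<^sup>2)"
    and "AE x in Q. integrable Q (\<lambda>y. degenerate_part Q f (x, y)) \<and> (\<integral>y. degenerate_part Q f (x, y) \<partial>Q) = 0" (is ?P2)
    and "degenerate_part Q f (x, y) = degenerate_part Q f (y, x)" (is ?P3)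
    and "integral\<^sup>L (Q \<Otimes>\<^sub>M Q) (degenerate_part Q f) = 0"
proof -
  let ?QQ = "Q \<Otimes>\<^sub>M Q"
  interpret Q: prob_space Q by fact
  interpret QQ: pair_prob_space Q Q ..
  define G where "G = marginal_mean Q f"
  define m where "m = integral\<^sup>L ?QQ f"
  define k where "k = degenerate_part Q f"
  have k: "k = (\<lambda>p. f p - G (fst p) - G (snd p) + m)"
    by (auto simp: k_def degenerate_part_def G_def m_def)
  have fm[measurable]: "f \<in> borel_measurable ?QQ"
    using f(1) by (simp cong: measurable_cong_sets add: sets_pair_borel Q)
  have Gm[measurable]: "G \<in> borel_measurable Q" and G2: "integrable Q (\<lambda>x. (G x)\<^sup>2)"
    unfolding G_def by (rule marginal_mean_square_integrable[OF Q f])+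
  have km: "k \<in> borel_measurable ?QQ" unfolding k by measurable
  then show kb: ?P1
    by (simp cong: measurable_cong_sets add: sets_pair_borel Q k_def)
  have Gf: "integrable ?QQ (\<lambda>p. (G (fst p))\<^sup>2)"
    using integrable_distr_eq[of fst "?QQ" Q "\<lambda>x. (G x)\<^sup>2"] G2 by (simp add: Q.distr_pair_fst)
  have Gs: "integrable ?QQ (\<lambda>p. (G (snd p))\<^sup>2)"
    using QQ.integrable_product_swap[OF Gf] by (simp add: case_prod_beta')
  have k2: "integrable ?QQ (\<lambda>p. (k p)\<^sup>2)"
    unfolding k by (intro square_integrable_add square_integrable_diff f Gf Gs) auto
  then show "integrable ?QQ (\<lambda>p. (degenerate_part Q f p)\<^sup>2)" by (simp add: k_def)
  have fi: "integrable ?QQ f" by (rule QQ.P.square_integrable_imp_integrable[OF fm f(2)])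
  have Gi: "integrable Q G" by (rule Q.square_integrable_imp_integrable[OF Gm G2])
  have mG: "m = (\<integral>y. G y \<partial>Q)"
    unfolding m_def G_def marginal_mean_def[abs_def] by (rule QQ.integral_fst'[OF fi, symmetric])
  have deg: "AE x in Q. integrable Q (\<lambda>y. k (x, y)) \<and> (\<integral>y. k (x, y) \<partial>Q) = 0"
    using QQ.AE_integrable_fst'[OF fi]
  proof eventually_elim
    case (elim x)
    have "(\<integral>y. k (x, y) \<partial>Q) = (\<integral>y. f (x, y) \<partial>Q) - G x - (\<integral>y. G y \<partial>Q) + m"
      unfolding k using elim Gi by (simp add: Q.prob_space)
    also have "G x = (\<integral>y. f (x, y) \<partial>Q)" by (simp add: G_def marginal_mean_def)
    finally have "(\<integral>y. k (x, y) \<partial>Q) = 0" unfolding mG by simp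
    then show ?case unfolding k using elim Gi by simp
  qed
  then show ?P2
    by (simp add: k_def)
  show ?P3
    by (simp add: degenerate_part_def sym[of x y])
  have ki: "integrable ?QQ k" by (rule QQ.P.square_integrable_imp_integrable[OF km k2])
  have "integral\<^sup>L ?QQ k = (\<integral>x. (\<integral>y. k (x, y) \<partial>Q) \<partial>Q)" by (rule QQ.integral_fst'[OF ki, symmetric])
  also have "\<dots> = 0" using deg by (intro integral_eq_zero_AE) auto
  finally show "integral\<^sup>L ?QQ (degenerate_part Q f) = 0" by (simp add: k_def)
qed

text \<open>Here \<open>k\<close> arises from \<open>f\<close> by subtracting functions of one coordinate and a constant. Centring by
  the pooled margins removes these: the sum over all pooled pairs contains each one-coordinate term
  with almost the same total weight as the sum over the observed pairs does. The
  kernel \<open>k\<close> survives, once as a sum over observations and once as an off-diagonal double sum; what is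
  left of \<open>f\<close> itself comes from the \<open>n\<close> diagonal terms and carries an additional factor \<open>1 / n\<close>.\<close>

lemma centred_statistic_decomposition:
  fixes f :: "real \<times> real \<Rightarrow> real" and w :: "nat \<Rightarrow> real \<times> real"
  assumes sym: "\<And>x y. f (x, y) = f (y, x)" and diag: "\<And>x. f (x, x) = 0"
    and k: "\<And>x y. k (x, y) = f (x, y) - G x - G y + m"
  shows "(\<Sum>i = 1..n. f (w i)) / sqrt n - (\<Sum>i = 1..n. \<Sum>j = 1..n. pair_sum f (w i) (w j)) / (4 * real n * sqrt n)
    = (\<Sum>i = 1..n. k (w i)) / sqrt n
      + ((\<Sum>i = 1..n. f (w i) / 2 - k (w i)) - (\<Sum>i\<in>{1..n}. \<Sum>j\<in>{1..n} - {i}. pair_sum k (w i) (w j)) / 4) / (n * sqrt n)"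
proof (cases "n = 0")
  case False
  \<comment> \<open>The one-coordinate part of the \<open>i\<close>-th summand; the next facts separate it from \<open>k\<close> in the diagonal and in the off-diagonal terms.\<close>
  define s where "s i = G (fst (w i)) + G (snd (w i))" for i
  define F where "F = (\<Sum>i = 1..n. f (w i))"
  define Z where "Z = (\<Sum>i = 1..n. k (w i))"
  define D where "D = (\<Sum>i\<in>{1..n}. \<Sum>j\<in>{1..n} - {i}. pair_sum k (w i) (w j))"
  define B where "B = (\<Sum>i = 1..n. s i - m)"
  have fk: "f (w i) = k (w i) + (s i - m)" for i
    using k[of "fst (w i)" "snd (w i)"] by (simp add: s_def)
  have FZ: "F = Z + B" unfolding F_def Z_def B_def fk by (rule sum.distrib)
  have same: "pair_sum f (w i) (w i) = 2 * f (w i)" for i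
    using sym[of "snd (w i)" "fst (w i)"] by (simp add: pair_sum_def diag)
  have diff: "pair_sum f (w i) (w j) = pair_sum k (w i) (w j) + 2 * (s i - m) + 2 * (s j - m)" for i j
    by (simp add: pair_sum_def s_def k)
  have "(\<Sum>i = 1..n. \<Sum>j = 1..n. pair_sum f (w i) (w j))
      = (\<Sum>i\<in>{1..n}. pair_sum f (w i) (w i) + (\<Sum>j\<in>{1..n} - {i}. pair_sum f (w i) (w j)))"
    by (intro sum.cong refl sum.remove) auto
  also have "\<dots> = 2 * F + (\<Sum>i\<in>{1..n}. \<Sum>j\<in>{1..n} - {i}. pair_sum f (w i) (w j))"
    by (simp add: sum.distrib same F_def sum_distrib_left)
  also have "(\<Sum>i\<in>{1..n}. \<Sum>j\<in>{1..n} - {i}. pair_sum f (w i) (w j))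
      = D + (\<Sum>i\<in>{1..n}. \<Sum>j\<in>{1..n} - {i}. 2 * (s i - m)) + (\<Sum>i\<in>{1..n}. \<Sum>j\<in>{1..n} - {i}. 2 * (s j - m))"
    by (simp only: diff sum.distrib D_def)
  also have "(\<Sum>i\<in>{1..n}. \<Sum>j\<in>{1..n} - {i}. 2 * (s i - m)) = (\<Sum>i\<in>{1..n}. 2 * (real n - 1) * (s i - m))"
    using False by (intro sum.cong refl) (simp add: card_Diff_singleton of_nat_diff algebra_simps)
  also have "\<dots> = 2 * (real n - 1) * B"
    unfolding B_def by (rule sum_distrib_left[symmetric])
  also have "(\<Sum>i\<in>{1..n}. \<Sum>j\<in>{1..n} - {i}. 2 * (s j - m)) = (\<Sum>i\<in>{1..n}. 2 * B - 2 * (s i - m))"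
    by (intro sum.cong refl) (simp add: sum_diff1 B_def sum_distrib_left)
  also have "\<dots> = 2 * (real n - 1) * B"
  proof -
    have "(\<Sum>i\<in>{1..n}. 2 * (s i - m)) = 2 * B" unfolding B_def by (rule sum_distrib_left[symmetric])
    then show ?thesis unfolding sum_subtractf by (simp add: algebra_simps)
  qed
  finally have all: "(\<Sum>i = 1..n. \<Sum>j = 1..n. pair_sum f (w i) (w j)) = 2 * F + D + 4 * (real n - 1) * B"
    by simp
  have half: "(\<Sum>i = 1..n. f (w i) / 2 - k (w i)) = F / 2 - Z"
    by (simp add: sum_subtractf F_def Z_def sum_divide_distrib)
  show ?thesis
    unfolding all half D_def[symmetric] F_def[symmetric] Z_def[symmetric] FZ
    using False by (simp add: field_simps)
qed simp

lemma fold_triangle_sym: "fold_triangle \<phi> (x, y) = fold_triangle \<phi> (y, x)"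
  by (simp add: fold_triangle_def)

lemma fold_triangle_diag: "fold_triangle \<phi> (x, x) = 0"
  by (simp add: fold_triangle_def triangle_def)

section \<open>Pairs with oppositely tilted laws\<close>

text \<open>With \<open>s = 1\<close> and \<open>s = -1\<close> these are the laws of the two coordinates. The null hypothesis is the case
  \<open>\<eta> = 0\<close>, so that both hypotheses can be treated at once.\<close>

definition tilt :: "real measure \<Rightarrow> (real \<Rightarrow> real) \<Rightarrow> real \<Rightarrow> real measure" where
  "tilt Q \<eta> s = density Q (\<lambda>x. ennreal (1 + s * \<eta> x))"

text \<open>Since both densities are nonnegative and add up to \<open>2\<close>, the perturbation \<open>\<eta>\<close> is bounded by \<open>1\<close>. This
  is what makes square integrability with respect to \<open>Q\<close> sufficient under the alternatives as well.\<close>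

locale opposite_tilts =
  fixes Q :: "real measure" and \<eta> :: "real \<Rightarrow> real"
  assumes Q: "prob_space Q" "sets Q = sets borel"
    and \<eta>_meas: "\<eta> \<in> borel_measurable borel"
    and \<eta>_bound: "\<And>x. \<bar>\<eta> x\<bar> \<le> 1"
    and \<eta>_mean: "(\<integral>x. \<eta> x \<partial>Q) = 0"
begin

sublocale Q: prob_space Q by (rule Q)
sublocale QQ: pair_prob_space Q Q ..

lemma meas_Q[measurable_cong, simp]: "sets Q = sets borel"
  by (rule Q)

lemma space_Q[simp]: "space Q = UNIV"
  using sets_eq_imp_space_eq[OF meas_Q] by simp

lemma \<eta>_measurable[measurable]: "\<eta> \<in> borel_measurable borel"
  by (rule \<eta>_meas)

lemma sets_QQ: "sets (Q \<Otimes>\<^sub>M Q) = sets borel"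
  by (rule sets_pair_borel) (rule Q)+

lemma integrable_\<eta>: "integrable Q \<eta>"
  by (rule Q.integrable_const_bound[of _ 1]) (use \<eta>_bound in auto)

lemma tilt_weight_bounds: "\<bar>s\<bar> \<le> 1 \<Longrightarrow> 0 \<le> 1 + s * \<eta> x" "\<bar>s\<bar> \<le> 1 \<Longrightarrow> 1 + s * \<eta> x \<le> 2"
proof -
  assume "\<bar>s\<bar> \<le> 1"
  then have "\<bar>s * \<eta> x\<bar> \<le> 1" using \<eta>_bound[of x] by (simp add: abs_mult mult_le_one)
  then show "0 \<le> 1 + s * \<eta> x" "1 + s * \<eta> x \<le> 2" by auto
qed

lemma sets_tilt[simp, measurable_cong]: "sets (tilt Q \<eta> s) = sets borel"
  by (simp add: tilt_def)

lemma space_tilt[simp]: "space (tilt Q \<eta> s) = UNIV"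
  using sets_eq_imp_space_eq[OF sets_tilt] by simp

lemma prob_space_tilt:
  assumes "\<bar>s\<bar> \<le> 1" shows "prob_space (tilt Q \<eta> s)"
proof
  have "emeasure (tilt Q \<eta> s) (space (tilt Q \<eta> s)) = (\<integral>\<^sup>+x. ennreal (1 + s * \<eta> x) \<partial>Q)"
    unfolding tilt_def by (subst emeasure_density) (auto intro!: nn_integral_cong split: split_indicator)
  also have "\<dots> = ennreal (\<integral>x. 1 + s * \<eta> x \<partial>Q)"
    using integrable_\<eta> tilt_weight_bounds(1)[OF assms] by (intro nn_integral_eq_integral) auto
  also have "\<dots> = 1" using integrable_\<eta> Q.prob_space by (simp add: \<eta>_mean)
  finally show "emeasure (tilt Q \<eta> s) (space (tilt Q \<eta> s)) = 1" .
qed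

lemma AE_tilt: "AE x in Q. R x \<Longrightarrow> AE x in tilt Q \<eta> s. R x"
  unfolding tilt_def by (subst AE_density) auto

lemma integrable_tilt:
  fixes g :: "real \<Rightarrow> 'c::{banach, second_countable_topology}"
  assumes s: "\<bar>s\<bar> \<le> 1" and g: "integrable Q g"
  shows "integrable (tilt Q \<eta> s) g" "integral\<^sup>L (tilt Q \<eta> s) g = (\<integral>x. g x \<partial>Q) + s *\<^sub>R (\<integral>x. \<eta> x *\<^sub>R g x \<partial>Q)" (is ?P1)
proof -
  have gm[measurable]: "g \<in> borel_measurable Q" using g by auto
  have "integrable Q (\<lambda>x. \<eta> x *\<^sub>R g x)"
  proof (rule Bochner_Integration.integrable_bound[OF g])
    show "AE x in Q. norm (\<eta> x *\<^sub>R g x) \<le> norm (g x)"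
      using \<eta>_bound by (auto intro!: mult_left_le_one_le)
  qed measurable
  then have j: "integrable Q (\<lambda>x. s *\<^sub>R (\<eta> x *\<^sub>R g x))" by (rule integrable_scaleR_right)
  have i: "integrable Q (\<lambda>x. g x + s *\<^sub>R (\<eta> x *\<^sub>R g x))"
    by (rule Bochner_Integration.integrable_add[OF g j])
  have v: "(\<integral>x. g x + s *\<^sub>R (\<eta> x *\<^sub>R g x) \<partial>Q) = (\<integral>x. g x \<partial>Q) + s *\<^sub>R (\<integral>x. \<eta> x *\<^sub>R g x \<partial>Q)"
    unfolding Bochner_Integration.integral_add[OF g j] by (simp del: scaleR_scaleR)
  have e: "(1 + s * \<eta> x) *\<^sub>R g x = g x + s *\<^sub>R (\<eta> x *\<^sub>R g x)" for x
    by (simp add: scaleR_add_left)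
  show "integrable (tilt Q \<eta> s) g"
    unfolding tilt_def using i tilt_weight_bounds(1)[OF s] by (subst integrable_density) (auto simp: e simp del: scaleR_scaleR)
  show ?P1
    unfolding tilt_def using v tilt_weight_bounds(1)[OF s] by (subst integral_density) (auto simp: e simp del: scaleR_scaleR)
qed

abbreviation pair_tilt :: "real \<Rightarrow> real \<Rightarrow> (real \<times> real) measure" where
  "pair_tilt s t \<equiv> tilt Q \<eta> s \<Otimes>\<^sub>M tilt Q \<eta> t"

lemma tilt_pair_density:
  assumes "\<bar>s\<bar> \<le> 1" "\<bar>t\<bar> \<le> 1"
  shows "pair_tilt s t = density (Q \<Otimes>\<^sub>M Q) (\<lambda>p. ennreal ((1 + s * \<eta> (fst p)) * (1 + t * \<eta> (snd p))))"
proof -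
  interpret T: prob_space "tilt Q \<eta> t" by (rule prob_space_tilt) fact
  have "pair_tilt s t = density (Q \<Otimes>\<^sub>M Q) (\<lambda>(x, y). ennreal (1 + s * \<eta> x) * ennreal (1 + t * \<eta> y))"
    unfolding tilt_def
    using T.sigma_finite_measure_axioms[unfolded tilt_def]
    by (intro pair_measure_density Q.sigma_finite_measure_axioms) auto
  also have "(\<lambda>(x, y). ennreal (1 + s * \<eta> x) * ennreal (1 + t * \<eta> y)) = (\<lambda>p. ennreal ((1 + s * \<eta> (fst p)) * (1 + t * \<eta> (snd p))))"
    using tilt_weight_bounds(1) assms by (auto simp: ennreal_mult)
  finally show ?thesis .
qed

text \<open>Each of the densities \<open>1 + s \<eta>\<close> and \<open>1 + t \<eta>\<close> is at most \<open>2\<close>.\<close>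

lemma tilt_pair_domination:
  assumes st: "\<bar>s\<bar> \<le> 1" "\<bar>t\<bar> \<le> 1" and g: "integrable (Q \<Otimes>\<^sub>M Q) (g :: real \<times> real \<Rightarrow> real)" "\<And>p. 0 \<le> g p"
  shows "integrable (pair_tilt s t) g"
    "integral\<^sup>L (pair_tilt s t) g \<le> 4 * integral\<^sup>L (Q \<Otimes>\<^sub>M Q) g"
proof -
  let ?QQ = "Q \<Otimes>\<^sub>M Q"
  define r where "r p = (1 + s * \<eta> (fst p)) * (1 + t * \<eta> (snd p))" for p
  have r: "0 \<le> r p" "r p \<le> 4" for p
    unfolding r_def using tilt_weight_bounds[OF st(1), of "fst p"] tilt_weight_bounds[OF st(2), of "snd p"]
      mult_mono[of "1 + s * \<eta> (fst p)" 2 "1 + t * \<eta> (snd p)" 2] by (auto intro: mult_nonneg_nonneg)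
  have rm[measurable]: "r \<in> borel_measurable ?QQ" unfolding r_def[abs_def] by measurable
  have gm[measurable]: "g \<in> borel_measurable ?QQ" using g by auto
  have i: "integrable ?QQ (\<lambda>p. r p * g p)"
  proof (rule Bochner_Integration.integrable_bound)
    show "integrable ?QQ (\<lambda>p. 4 * g p)" using g by simp
    show "AE p in ?QQ. norm (r p * g p) \<le> norm (4 * g p)"
      using r g(2) by (auto simp: abs_mult intro!: mult_right_mono)
  qed measurable
  have d: "pair_tilt s t = density ?QQ (\<lambda>p. ennreal (r p))"
    unfolding r_def by (rule tilt_pair_density[OF st])
  show "integrable (pair_tilt s t) g"
    unfolding d using i r by (subst integrable_density) auto
  have "integral\<^sup>L (pair_tilt s t) g = (\<integral>p. r p * g p \<partial>?QQ)"
    unfolding d using r by (subst integral_density) auto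
  also have "\<dots> \<le> (\<integral>p. 4 * g p \<partial>?QQ)"
    using i g r by (intro integral_mono) (auto intro!: mult_right_mono)
  finally show "integral\<^sup>L (pair_tilt s t) g \<le> 4 * integral\<^sup>L ?QQ g"
    using g by simp
qed

text \<open>The density \<open>(1 + \<eta>(x)) (1 - \<eta>(y))\<close> has the antisymmetric part \<open>\<eta>(x) - \<eta>(y)\<close>, which a symmetric
  function does not see. This is why the alternatives, whose labelled samples deviate from \<open>Q\<close> at the
  order \<open>\<epsilon>\<^sub>n\<close>, deviate only at the order \<open>\<epsilon>\<^sub>n\<^sup>2\<close> for colour-blind statistics.\<close>

lemma symmetric_integral_opposite_tilts:
  fixes g :: "real \<times> real \<Rightarrow> 'c::{banach, second_countable_topology}"
  assumes g: "integrable (Q \<Otimes>\<^sub>M Q) g" and sym: "\<And>x y. g (x, y) = g (y, x)"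
  shows "integral\<^sup>L (pair_tilt 1 (-1)) g
    = integral\<^sup>L (Q \<Otimes>\<^sub>M Q) g - (\<integral>p. (\<eta> (fst p) * \<eta> (snd p)) *\<^sub>R g p \<partial>(Q \<Otimes>\<^sub>M Q))"
proof -
  let ?QQ = "Q \<Otimes>\<^sub>M Q"
  have [measurable]: "g \<in> borel_measurable ?QQ" using g by auto
  have b1: "integrable ?QQ (\<lambda>p. c p *\<^sub>R g p)" if "c \<in> borel_measurable ?QQ" "\<And>p. \<bar>c p\<bar> \<le> 1" for c
  proof (rule Bochner_Integration.integrable_bound[OF g])
    show "AE p in ?QQ. norm (c p *\<^sub>R g p) \<le> norm (g p)"
      using that by (auto intro!: mult_left_le_one_le)
  qed (use that in measurable)
  have i1: "integrable ?QQ (\<lambda>p. \<eta> (fst p) *\<^sub>R g p)" by (rule b1) (auto simp: \<eta>_bound)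
  have i2: "integrable ?QQ (\<lambda>p. \<eta> (snd p) *\<^sub>R g p)" by (rule b1) (auto simp: \<eta>_bound)
  have i3: "integrable ?QQ (\<lambda>p. (\<eta> (fst p) * \<eta> (snd p)) *\<^sub>R g p)"
    by (rule b1) (auto simp: \<eta>_bound abs_mult intro!: mult_le_one)
  have "integral\<^sup>L ?QQ (\<lambda>p. \<eta> (fst p) *\<^sub>R g p) = integral\<^sup>L ?QQ (\<lambda>(x, y). \<eta> (fst (y, x)) *\<^sub>R g (y, x))"
    by (rule QQ.integral_product_swap[symmetric]) measurable
  also have "\<dots> = integral\<^sup>L ?QQ (\<lambda>p. \<eta> (snd p) *\<^sub>R g p)"
    by (intro Bochner_Integration.integral_cong refl) (auto simp: sym)
  finally have swap: "integral\<^sup>L ?QQ (\<lambda>p. \<eta> (fst p) *\<^sub>R g p) = integral\<^sup>L ?QQ (\<lambda>p. \<eta> (snd p) *\<^sub>R g p)" .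
  have nn: "0 \<le> (1 + 1 * \<eta> (fst p)) * (1 + (-1) * \<eta> (snd p))" for p :: "real \<times> real"
    using tilt_weight_bounds(1)[of 1 "fst p"] tilt_weight_bounds(1)[of "-1" "snd p"] by (intro mult_nonneg_nonneg) auto
  have "integral\<^sup>L (pair_tilt 1 (-1)) g
     = (\<integral>p. ((1 + 1 * \<eta> (fst p)) * (1 + (-1) * \<eta> (snd p))) *\<^sub>R g p \<partial>?QQ)"
    using nn by (subst tilt_pair_density) (auto intro!: integral_density)
  also have "\<dots> = (\<integral>p. g p + \<eta> (fst p) *\<^sub>R g p - \<eta> (snd p) *\<^sub>R g p - (\<eta> (fst p) * \<eta> (snd p)) *\<^sub>R g p \<partial>?QQ)"
    by (intro Bochner_Integration.integral_cong refl) (simp add: algebra_simps)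
  also have "\<dots> = integral\<^sup>L ?QQ g - (\<integral>p. (\<eta> (fst p) * \<eta> (snd p)) *\<^sub>R g p \<partial>?QQ)"
    using g i1 i2 i3 swap by simp
  finally show ?thesis .
qed

lemma distr_tilt_pair:
  assumes "\<bar>s\<bar> \<le> 1" "\<bar>t\<bar> \<le> 1"
  shows "distr (pair_tilt s t) (tilt Q \<eta> s) fst = tilt Q \<eta> s" (is ?P1)
    and "distr (pair_tilt s t) (tilt Q \<eta> t) snd = tilt Q \<eta> t" (is ?P2)
proof -
  interpret S: prob_space "tilt Q \<eta> s" by (rule prob_space_tilt) fact
  interpret T: prob_space "tilt Q \<eta> t" by (rule prob_space_tilt) fact
  interpret ST: pair_prob_space "tilt Q \<eta> s" "tilt Q \<eta> t" ..
  show ?P1 by (rule T.distr_pair_fst)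
  have "distr (pair_tilt s t) (tilt Q \<eta> t) snd
    = distr (distr (pair_tilt t s) (pair_tilt s t) (\<lambda>(x, y). (y, x))) (tilt Q \<eta> t) snd"
    by (subst ST.distr_pair_swap) simp
  also have "\<dots> = distr (pair_tilt t s) (tilt Q \<eta> t) fst"
    by (subst distr_distr) (auto intro!: distr_cong simp: measurable_pair_swap')
  also have "\<dots> = tilt Q \<eta> t" by (rule S.distr_pair_fst)
  finally show ?P2 .
qed

lemma AE_pair_tilt:
  assumes "AE x in Q. R x" "\<bar>s\<bar> \<le> 1" "\<bar>t\<bar> \<le> 1"
  shows "AE w in pair_tilt s t. R (fst w) \<and> R (snd w)"
proof -
  have "AE w in pair_tilt s t. R (fst w)"
    using AE_distrD[of fst "pair_tilt s t" "tilt Q \<eta> s" R] AE_tilt[OF assms(1)]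
    by (simp only: measurable_fst distr_tilt_pair(1)[OF assms(2,3)] simp_thms)
  moreover have "AE w in pair_tilt s t. R (snd w)"
    using AE_distrD[of snd "pair_tilt s t" "tilt Q \<eta> t" R] AE_tilt[OF assms(1)]
    by (simp only: measurable_snd distr_tilt_pair(2)[OF assms(2,3)] simp_thms)
  ultimately show ?thesis by eventually_elim simp
qed

end

lemma fold_triangle_square_integrable:
  assumes Q: "prob_space Q" "sets Q = sets borel"
    and \<phi>: "\<phi> \<in> borel_measurable borel" "integrable (Q \<Otimes>\<^sub>M Q) (\<lambda>p. (\<phi> p)\<^sup>2)"
  shows "integrable (Q \<Otimes>\<^sub>M Q) (\<lambda>p. (fold_triangle \<phi> p)\<^sup>2)"
proof -
  interpret Q: prob_space Q by fact
  interpret QQ: pair_prob_space Q Q ..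
  define g where "g p = indicator triangle p * \<phi> p" for p
  have gb: "g \<in> borel_measurable borel"
    unfolding g_def[abs_def] using \<phi>(1) triangle_sets by measurable
  have gm[measurable]: "g \<in> borel_measurable (Q \<Otimes>\<^sub>M Q)"
    using gb by (simp cong: measurable_cong_sets add: sets_pair_borel Q)
  have g2: "integrable (Q \<Otimes>\<^sub>M Q) (\<lambda>p. (g p)\<^sup>2)"
  proof (rule Bochner_Integration.integrable_bound[OF \<phi>(2)])
    show "AE p in Q \<Otimes>\<^sub>M Q. norm ((g p)\<^sup>2) \<le> norm ((\<phi> p)\<^sup>2)"
      by (auto simp: g_def split: split_indicator)
  qed measurable
  have g2': "integrable (Q \<Otimes>\<^sub>M Q) (\<lambda>p. (g (snd p, fst p))\<^sup>2)"
    using QQ.integrable_product_swap[OF g2] by (simp add: case_prod_beta')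
  have "fold_triangle \<phi> p = g p + g (snd p, fst p)" for p
    by (cases p) (simp add: fold_triangle_def g_def)
  then show ?thesis
    using square_integrable_add[OF gm g2 _ g2'] by simp
qed

lemma pair_sum_sym:
  assumes "\<And>x y. k (x, y) = k (y, x)"
  shows "pair_sum k w w' = pair_sum k w' w"
  using assms[of "fst w"] assms[of "snd w"] by (simp add: pair_sum_def)

lemma pair_sum_square_le:
  "(pair_sum k w w')\<^sup>2 \<le> 4 * pair_sum (\<lambda>p. (k p)\<^sup>2) w w'"
proof -
  have "(a + b + c + d)\<^sup>2 \<le> 4 * (a\<^sup>2 + b\<^sup>2 + c\<^sup>2 + d\<^sup>2)" for a b c d :: real
    using sum_squares_bound[of a b] sum_squares_bound[of a c] sum_squares_bound[of a d]
      sum_squares_bound[of b c] sum_squares_bound[of b d] sum_squares_bound[of c d]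
    by (simp add: power2_eq_square algebra_simps)
  then show ?thesis by (simp add: pair_sum_def)
qed

context opposite_tilts
begin

abbreviation pair_law :: "(real \<times> real) measure" where
  "pair_law \<equiv> pair_tilt 1 (-1)"

sublocale A1: prob_space "tilt Q \<eta> 1" by (rule prob_space_tilt) simp
sublocale A2: prob_space "tilt Q \<eta> (-1)" by (rule prob_space_tilt) simp
sublocale P: pair_prob_space "tilt Q \<eta> 1" "tilt Q \<eta> (-1)" ..

abbreviation two_pairs :: "((real \<times> real) \<times> (real \<times> real)) measure" where
  "two_pairs \<equiv> pair_law \<Otimes>\<^sub>M pair_law"

lemma sets_pair_law: "sets pair_law = sets borel"
  by (rule sets_pair_borel) simp_all

lemma distr_fst_pair_law: "distr pair_law (tilt Q \<eta> 1) fst = tilt Q \<eta> 1"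
  and distr_snd_pair_law: "distr pair_law (tilt Q \<eta> (-1)) snd = tilt Q \<eta> (-1)"
  by (rule distr_tilt_pair; simp)+

text \<open>The coordinates of two independent pairs are independent, with laws that have densities bounded by
  \<open>2\<close> with respect to \<open>Q\<close>; this is applied with \<open>c\<close> and \<open>c'\<close> each equal to \<open>fst\<close> or \<open>snd\<close>.\<close>

lemma coordinates_domination:
  assumes c: "c \<in> pair_law \<rightarrow>\<^sub>M borel" "distr pair_law (tilt Q \<eta> s) c = tilt Q \<eta> s"
    and c': "c' \<in> pair_law \<rightarrow>\<^sub>M borel" "distr pair_law (tilt Q \<eta> t) c' = tilt Q \<eta> t"
    and st: "\<bar>s\<bar> \<le> 1" "\<bar>t\<bar> \<le> 1"
    and g: "integrable (Q \<Otimes>\<^sub>M Q) (g :: real \<times> real \<Rightarrow> real)" "\<And>p. 0 \<le> g p"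
  shows "integrable two_pairs (\<lambda>(w, w'). g (c w, c' w'))" (is ?P1)
    "integral\<^sup>L two_pairs (\<lambda>(w, w'). g (c w, c' w')) \<le> 4 * integral\<^sup>L (Q \<Otimes>\<^sub>M Q) g" (is ?P2)
proof -
  interpret T: prob_space "tilt Q \<eta> t" by (rule prob_space_tilt) fact
  have cm: "c \<in> pair_law \<rightarrow>\<^sub>M tilt Q \<eta> s" "c' \<in> pair_law \<rightarrow>\<^sub>M tilt Q \<eta> t"
    using c(1) c'(1) by (simp_all cong: measurable_cong_sets)
  have law: "pair_tilt s t
      = distr two_pairs (pair_tilt s t) (\<lambda>(w, w'). (c w, c' w'))"
    using pair_measure_distr[OF cm] T.sigma_finite_measure_axioms by (simp add: c c')
  have m: "(\<lambda>(w, w'). (c w, c' w')) \<in> two_pairs \<rightarrow>\<^sub>M pair_tilt s t"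
    using cm by measurable
  have gm: "g \<in> borel_measurable (pair_tilt s t)"
    using tilt_pair_domination(1)[OF st g] by auto
  show ?P1
    using tilt_pair_domination(1)[OF st g] integrable_distr_eq[OF m gm]
    unfolding law[symmetric] by (simp add: case_prod_beta')
  show ?P2
    using tilt_pair_domination(2)[OF st g] integral_distr[OF m gm]
    unfolding law[symmetric] by (simp add: case_prod_beta')
qed

lemma pair_sum_domination:
  assumes g: "integrable (Q \<Otimes>\<^sub>M Q) (g :: real \<times> real \<Rightarrow> real)" "\<And>p. 0 \<le> g p"
  shows "integrable two_pairs (\<lambda>(w, w'). pair_sum g w w')" (is ?P1)
    "integral\<^sup>L two_pairs (\<lambda>(w, w'). pair_sum g w w') \<le> 16 * integral\<^sup>L (Q \<Otimes>\<^sub>M Q) g" (is ?P2)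
proof -
  have mf: "fst \<in> pair_law \<rightarrow>\<^sub>M borel" "snd \<in> pair_law \<rightarrow>\<^sub>M borel" by measurable
  note F = mf(1) distr_fst_pair_law and S = mf(2) distr_snd_pair_law
  have b: "\<bar>1::real\<bar> \<le> 1" "\<bar>-1::real\<bar> \<le> 1" by simp_all
  note ff = coordinates_domination[OF F F b(1) b(1) g] and fs = coordinates_domination[OF F S b(1) b(2) g]
    and sf = coordinates_domination[OF S F b(2) b(1) g] and ss = coordinates_domination[OF S S b(2) b(2) g]
  have e: "(\<lambda>(w, w'). pair_sum g w w') = (\<lambda>p. (case p of (w, w') \<Rightarrow> g (fst w, fst w')) + (case p of (w, w') \<Rightarrow> g (fst w, snd w'))
    + (case p of (w, w') \<Rightarrow> g (snd w, fst w')) + (case p of (w, w') \<Rightarrow> g (snd w, snd w')))"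
    by (auto simp: pair_sum_def)
  show ?P1
    unfolding e by (intro Bochner_Integration.integrable_add ff fs sf ss)
  have "integral\<^sup>L two_pairs (\<lambda>(w, w'). pair_sum g w w')
    = integral\<^sup>L two_pairs (\<lambda>(w, w'). g (fst w, fst w')) + integral\<^sup>L two_pairs (\<lambda>(w, w'). g (fst w, snd w'))
      + integral\<^sup>L two_pairs (\<lambda>(w, w'). g (snd w, fst w')) + integral\<^sup>L two_pairs (\<lambda>(w, w'). g (snd w, snd w'))"
    unfolding e by (subst Bochner_Integration.integral_add Bochner_Integration.integrable_add ff fs sf ss;
        (intro Bochner_Integration.integrable_add ff fs sf ss)?)+ simp
  then show ?P2
    using ff(2) fs(2) sf(2) ss(2) by simp
qed

text \<open>The two coordinates together have the law \<open>2 Q\<close>, so degeneracy with respect to \<open>Q\<close> is passed on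
  exactly, and not merely approximately, to the alternatives.\<close>

lemma pair_sum_degenerate:
  assumes deg: "AE x in Q. integrable Q (\<lambda>y. k (x, y)) \<and> (\<integral>y. k (x, y) \<partial>Q) = (0::real)"
  shows "AE w in pair_law. (\<integral>w'. pair_sum k w w' \<partial>pair_law) = 0"
proof -
  have "AE w in pair_law. (integrable Q (\<lambda>y. k (fst w, y)) \<and> (\<integral>y. k (fst w, y) \<partial>Q) = 0)
      \<and> (integrable Q (\<lambda>y. k (snd w, y)) \<and> (\<integral>y. k (snd w, y) \<partial>Q) = 0)"
    by (rule AE_pair_tilt[OF deg]) simp_all
  then show ?thesis
  proof eventually_elim
    case (elim w)
    have *: "integrable pair_law (\<lambda>w'. u (fst w'))" "integrable pair_law (\<lambda>w'. u (snd w'))"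
      "(\<integral>w'. u (fst w') \<partial>pair_law) + (\<integral>w'. u (snd w') \<partial>pair_law) = 2 * (\<integral>y. u y \<partial>Q)"
      if u: "integrable Q u" for u :: "real \<Rightarrow> real"
    proof -
      have um: "u \<in> borel_measurable (tilt Q \<eta> s)" for s using u by auto
      have mf: "fst \<in> pair_law \<rightarrow>\<^sub>M tilt Q \<eta> 1" "snd \<in> pair_law \<rightarrow>\<^sub>M tilt Q \<eta> (-1)" by measurable
      note t1 = integrable_tilt[of 1, OF _ u] and t2 = integrable_tilt[of "-1", OF _ u]
      show "integrable pair_law (\<lambda>w'. u (fst w'))" "integrable pair_law (\<lambda>w'. u (snd w'))"
        using integrable_distr_eq[OF mf(1) um] integrable_distr_eq[OF mf(2) um] t1 t2
        by (simp_all add: distr_fst_pair_law distr_snd_pair_law)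
      show "(\<integral>w'. u (fst w') \<partial>pair_law) + (\<integral>w'. u (snd w') \<partial>pair_law) = 2 * (\<integral>y. u y \<partial>Q)"
        using integral_distr[OF mf(1) um] integral_distr[OF mf(2) um] t1 t2
        by (simp add: distr_fst_pair_law distr_snd_pair_law)
    qed
    have kx: "integrable Q (\<lambda>y. k (fst w, y))" and ky: "integrable Q (\<lambda>y. k (snd w, y))" using elim by auto
    show ?case
      unfolding pair_sum_def using *[OF kx] *[OF ky] elim by simp
  qed
qed

lemma integral_pair_law_abs_le:
  assumes g: "integrable (Q \<Otimes>\<^sub>M Q) (g :: real \<times> real \<Rightarrow> real)"
  shows "integrable pair_law (\<lambda>w. \<bar>g w\<bar>)" "(\<integral>w. \<bar>g w\<bar> \<partial>pair_law) \<le> 4 * (\<integral>p. \<bar>g p\<bar> \<partial>(Q \<Otimes>\<^sub>M Q))"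
  using tilt_pair_domination[of 1 "-1" "\<lambda>p. \<bar>g p\<bar>"] g by simp_all

text \<open>The double sum of the decomposition has second moment of order \<open>n\<^sup>2\<close> and is divided by
  \<open>n * sqrt n\<close>, so the statistic agrees with a normalised sum of independent variables up to order
  \<open>1 / sqrt n\<close> in mean. The bound involves only \<open>Q\<close> and \<open>\<phi>\<close>, hence is uniform over the
  alternatives.\<close>

lemma cb_statistic_remainder_bound:
  fixes X Y :: "nat \<Rightarrow> 'a \<Rightarrow> real"
  assumes iid: "iid_pairs M n X Y (tilt Q \<eta> 1) (tilt Q \<eta> (-1))"
    and \<phi>: "\<phi> \<in> borel_measurable borel" "integrable (Q \<Otimes>\<^sub>M Q) (\<lambda>p. (\<phi> p)\<^sup>2)"
  defines "f \<equiv> fold_triangle \<phi>"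
  defines "k \<equiv> degenerate_part Q f"
  defines "S \<equiv> (\<lambda>z. cb_statistic n (\<lambda>i. X i z) (\<lambda>i. Y i z) \<phi>)"
    and "T \<equiv> (\<lambda>z. (\<Sum>i = 1..n. k (X i z, Y i z)) / sqrt n)"
  shows "S \<in> borel_measurable M" "T \<in> borel_measurable M" "integrable M (\<lambda>z. S z - T z)"
    "(\<integral>z. \<bar>S z - T z\<bar> \<partial>M) \<le> (4 * (\<integral>p. \<bar>f p / 2 - k p\<bar> \<partial>(Q \<Otimes>\<^sub>M Q)) + 1 / 8 + 32 * (\<integral>p. (k p)\<^sup>2 \<partial>(Q \<Otimes>\<^sub>M Q))) / sqrt n"
proof -
  let ?QQ = "Q \<Otimes>\<^sub>M Q"
  interpret M: prob_space M using iid by (simp add: iid_pairs_def)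
  define W where "W i z = (X i z, Y i z)" for i z
  have ind: "M.indep_vars (\<lambda>_. borel \<Otimes>\<^sub>M borel) W {1..n}"
    and law: "\<And>i. i \<in> {1..n} \<Longrightarrow> distr M (borel \<Otimes>\<^sub>M borel) (W i) = pair_law"
    using iid by (simp_all add: iid_pairs_def W_def[abs_def])
  have W: "W i \<in> M \<rightarrow>\<^sub>M borel" if "i \<in> {1..n}" for i
    using ind that by (auto simp: M.indep_vars_def borel_prod)
  have WP: "W i \<in> M \<rightarrow>\<^sub>M borel \<Otimes>\<^sub>M borel" if "i \<in> {1..n}" for i
    using ind that by (auto simp: M.indep_vars_def)
  have fb: "f \<in> borel_measurable borel" unfolding f_def by (rule fold_triangle_measurable[OF \<phi>(1)])
  have f2: "integrable ?QQ (\<lambda>p. (f p)\<^sup>2)" unfolding f_def by (rule fold_triangle_square_integrable[OF Q \<phi>])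
  have fsym: "f (x, y) = f (y, x)" for x y unfolding f_def by (rule fold_triangle_sym)
  note dp = degenerate_part_properties[OF Q fb f2 fsym, folded k_def]
  have kb: "k \<in> borel_measurable borel" by (rule dp(1))
  have k2: "integrable ?QQ (\<lambda>p. (k p)\<^sup>2)" by (rule dp(2))
  have QQm: "g \<in> borel_measurable ?QQ" if "g \<in> borel_measurable borel" for g :: "real \<times> real \<Rightarrow> real"
    using that measurable_cong_sets[OF sets_QQ refl] by blast
  define r where "r p = f p / 2 - k p" for p
  have ri: "integrable ?QQ r"
    unfolding r_def using QQ.P.square_integrable_imp_integrable[OF QQm[OF fb] f2] QQ.P.square_integrable_imp_integrable[OF QQm[OF kb] k2]
    by simp
  have rb: "r \<in> borel_measurable borel" unfolding r_def[abs_def] using fb kb by simp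
  define D where "D z = (\<Sum>i\<in>{1..n}. \<Sum>j\<in>{1..n} - {i}. pair_sum k (W i z) (W j z))" for z
  define \<kappa> where "\<kappa> = (\<integral>p. (k p)\<^sup>2 \<partial>?QQ)"
  define \<rho> where "\<rho> = (\<integral>p. \<bar>r p\<bar> \<partial>?QQ)"
  have ST: "S z - T z = ((\<Sum>i = 1..n. r (W i z)) - D z / 4) / (n * sqrt n)" for z
  proof -
    have "S z = (\<Sum>i = 1..n. f (W i z)) / sqrt n - (\<Sum>i = 1..n. \<Sum>j = 1..n. pair_sum f (W i z) (W j z)) / (4 * real n * sqrt n)"
      unfolding S_def W_def f_def by (rule cb_statistic_eq[OF \<phi>(1)])
    also have "\<dots> = (\<Sum>i = 1..n. k (W i z)) / sqrt n
      + ((\<Sum>i = 1..n. f (W i z) / 2 - k (W i z)) - (\<Sum>i\<in>{1..n}. \<Sum>j\<in>{1..n} - {i}. pair_sum k (W i z) (W j z)) / 4) / (n * sqrt n)"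
      by (rule centred_statistic_decomposition[where G = "marginal_mean Q f" and m = "integral\<^sup>L ?QQ f"])
        (simp_all add: fsym k_def degenerate_part_def f_def fold_triangle_diag, simp add: fold_triangle_sym)
    finally show ?thesis by (simp add: T_def W_def[symmetric] r_def D_def)
  qed
  have Km: "case_prod (pair_sum k) \<in> borel_measurable two_pairs"
  proof -
    have kP: "k \<in> borel_measurable (borel \<Otimes>\<^sub>M borel)" using kb by (simp add: borel_prod)
    have e: "case_prod (pair_sum k) = (\<lambda>p. k (fst (fst p), fst (snd p)) + k (fst (fst p), snd (snd p))
        + k (snd (fst p), fst (snd p)) + k (snd (fst p), snd (snd p)))"
      by (auto simp: pair_sum_def)
    have m: "fst \<in> pair_law \<rightarrow>\<^sub>M borel" "snd \<in> pair_law \<rightarrow>\<^sub>M borel" by measurable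
    show ?thesis unfolding e
      by (intro borel_measurable_add measurable_compose[OF _ kP] measurable_Pair
          measurable_compose[OF measurable_fst m(1)] measurable_compose[OF measurable_fst m(2)]
          measurable_compose[OF measurable_snd m(1)] measurable_compose[OF measurable_snd m(2)])
  qed
  let ?K2 = "\<lambda>(w, w'). (pair_sum k w w')\<^sup>2"
  have K2: "integrable two_pairs ?K2"
    and K2_le: "integral\<^sup>L two_pairs ?K2 \<le> 64 * \<kappa>" (is ?P1)
  proof -
    note d = pair_sum_domination[OF k2]
    have i: "integrable two_pairs (\<lambda>p. 4 * (case p of (w, w') \<Rightarrow> pair_sum (\<lambda>p. (k p)\<^sup>2) w w'))"
      using d(1) by (intro integrable_mult_right) simp
    show K2: "integrable two_pairs ?K2"
    proof (rule Bochner_Integration.integrable_bound[OF i])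
      show "?K2 \<in> borel_measurable two_pairs"
        using borel_measurable_power[OF Km, of 2] by (simp add: case_prod_beta')
      show "AE p in two_pairs. norm (case p of (w, w') \<Rightarrow> (pair_sum k w w')\<^sup>2)
          \<le> norm (4 * (case p of (w, w') \<Rightarrow> pair_sum (\<lambda>p. (k p)\<^sup>2) w w'))"
      proof (intro AE_I2)
        fix p show "norm (case p of (w, w') \<Rightarrow> (pair_sum k w w')\<^sup>2)
          \<le> norm (4 * (case p of (w, w') \<Rightarrow> pair_sum (\<lambda>p. (k p)\<^sup>2) w w'))"
          using pair_sum_square_le[of k "fst p" "snd p"] by (simp add: case_prod_beta')
      qed
    qed
    have "integral\<^sup>L two_pairs ?K2
      \<le> integral\<^sup>L two_pairs (\<lambda>p. 4 * (case p of (w, w') \<Rightarrow> pair_sum (\<lambda>p. (k p)\<^sup>2) w w'))"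
      using K2 i by (rule integral_mono) (auto simp: pair_sum_square_le)
    also have "\<dots> \<le> 64 * \<kappa>" using d(2) by (simp add: \<kappa>_def)
    finally show ?P1 .
  qed
  note D = M.degenerate_double_sum_second_moment[OF ind _ law K2 Km pair_sum_sym[of k, OF dp(4)] pair_sum_degenerate[OF dp(3)]]
  have D2: "integrable M (\<lambda>z. (D z)\<^sup>2)"
    unfolding D_def by (rule D(1)) simp_all
  have "(\<integral>z. (D z)\<^sup>2 \<partial>M) \<le> 4 * (real n)\<^sup>2 * integral\<^sup>L two_pairs ?K2"
    using D(2) unfolding D_def by simp
  also have "\<dots> \<le> 4 * (real n)\<^sup>2 * (64 * \<kappa>)"
    by (intro mult_left_mono K2_le) simp
  finally have ED2: "(\<integral>z. (D z)\<^sup>2 \<partial>M) \<le> 256 * (real n)\<^sup>2 * \<kappa>" by simp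
  have kW: "(\<lambda>z. g (W i z)) \<in> borel_measurable M" if "i \<in> {1..n}" "g \<in> borel_measurable borel" for g :: "real \<times> real \<Rightarrow> real" and i
    by (rule measurable_compose[OF W[OF that(1)] that(2)])
  show Tm: "T \<in> borel_measurable M"
    unfolding T_def W_def[symmetric] using kW[OF _ kb] by measurable
  have Dm: "D \<in> borel_measurable M"
  proof -
    have "(\<lambda>z. pair_sum k (W i z) (W j z)) \<in> borel_measurable M" if "i \<in> {1..n}" "j \<in> {1..n}" for i j
    proof -
      have "(\<lambda>z. (W i z, W j z)) \<in> M \<rightarrow>\<^sub>M two_pairs"
        using W that sets_pair_law by (intro measurable_Pair) (auto cong: measurable_cong_sets)
      from measurable_compose[OF this Km] show ?thesis by simp
    qed
    then show ?thesis unfolding D_def[abs_def] by (intro borel_measurable_sum) auto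
  qed
  have STm: "(\<lambda>z. S z - T z) \<in> borel_measurable M"
    unfolding ST using kW[OF _ rb] Dm by measurable
  then show "S \<in> borel_measurable M" using borel_measurable_add[OF STm Tm] by simp
  have rW: "integrable M (\<lambda>z. \<bar>r (W i z)\<bar>)" (is ?P1) "(\<integral>z. \<bar>r (W i z)\<bar> \<partial>M) \<le> 4 * \<rho>" (is ?P2) if "i \<in> {1..n}" for i
  proof -
    have m: "(\<lambda>p. \<bar>r p\<bar>) \<in> borel_measurable (borel \<Otimes>\<^sub>M borel)" using rb by (simp add: borel_prod)
    show ?P1
      using integrable_distr_eq[OF WP[OF that] m] integral_pair_law_abs_le(1)[OF ri] unfolding law[OF that] by simp
    show ?P2
      using integral_distr[OF WP[OF that] m] integral_pair_law_abs_le(2)[OF ri] unfolding law[OF that] \<rho>_def by simp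
  qed
  define U where "U z = ((\<Sum>i = 1..n. \<bar>r (W i z)\<bar>) + (n + (D z)\<^sup>2 / n) / 8) / (n * sqrt n)" for z
  have Ui: "integrable M U"
    unfolding U_def using rW(1) D2 by (intro integrable_divide Bochner_Integration.integrable_add Bochner_Integration.integrable_sum) auto
  have U: "\<bar>S z - T z\<bar> \<le> U z" for z
  proof (cases "n = 0")
    case False
    \<comment> \<open>The mean of \<open>\<bar>D\<bar>\<close> is bounded through the second moment, with the weight \<open>n\<close> chosen because \<open>D\<close> is of order \<open>n\<close>.\<close>
    have "2 * \<bar>D z\<bar> \<le> n + (D z)\<^sup>2 / n"
    proof -
      have "2 * n * \<bar>D z\<bar> \<le> n\<^sup>2 + (D z)\<^sup>2" using sum_squares_bound[of "real n" "\<bar>D z\<bar>"] by simp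
      then show ?thesis using False by (simp add: field_simps power2_eq_square)
    qed
    moreover have "\<bar>a - d / 4\<bar> \<le> b + c / 8" if "2 * \<bar>d\<bar> \<le> c" "\<bar>a\<bar> \<le> b" for a b c d :: real
      using that by linarith
    ultimately have "\<bar>(\<Sum>i = 1..n. r (W i z)) - D z / 4\<bar> \<le> (\<Sum>i = 1..n. \<bar>r (W i z)\<bar>) + (n + (D z)\<^sup>2 / n) / 8"
      using sum_abs by blast
    then show ?thesis unfolding ST U_def by (simp add: abs_mult divide_right_mono)
  qed (simp add: ST U_def)
  show i: "integrable M (\<lambda>z. S z - T z)"
    by (rule Bochner_Integration.integrable_bound[OF Ui STm]) (use U in \<open>auto intro: order_trans[OF _ abs_ge_self]\<close>)
  have "(\<integral>z. \<bar>S z - T z\<bar> \<partial>M) \<le> (\<integral>z. U z \<partial>M)"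
    using i Ui U by (intro integral_mono) auto
  also have "\<dots> = ((\<Sum>i = 1..n. \<integral>z. \<bar>r (W i z)\<bar> \<partial>M) + (n + (\<integral>z. (D z)\<^sup>2 \<partial>M) / n) / 8) / (n * sqrt n)"
  proof -
    have a: "integrable M (\<lambda>z. \<Sum>i = 1..n. \<bar>r (W i z)\<bar>)" by (intro Bochner_Integration.integrable_sum rW(1))
    have "(\<integral>z. (\<Sum>i = 1..n. \<bar>r (W i z)\<bar>) \<partial>M) = (\<Sum>i = 1..n. \<integral>z. \<bar>r (W i z)\<bar> \<partial>M)"
      by (intro Bochner_Integration.integral_sum rW(1))
    moreover have b: "integrable M (\<lambda>z. (n + (D z)\<^sup>2 / n) / 8)" using D2 by simp
    moreover have "(\<integral>z. (n + (D z)\<^sup>2 / n) / 8 \<partial>M) = (n + (\<integral>z. (D z)\<^sup>2 \<partial>M) / n) / 8"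
      using D2 by (simp add: M.prob_space)
    ultimately show ?thesis
      unfolding U_def by (simp only: integral_divide_zero Bochner_Integration.integral_add[OF a b])
  qed
  also have "\<dots> \<le> ((\<Sum>i = 1..n. 4 * \<rho>) + (n + (256 * (real n)\<^sup>2 * \<kappa>) / n) / 8) / (n * sqrt n)"
    using ED2 by (intro divide_right_mono add_mono sum_mono rW(2)) auto
  also have "\<dots> = (4 * \<rho> + 1 / 8 + 32 * \<kappa>) / sqrt n"
    by (cases "n = 0") (simp_all add: field_simps power2_eq_square)
  finally show "(\<integral>z. \<bar>S z - T z\<bar> \<partial>M)
  \<le> (4 * (\<integral>p. \<bar>f p / 2 - k p\<bar> \<partial>?QQ) + 1 / 8 + 32 * (\<integral>p. (k p)\<^sup>2 \<partial>?QQ)) / sqrt n" by (simp add: \<rho>_def \<kappa>_def r_def)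
qed

end

section \<open>A central limit theorem under shrinking perturbations\<close>

lemma cmod_iexp_minus_one_le: "cmod (iexp x - 1) \<le> \<bar>x\<bar>"
  using iexp_approx1[of x 0] by simp

lemma tendsto_scaled_exp_minus_one:
  fixes z :: complex
  shows "(\<lambda>n. of_nat n * (exp (z / of_nat n) - 1)) \<longlonglongrightarrow> z"
proof (cases "z = 0")
  case False
  have d: "((\<lambda>w. (exp w - 1) / w) \<longlongrightarrow> 1) (at (0::complex))"
    using DERIV_exp[of "0::complex"] by (simp add: DERIV_def)
  have zn: "filterlim (\<lambda>n. z / of_nat n) (at 0) sequentially"
    unfolding filterlim_at
  proof
    show "\<forall>\<^sub>F n in sequentially. z / of_nat n \<in> UNIV \<and> z / of_nat n \<noteq> 0"
      using eventually_gt_at_top[of "0::nat"] by eventually_elim (use False in simp)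
    show "(\<lambda>n. z / of_nat n) \<longlonglongrightarrow> 0"
      by (intro tendsto_divide_0[OF tendsto_const] tendsto_of_nat) 
  qed
  have "(\<lambda>n. z * ((exp (z / of_nat n) - 1) / (z / of_nat n))) \<longlonglongrightarrow> z * 1"
    by (intro tendsto_mult tendsto_const filterlim_compose[OF d zn])
  moreover have "\<forall>\<^sub>F n in sequentially. z * ((exp (z / of_nat n) - 1) / (z / of_nat n)) = of_nat n * (exp (z / of_nat n) - 1)"
    using eventually_gt_at_top[of "0::nat"] by eventually_elim (use False in \<open>simp add: field_simps\<close>)
  ultimately show ?thesis using tendsto_cong by fastforce
qed simp

text \<open>For complex numbers \<open>a\<close> and \<open>b\<close> of modulus at most \<open>1\<close> one has \<open>\<bar>a\<^sup>n - b\<^sup>n\<bar> \<le> n \<bar>a - b\<bar>\<close>; the comparison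
  is made with \<open>b = exp (z / n)\<close>.\<close>

lemma power_tendsto_exp:
  fixes cf :: "nat \<Rightarrow> complex"
  assumes lim: "(\<lambda>n. of_nat n * (cf n - 1)) \<longlonglongrightarrow> z" and le1: "\<And>n. cmod (cf n) \<le> 1" and z: "Re z \<le> 0"
  shows "(\<lambda>n. cf n ^ n) \<longlonglongrightarrow> exp z"
proof -
  have "(\<lambda>n. of_nat n * (cf n - 1) - of_nat n * (exp (z / of_nat n) - 1)) \<longlonglongrightarrow> z - z"
    by (intro tendsto_diff lim tendsto_scaled_exp_minus_one)
  then have lim0: "(\<lambda>n. cmod (of_nat n * (cf n - 1) - of_nat n * (exp (z / of_nat n) - 1))) \<longlonglongrightarrow> 0"
    using tendsto_norm by fastforce
  have "(\<lambda>n. cf n ^ n - exp z) \<longlonglongrightarrow> 0"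
  proof (rule Lim_null_comparison[OF _ lim0])
    show "\<forall>\<^sub>F n in sequentially. cmod (cf n ^ n - exp z) \<le> cmod (of_nat n * (cf n - 1) - of_nat n * (exp (z / of_nat n) - 1))"
      using eventually_gt_at_top[of "0::nat"]
    proof eventually_elim
      case (elim n)
      have e: "exp z = exp (z / of_nat n) ^ n"
        using elim by (simp flip: exp_of_nat_mult)
      have "cmod (exp (z / of_nat n)) \<le> 1"
        using z by (simp add: norm_exp_eq_Re divide_nonpos_nonneg)
      then have "cmod (cf n ^ n - exp z) \<le> n * cmod (cf n - exp (z / of_nat n))"
        unfolding e by (intro norm_power_diff le1)
      also have "\<dots> = cmod (of_nat n * (cf n - exp (z / of_nat n)))" by (simp add: norm_mult)
      also have "of_nat n * (cf n - exp (z / of_nat n)) = of_nat n * (cf n - 1) - of_nat n * (exp (z / of_nat n) - 1)"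
        by (simp add: algebra_simps)
      finally show ?case .
    qed
  qed
  then show ?thesis by (rule LIM_zero_cancel)
qed

lemma scaled_iexp_first_order:
  shows "(\<lambda>n. complex_of_real (sqrt (real n)) * (iexp (x / sqrt (real n)) - 1)) \<longlonglongrightarrow> \<i> * complex_of_real x"
proof -
  let ?R = "\<lambda>n. complex_of_real (sqrt (real n)) * (iexp (x / sqrt (real n)) - 1) - \<i> * complex_of_real x"
  have "(\<lambda>n. x\<^sup>2 / 2 * inverse (sqrt (real n))) \<longlonglongrightarrow> x\<^sup>2 / 2 * 0"
    by (intro tendsto_intros tendsto_inverse_0_at_top filterlim_compose[OF sqrt_at_top filterlim_real_sequentially])
  then have l: "(\<lambda>n. x\<^sup>2 / 2 * inverse (sqrt (real n))) \<longlonglongrightarrow> 0" by simp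
  have "?R \<longlonglongrightarrow> 0"
  proof (rule Lim_null_comparison[OF _ l])
    show "\<forall>\<^sub>F n in sequentially. cmod (?R n)
      \<le> x\<^sup>2 / 2 * inverse (sqrt (real n))"
      using eventually_gt_at_top[of "0::nat"]
    proof eventually_elim
      case (elim n)
      define r where "r = sqrt (real n)"
      have r: "r > 0" using elim by (simp add: r_def)
      have "complex_of_real r * (iexp (x / r) - 1) - \<i> * complex_of_real x = complex_of_real r * (iexp (x / r) - (1 + \<i> * complex_of_real (x / r)))"
        using r by (simp add: algebra_simps)
      also have "cmod \<dots> = r * cmod (iexp (x / r) - (1 + \<i> * complex_of_real (x / r)))"
        using r by (simp add: norm_mult)
      also have "\<dots> \<le> r * (\<bar>x / r\<bar> ^ 2 / 2)"
        using r iexp_approx1[of "x / r" 1] by (intro mult_left_mono) (auto simp: numeral_2_eq_2)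
      also have "\<dots> = x\<^sup>2 / 2 * inverse r" using r by (simp add: power2_eq_square field_simps)
      finally show ?case by (simp add: r_def)
    qed
  qed
  then show ?thesis by (rule LIM_zero_cancel)
qed

lemma scaled_iexp_second_order:
  shows "(\<lambda>n. of_nat n * (iexp (x / sqrt (real n)) - 1 - \<i> * complex_of_real (x / sqrt (real n)))) \<longlonglongrightarrow> complex_of_real (- x\<^sup>2 / 2)"
proof -
  let ?R = "\<lambda>n. of_nat n * (iexp (x / sqrt (real n)) - 1 - \<i> * complex_of_real (x / sqrt (real n))) - complex_of_real (- x\<^sup>2 / 2)"
  have "(\<lambda>n. \<bar>x\<bar> ^ 3 / 6 * inverse (sqrt (real n))) \<longlonglongrightarrow> \<bar>x\<bar> ^ 3 / 6 * 0"
    by (intro tendsto_intros tendsto_inverse_0_at_top filterlim_compose[OF sqrt_at_top filterlim_real_sequentially])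
  then have l: "(\<lambda>n. \<bar>x\<bar> ^ 3 / 6 * inverse (sqrt (real n))) \<longlonglongrightarrow> 0" by simp
  have "?R \<longlonglongrightarrow> 0"
  proof (rule Lim_null_comparison[OF _ l])
    show "\<forall>\<^sub>F n in sequentially. cmod (?R n)
      \<le> \<bar>x\<bar> ^ 3 / 6 * inverse (sqrt (real n))"
      using eventually_gt_at_top[of "0::nat"]
    proof eventually_elim
      case (elim n)
      define r where "r = sqrt (real n)"
      have r: "r > 0" using elim by (simp add: r_def)
      have n: "real n = r\<^sup>2" by (simp add: r_def)
      have nc: "of_nat n = complex_of_real (r\<^sup>2)" using n by (metis of_real_of_nat_eq)
      have sq: "(\<i> * complex_of_real (x / r))\<^sup>2 / 2 = - complex_of_real (x\<^sup>2 / r\<^sup>2 / 2)"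
        by (simp add: power_mult_distrib power_divide)
      have "of_nat n * (iexp (x / r) - 1 - \<i> * complex_of_real (x / r)) - complex_of_real (- x\<^sup>2 / 2)
        = complex_of_real (r\<^sup>2) * (iexp (x / r) - (1 + \<i> * complex_of_real (x / r) + (\<i> * complex_of_real (x / r))\<^sup>2 / 2))"
        unfolding nc sq using r by (simp add: algebra_simps)
      also have "cmod \<dots> = r\<^sup>2 * cmod (iexp (x / r) - (1 + \<i> * complex_of_real (x / r) + (\<i> * complex_of_real (x / r))\<^sup>2 / 2))"
        using r by (simp add: norm_mult norm_power)
      also have "\<dots> \<le> r\<^sup>2 * (\<bar>x / r\<bar> ^ 3 / 6)"
        using iexp_approx1[of "x / r" 2]
        by (intro mult_left_mono) (auto simp: numeral_2_eq_2 numeral_3_eq_3 add.assoc)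
      also have "\<dots> = \<bar>x\<bar> ^ 3 / 6 * inverse r" using r by (simp add: power2_eq_square power3_eq_cube field_simps)
      finally show ?case by (simp add: r_def)
    qed
  qed
  then show ?thesis by (rule LIM_zero_cancel)
qed

text \<open>The central limit theorem under a perturbation of order \<open>1 / sqrt n\<close> of the law: \<open>cf n\<close> is the
  characteristic function at \<open>t / sqrt n\<close> of \<open>k\<close> under the density \<open>1 - e n\<close>. The unperturbed part
  contributes the variance. In the perturbation \<open>n e n (exp (i t k / sqrt n) - 1)\<close> one factor
  \<open>sqrt n\<close> turns \<open>e n\<close> into \<open>g\<close> and the other one turns the exponential into \<open>i t k\<close>, which produces a
  shift of the mean and leaves the variance unchanged.\<close>

lemma perturbed_characteristic_power_limit:
  fixes k g :: "'b \<Rightarrow> real" and e :: "nat \<Rightarrow> 'b \<Rightarrow> real"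
  assumes N: "prob_space N"
    and k: "k \<in> borel_measurable N" "integrable N (\<lambda>p. (k p)\<^sup>2)" "(\<integral>p. k p \<partial>N) = 0"
    and e: "\<And>n. e n \<in> borel_measurable N" "\<And>n p. \<bar>e n p\<bar> \<le> 1" "\<And>n. (\<integral>p. e n p \<partial>N) = 0"
    and g: "g \<in> borel_measurable N" "integrable N (\<lambda>p. k p * g p)"
    and lim: "(\<lambda>n. \<integral>p. \<bar>k p * (sqrt n * e n p - g p)\<bar> \<partial>N) \<longlonglongrightarrow> 0"
    and cf: "\<And>n. cf n = (CLINT p|N. iexp (t / sqrt n * k p)) - (CLINT p|N. e n p *\<^sub>R iexp (t / sqrt n * k p))"
    and cf_le: "\<And>n. cmod (cf n) \<le> 1"
  shows "(\<lambda>n. cf n ^ n) \<longlonglongrightarrow> exp (\<i> * complex_of_real (t * - (\<integral>p. k p * g p \<partial>N)) - complex_of_real (t\<^sup>2 * (\<integral>p. (k p)\<^sup>2 \<partial>N) / 2))"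
proof (rule power_tendsto_exp)
  interpret N: prob_space N by fact
  note [measurable] = k(1) e(1) g(1)
  have ki: "integrable N k" by (rule N.square_integrable_imp_integrable[OF k(1,2)])
  have ei: "integrable N (\<lambda>p. complex_of_real (e n p))" for n
    by (rule N.integrable_const_bound[of _ 1]) (auto simp: e)
  define E where "E n p = iexp (t / sqrt (real n) * k p)" for n :: nat and p
  have Em[measurable]: "E n \<in> borel_measurable N" for n unfolding E_def[abs_def] by measurable
  have normE: "cmod (E n p) = 1" for n p by (simp add: E_def)
  have Ei: "integrable N (E n)" for n
    by (rule N.integrable_const_bound[of _ 1]) (auto simp: normE)
  have eEi: "integrable N (\<lambda>p. e n p *\<^sub>R E n p)" for n
    by (rule N.integrable_const_bound[of _ 1]) (auto simp: normE e)
  let ?J = "CLINT p|N. g p *\<^sub>R (\<i> * complex_of_real (t * k p))"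
  let ?d = "\<lambda>n p. \<bar>k p * (sqrt (real n) * e n p - g p)\<bar>"
  \<comment> \<open>First and second order remainders of the exponential, at the scales \<open>sqrt n\<close> and \<open>n\<close>; both are dominated uniformly in \<open>n\<close>.\<close>
  define a where "a n p = complex_of_real (sqrt (real n)) * (E n p - 1)" for n :: nat and p
  have am[measurable]: "a n \<in> borel_measurable N" for n unfolding a_def[abs_def] by measurable
  have a_le: "cmod (a n p) \<le> \<bar>t\<bar> * \<bar>k p\<bar>" for n p
  proof (cases "n = 0")
    case False
    have "cmod (a n p) = sqrt (real n) * cmod (E n p - 1)" by (simp add: a_def norm_mult)
    also have "\<dots> \<le> sqrt (real n) * \<bar>t / sqrt (real n) * k p\<bar>"
      unfolding E_def by (intro mult_left_mono cmod_iexp_minus_one_le) simp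
    also have "\<dots> = \<bar>t\<bar> * \<bar>k p\<bar>" using False by (simp add: abs_mult)
    finally show ?thesis .
  qed (simp add: a_def)
  have a_lim: "(\<lambda>n. a n p) \<longlonglongrightarrow> \<i> * complex_of_real (t * k p)" for p
    using scaled_iexp_first_order[of "t * k p"] by (simp add: a_def E_def)
  define b where "b n p = of_nat n * (E n p - 1 - \<i> * complex_of_real (t / sqrt (real n) * k p))" for n :: nat and p
  have bm[measurable]: "b n \<in> borel_measurable N" for n unfolding b_def[abs_def] by measurable
  have b_le: "cmod (b n p) \<le> t\<^sup>2 / 2 * (k p)\<^sup>2" for n p
  proof (cases "n = 0")
    case False
    have "cmod (b n p) = n * cmod (E n p - (1 + \<i> * complex_of_real (t / sqrt (real n) * k p)))" 
      by (simp add: b_def norm_mult diff_diff_add)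
    also have "\<dots> \<le> n * (\<bar>t / sqrt (real n) * k p\<bar> ^ 2 / 2)"
      unfolding E_def using iexp_approx1[of "t / sqrt (real n) * k p" 1] by (intro mult_left_mono) (auto simp: numeral_2_eq_2)
    also have "\<dots> = t\<^sup>2 / 2 * (k p)\<^sup>2" using False by (simp add: power_mult_distrib power_divide)
    finally show ?thesis .
  qed (simp add: b_def)
  have b_lim: "(\<lambda>n. b n p) \<longlonglongrightarrow> complex_of_real (- (t * k p)\<^sup>2 / 2)" for p
    using scaled_iexp_second_order[of "t * k p"] by (simp add: b_def E_def)
  have first: "(\<lambda>n. CLINT p|N. b n p) \<longlonglongrightarrow> (CLINT p|N. complex_of_real (- (t * k p)\<^sup>2 / 2))"
    by (rule integral_dominated_convergence[where w = "\<lambda>p. t\<^sup>2 / 2 * (k p)\<^sup>2"])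
       (use k(2) b_lim b_le in auto)
  have ga_le: "norm (g p *\<^sub>R a n p) \<le> \<bar>\<bar>t\<bar> * (k p * g p)\<bar>" for n p
    using mult_left_mono[OF a_le[of n p], of "\<bar>g p\<bar>"] by (simp add: abs_mult mult_ac)
  have gai: "integrable N (\<lambda>p. g p *\<^sub>R a n p)" for n
  proof (rule Bochner_Integration.integrable_bound[where f = "\<lambda>p. \<bar>t\<bar> * (k p * g p)"])
    show "AE p in N. norm (g p *\<^sub>R a n p) \<le> norm (\<bar>t\<bar> * (k p * g p))"
      by (intro AE_I2) (simp only: ga_le real_norm_def)
  qed (use g in auto)
  have eai: "integrable N (\<lambda>p. (sqrt (real n) * e n p) *\<^sub>R a n p)" for n
    by (rule N.integrable_const_bound[of _ "sqrt (real n) * (sqrt (real n) * 2)"])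
       (auto simp: abs_mult a_def norm_mult normE e intro!: mult_mono order_trans[OF norm_triangle_ineq4] mult_left_le)
  have second1: "(\<lambda>n. CLINT p|N. g p *\<^sub>R a n p) \<longlonglongrightarrow> ?J"
  proof (rule integral_dominated_convergence[where w = "\<lambda>p. \<bar>\<bar>t\<bar> * (k p * g p)\<bar>"])
    show "AE p in N. norm (g p *\<^sub>R a n p) \<le> \<bar>\<bar>t\<bar> * (k p * g p)\<bar>" for n
      by (intro AE_I2) (simp only: ga_le real_norm_def)
    show "AE p in N. (\<lambda>n. g p *\<^sub>R a n p) \<longlonglongrightarrow> g p *\<^sub>R (\<i> * complex_of_real (t * k p))"
      by (intro AE_I2 tendsto_intros a_lim)
  qed (use g in auto)
  let ?v = "\<lambda>n p. (sqrt (real n) * e n p - g p) *\<^sub>R a n p"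
  \<comment> \<open>Replacing the scaled perturbation by its limit is free, because \<open>\<bar>a n\<bar> \<le> \<bar>t\<bar> \<bar>k\<bar>\<close>.\<close>
  have second2: "(\<lambda>n. CLINT p|N. ?v n p) \<longlonglongrightarrow> 0"
  proof (rule Lim_null_comparison)
    show "(\<lambda>n. \<bar>t\<bar> * (\<integral>p. ?d n p \<partial>N)) \<longlonglongrightarrow> 0"
      using tendsto_mult_right[OF lim, of "\<bar>t\<bar>"] by (simp add: tendsto_mult_right_zero lim)
    have "integrable N (?d n)" for n
    proof -
      have "integrable N (\<lambda>p. e n p *\<^sub>R k p)"
        by (rule Bochner_Integration.integrable_bound[OF ki]) (use mult_right_mono[OF e(2) abs_ge_zero] in \<open>auto simp: abs_mult\<close>)
      then have "integrable N (\<lambda>p. sqrt (real n) * (e n p * k p) - k p * g p)" using g by simp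
      then have "integrable N (\<lambda>p. k p * (sqrt (real n) * e n p - g p))" by (simp add: algebra_simps)
      then show ?thesis by simp
    qed
    note i = this
    have "cmod (CLINT p|N. ?v n p) \<le> \<bar>t\<bar> * (\<integral>p. ?d n p \<partial>N)" for n
    proof -
      have "cmod (CLINT p|N. ?v n p) \<le> (\<integral>p. cmod (?v n p) \<partial>N)"
        by (rule integral_norm_bound)
      also have "\<dots> \<le> (\<integral>p. \<bar>t\<bar> * ?d n p \<partial>N)"
      proof (rule integral_mono)
        have "integrable N (?v n)"
          using Bochner_Integration.integrable_diff[OF eai[of n] gai[of n]] by (simp only: scaleR_diff_left)
        then show "integrable N (\<lambda>p. cmod (?v n p))" by (rule integrable_norm)
        show "integrable N (\<lambda>p. \<bar>t\<bar> * ?d n p)" using i[of n] by simp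
        show "cmod (?v n p) \<le> \<bar>t\<bar> * ?d n p" for p
          using mult_left_mono[OF a_le[of n p], of "\<bar>sqrt (real n) * e n p - g p\<bar>"] by (simp add: abs_mult mult_ac)
      qed
      finally show ?thesis using i[of n] by simp
    qed
    then show "\<forall>\<^sub>F n in sequentially. cmod (CLINT p|N. ?v n p)
        \<le> \<bar>t\<bar> * (\<integral>p. ?d n p \<partial>N)" by simp
  qed
  have second: "(\<lambda>n. CLINT p|N. (sqrt (real n) * e n p) *\<^sub>R a n p) \<longlonglongrightarrow> ?J"
  proof -
    have "(CLINT p|N. (sqrt (real n) * e n p) *\<^sub>R a n p) = (CLINT p|N. g p *\<^sub>R a n p) + (CLINT p|N. ?v n p)" for n
      unfolding scaleR_diff_left Bochner_Integration.integral_diff[OF eai gai] by simp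
    then show ?thesis using tendsto_add[OF second1 second2] by simp
  qed
  \<comment> \<open>The linear term of the exponential and the constant part of the perturbation integrate to \<open>0\<close>.\<close>
  have eq: "of_nat n * (cf n - 1) = (CLINT p|N. b n p) - (CLINT p|N. (sqrt (real n) * e n p) *\<^sub>R a n p)" for n
  proof -
    have s: "complex_of_real (sqrt (real n)) * complex_of_real (sqrt (real n)) = of_nat n"
      by (simp flip: of_real_mult)
    have "(CLINT p|N. b n p) = of_nat n * ((CLINT p|N. E n p) - 1)"
      unfolding b_def using Ei[of n] ki k(3) N.prob_space by (simp add: of_real_mult)
    moreover have "(CLINT p|N. (sqrt (real n) * e n p) *\<^sub>R a n p) = of_nat n * (CLINT p|N. e n p *\<^sub>R E n p)"
    proof -
      have "(sqrt (real n) * e n p) *\<^sub>R a n p = of_nat n * (e n p *\<^sub>R E n p - complex_of_real (e n p))" for p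
        by (simp add: a_def scaleR_conv_of_real algebra_simps flip: s)
      then have "(CLINT p|N. (sqrt (real n) * e n p) *\<^sub>R a n p) = of_nat n * ((CLINT p|N. e n p *\<^sub>R E n p) - (CLINT p|N. complex_of_real (e n p)))"
        using eEi[of n] ei[of n] by simp
      then show ?thesis using e(3)[of n] by simp
    qed
    ultimately show ?thesis unfolding cf E_def by (simp add: algebra_simps)
  qed
  have "(\<lambda>n. of_nat n * (cf n - 1)) \<longlonglongrightarrow> (CLINT p|N. complex_of_real (- (t * k p)\<^sup>2 / 2)) - ?J"
    unfolding eq by (intro tendsto_diff first second)
  also have "(CLINT p|N. complex_of_real (- (t * k p)\<^sup>2 / 2)) = - complex_of_real (t\<^sup>2 * (\<integral>p. (k p)\<^sup>2 \<partial>N) / 2)"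
    by (subst integral_complex_of_real) (simp add: power_mult_distrib)
  also have "?J = \<i> * complex_of_real (t * (\<integral>p. k p * g p \<partial>N))"
  proof -
    have "g p *\<^sub>R (\<i> * complex_of_real (t * k p)) = \<i> * complex_of_real (t * (k p * g p))" for p
      by (simp add: scaleR_conv_of_real algebra_simps)
    then have "?J = \<i> * (CLINT p|N. complex_of_real (t * (k p * g p)))"
      by simp
    then show ?thesis by (subst (asm) integral_complex_of_real) simp
  qed
  finally show "(\<lambda>n. of_nat n * (cf n - 1)) \<longlonglongrightarrow> \<i> * complex_of_real (t * - (\<integral>p. k p * g p \<partial>N)) - complex_of_real (t\<^sup>2 * (\<integral>p. (k p)\<^sup>2 \<partial>N) / 2)"
    by (simp add: minus_diff_commute)
  show "Re (\<i> * complex_of_real (t * - (\<integral>p. k p * g p \<partial>N)) - complex_of_real (t\<^sup>2 * (\<integral>p. (k p)\<^sup>2 \<partial>N) / 2)) \<le> 0"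
    by (simp add: zero_le_mult_iff)
  show "cmod (cf n) \<le> 1" for n by (rule cf_le)
qed

section \<open>Total variation distance of Gaussian laws\<close>

lemma gaussian_eq_distr:
  assumes "\<sigma> \<ge> 0"
  shows "gaussian m \<sigma> = distr std_normal_distribution borel (\<lambda>x. m + \<sigma> * x)"
proof (cases "\<sigma> = 0")
  case True
  interpret prob_space std_normal_distribution
    using real_dist_normal_dist by (rule real_distribution.axioms)
  show ?thesis using True by (simp add: gaussian_def)
next
  case False
  interpret prob_space std_normal_distribution
    using real_dist_normal_dist by (rule real_distribution.axioms)
  have "distr std_normal_distribution lborel (\<lambda>x. x) = distr std_normal_distribution std_normal_distribution (\<lambda>x. x)"
    by (rule distr_cong) auto
  then have "distributed std_normal_distribution lborel (\<lambda>x. x) std_normal_density"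
    by (simp add: distributed_def)
  from normal_density_affine[OF this, of \<sigma> m] False assms
  have "distributed std_normal_distribution lborel (\<lambda>x. m + \<sigma> * x) (normal_density m \<sigma>)" by simp
  then have "distr std_normal_distribution lborel (\<lambda>x. m + \<sigma> * x) = density lborel (normal_density m \<sigma>)"
    by (simp add: distributed_distr_eq_density)
  moreover have "distr std_normal_distribution lborel (\<lambda>x. m + \<sigma> * x) = distr std_normal_distribution borel (\<lambda>x. m + \<sigma> * x)"
    by (rule distr_cong) auto
  ultimately show ?thesis using False by (simp add: gaussian_def)
qed

lemma real_distribution_gaussian: "\<sigma> \<ge> 0 \<Longrightarrow> real_distribution (gaussian m \<sigma>)"
  unfolding gaussian_eq_distr
  by (intro prob_space.real_distribution_distr real_distribution.axioms(1) real_dist_normal_dist) auto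

lemma char_gaussian:
  assumes "\<sigma> \<ge> 0"
  shows "char (gaussian m \<sigma>) t = exp (\<i> * complex_of_real (t * m) - complex_of_real (t\<^sup>2 * \<sigma>\<^sup>2 / 2))"
proof -
  have "char (gaussian m \<sigma>) t = (CLINT x|std_normal_distribution. iexp (t * (m + \<sigma> * x)))"
    unfolding gaussian_eq_distr[OF assms] char_def by (subst integral_distr) auto
  also have "\<dots> = (CLINT x|std_normal_distribution. iexp (t * m) * iexp ((t * \<sigma>) * x))"
  proof (intro Bochner_Integration.integral_cong refl)
    fix x
    have "t * (m + \<sigma> * x) = t * m + t * \<sigma> * x" by (simp add: algebra_simps)
    then show "iexp (t * (m + \<sigma> * x)) = iexp (t * m) * iexp (t * \<sigma> * x)"
      by (simp only: of_real_add distrib_left exp_add)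
  qed
  also have "\<dots> = iexp (t * m) * char std_normal_distribution (t * \<sigma>)"
    by (simp add: char_def)
  also have "\<dots> = exp (\<i> * complex_of_real (t * m) - complex_of_real (t\<^sup>2 * \<sigma>\<^sup>2 / 2))"
  proof -
    have "char std_normal_distribution (t * \<sigma>) = exp (- complex_of_real (t\<^sup>2 * \<sigma>\<^sup>2 / 2))"
      unfolding char_std_normal_distribution by (simp only: exp_of_real of_real_minus[symmetric] power_mult_distrib minus_divide_left)
    then show ?thesis by (simp only: exp_add[symmetric] diff_conv_add_uminus)
  qed
  finally show ?thesis .
qed

lemma std_normal_atLeast_eq_cdf:
  "measure std_normal_distribution {x..} = cdf std_normal_distribution (- x)"
proof -
  interpret real_distribution std_normal_distribution by (rule real_dist_normal_dist)
  have "emeasure std_normal_distribution {..- x} = (\<integral>\<^sup>+y. ennreal (std_normal_density y) * indicator {..- x} y \<partial>lborel)"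
    by (simp add: emeasure_density)
  also have "\<dots> = (\<integral>\<^sup>+y. ennreal (std_normal_density (0 + (-1) * y)) * indicator {..- x} (0 + (-1) * y) \<partial>lborel)"
    using nn_integral_real_affine[where c = "-1" and t = 0 and
        f = "\<lambda>y. ennreal (std_normal_density y) * indicator {..- x} y"] by simp
  also have "\<dots> = (\<integral>\<^sup>+y. ennreal (std_normal_density y) * indicator {x..} y \<partial>lborel)"
    by (intro nn_integral_cong) (auto simp: std_normal_density_def split: split_indicator)
  also have "\<dots> = emeasure std_normal_distribution {x..}" by (simp add: emeasure_density)
  finally show ?thesis by (simp add: cdf_def measure_def)
qed

lemma std_normal_singleton: "measure std_normal_distribution {x} = 0"
  by (simp add: measure_def emeasure_density nn_integral_indicator_singleton)

lemma cdf_std_normal_minus: "cdf std_normal_distribution (- x) = 1 - cdf std_normal_distribution x"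
proof -
  interpret real_distribution std_normal_distribution by (rule real_dist_normal_dist)
  have "measure std_normal_distribution {x..} = measure std_normal_distribution ({x<..} \<union> {x})"
    by (rule arg_cong[where f = "measure _"]) auto
  also have "\<dots> = measure std_normal_distribution {x<..}"
    by (subst finite_measure_Union) (auto simp: std_normal_singleton)
  also have "{x<..} = space std_normal_distribution - {..x}" by auto
  also have "measure std_normal_distribution \<dots> = 1 - cdf std_normal_distribution x"
    unfolding cdf_def by (rule prob_compl) simp
  finally show ?thesis by (simp add: std_normal_atLeast_eq_cdf)
qed

text \<open>The Neyman-Pearson argument: replacing \<open>B\<close> by another set gives up parts where \<open>F\<close> dominates and adds
  parts where \<open>G\<close> does. Passing to complements takes care of the opposite sign.\<close>

lemma tv_dist_density_threshold:
  assumes F: "prob_space F" "sets F = sets borel" and G: "prob_space G" "sets G = sets borel"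
    and B: "B \<in> sets borel"
    and above: "\<And>C. C \<in> sets borel \<Longrightarrow> C \<subseteq> B \<Longrightarrow> measure G C \<le> measure F C"
    and below: "\<And>C. C \<in> sets borel \<Longrightarrow> C \<subseteq> - B \<Longrightarrow> measure F C \<le> measure G C"
  shows "tv_dist F G = measure F B - measure G B"
proof -
  interpret F: prob_space F by fact
  interpret G: prob_space G by fact
  have sp: "space F = UNIV" "space G = UNIV"
    using sets_eq_imp_space_eq[OF F(2)] sets_eq_imp_space_eq[OF G(2)] by simp_all
  have le: "measure F C - measure G C \<le> measure F B - measure G B" if C: "C \<in> sets borel" for C
  proof -
    have split: "measure M C + measure M (B - C) = measure M B + measure M (C - B)"
      if "prob_space M" "sets M = sets borel" for M
    proof -
      interpret M: prob_space M by fact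
      have "measure M (C \<inter> B \<union> (C - B)) = measure M (C \<inter> B) + measure M (C - B)"
        using that B C by (intro M.finite_measure_Union) auto
      moreover have "measure M (C \<inter> B \<union> (B - C)) = measure M (C \<inter> B) + measure M (B - C)"
        using that B C by (intro M.finite_measure_Union) auto
      moreover have "C \<inter> B \<union> (C - B) = C" "C \<inter> B \<union> (B - C) = B" by blast+
      ultimately show ?thesis by simp
    qed
    have "measure G (B - C) \<le> measure F (B - C)" using B C by (intro above) auto
    moreover have "measure F (C - B) \<le> measure G (C - B)" using B C by (intro below) auto
    ultimately show ?thesis using split[OF F] split[OF G] by simp
  qed
  have abs: "\<bar>measure F C - measure G C\<bar> \<le> measure F B - measure G B" if C: "C \<in> sets borel" for C
  proof -
    have "measure F (- C) = 1 - measure F C" "measure G (- C) = 1 - measure G C"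
      using F.prob_compl[of C] G.prob_compl[of C] C F G by (simp_all add: sp Compl_eq_Diff_UNIV)
    with le[OF C] le[of "- C"] C show ?thesis by (auto simp: abs_le_iff)
  qed
  show ?thesis
    unfolding tv_dist_def
  proof (rule cSup_eq_maximum)
    have "measure F B - measure G B = \<bar>measure F B - measure G B\<bar>" using above[OF B] by simp
    then show "measure F B - measure G B \<in> (\<lambda>C. \<bar>measure F C - measure G C\<bar>) ` sets borel"
      using B by blast
  qed (use abs in auto)
qed

lemma tv_dist_commute: "tv_dist F G = tv_dist G F"
  by (simp add: tv_dist_def abs_minus_commute)

text \<open>The smaller of the two means is closer exactly to the points left of the midpoint, so the threshold
  set is a half-line.\<close>

lemma tv_dist_gaussian_shift:
  assumes \<sigma>: "\<sigma> > 0" and ab: "a \<le> b"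
  shows "tv_dist (gaussian a \<sigma>) (gaussian b \<sigma>) = 2 * cdf std_normal_distribution ((b - a) / (2 * \<sigma>)) - 1"
proof -
  have \<sigma>0: "\<sigma> \<ge> 0" using \<sigma> by simp
  define B where "B = {..(a + b) / 2}"
  have g: "gaussian m \<sigma> = density lborel (normal_density m \<sigma>)" for m using \<sigma> by (simp add: gaussian_def)
  have rd: "real_distribution (gaussian m \<sigma>)" for m by (rule real_distribution_gaussian[OF \<sigma>0])
  have ps: "prob_space (gaussian m \<sigma>)" for m using rd by (rule real_distribution.axioms)
  have st: "sets (gaussian m \<sigma>) = sets borel" for m by (simp add: g)
  have mono: "measure (gaussian m \<sigma>) C \<le> measure (gaussian m' \<sigma>) C"
    if "C \<in> sets borel" "\<And>x. x \<in> C \<Longrightarrow> (x - m')\<^sup>2 \<le> (x - m)\<^sup>2" for C m m'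
  proof -
    interpret prob_space "gaussian m' \<sigma>" by (rule ps)
    have "normal_density m \<sigma> x \<le> normal_density m' \<sigma> x" if "x \<in> C" for x
      using that \<open>x \<in> C \<Longrightarrow> (x - m')\<^sup>2 \<le> (x - m)\<^sup>2\<close> \<sigma>
      by (auto simp: normal_density_def intro!: divide_right_mono)
    then have "emeasure (gaussian m \<sigma>) C \<le> emeasure (gaussian m' \<sigma>) C"
      unfolding g using that(1)
      by (auto simp: emeasure_density intro!: nn_integral_mono split: split_indicator)
    then show ?thesis
      unfolding measure_def by (intro enn2real_mono) (auto simp: less_top[symmetric])
  qed
  have cl: "(x - a)\<^sup>2 \<le> (x - b)\<^sup>2" if "x \<le> (a + b) / 2" for x
  proof -
    have "(x - b)\<^sup>2 - (x - a)\<^sup>2 = (b - a) * (a + b - 2 * x)" by (simp add: power2_eq_square algebra_simps)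
    moreover have "\<dots> \<ge> 0" using ab that by (intro mult_nonneg_nonneg) auto
    ultimately show ?thesis by simp
  qed
  have cr: "(x - b)\<^sup>2 \<le> (x - a)\<^sup>2" if "x \<ge> (a + b) / 2" for x
  proof -
    have "(x - a)\<^sup>2 - (x - b)\<^sup>2 = (b - a) * (2 * x - a - b)" by (simp add: power2_eq_square algebra_simps)
    moreover have "\<dots> \<ge> 0" using ab that by (intro mult_nonneg_nonneg) auto
    ultimately show ?thesis by simp
  qed
  have "tv_dist (gaussian a \<sigma>) (gaussian b \<sigma>) = measure (gaussian a \<sigma>) B - measure (gaussian b \<sigma>) B"
    by (rule tv_dist_density_threshold[OF ps st ps st]) (auto simp: B_def intro!: mono cl cr)
  also have val: "measure (gaussian m \<sigma>) {..z} = cdf std_normal_distribution ((z - m) / \<sigma>)" for m z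
  proof -
    have "(\<lambda>x. m + \<sigma> * x) -` {..z} = {..(z - m) / \<sigma>}" using \<sigma> by (auto simp: field_simps)
    then show ?thesis unfolding gaussian_eq_distr[OF \<sigma>0] cdf_def by (subst measure_distr) auto
  qed
  have "((a + b) / 2 - a) / \<sigma> = (b - a) / (2 * \<sigma>)" "((a + b) / 2 - b) / \<sigma> = - ((b - a) / (2 * \<sigma>))"
    using \<sigma> by (simp_all add: field_simps)
  then have "measure (gaussian a \<sigma>) B - measure (gaussian b \<sigma>) B = 2 * cdf std_normal_distribution ((b - a) / (2 * \<sigma>)) - 1"
    unfolding B_def val by (simp only: cdf_std_normal_minus)
  finally show ?thesis .
qed

lemma tv_dist_gaussian:
  assumes "\<sigma> > 0"
  shows "tv_dist (gaussian a \<sigma>) (gaussian b \<sigma>) = 2 * cdf std_normal_distribution (\<bar>b - a\<bar> / (2 * \<sigma>)) - 1"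
proof (cases "a \<le> b")
  case False
  then show ?thesis using tv_dist_gaussian_shift[OF assms, of b a] by (simp add: tv_dist_commute)
qed (use tv_dist_gaussian_shift[OF assms] in simp)

lemma tv_dist_refl: "tv_dist F F = 0"
proof -
  have "(sets borel :: real set set) \<noteq> {}" using sets.empty_sets by blast
  then show ?thesis by (simp add: tv_dist_def)
qed

section \<open>Limit laws of colour-blind statistics\<close>

context opposite_tilts
begin

lemma \<eta>_product:
  shows "(\<lambda>p. \<eta> (fst p) * \<eta> (snd p)) \<in> borel_measurable (Q \<Otimes>\<^sub>M Q)"
  and "\<And>p :: real \<times> real. \<bar>\<eta> (fst p) * \<eta> (snd p)\<bar> \<le> 1"
  and "(\<integral>p. \<eta> (fst p) * \<eta> (snd p) \<partial>(Q \<Otimes>\<^sub>M Q)) = 0"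
proof -
  show m: "(\<lambda>p. \<eta> (fst p) * \<eta> (snd p)) \<in> borel_measurable (Q \<Otimes>\<^sub>M Q)" by measurable
  show b: "\<bar>\<eta> (fst p) * \<eta> (snd p)\<bar> \<le> 1" for p :: "real \<times> real"
    using \<eta>_bound[of "fst p"] \<eta>_bound[of "snd p"] by (simp only: abs_mult mult_le_one abs_ge_zero)
  have "integrable (Q \<Otimes>\<^sub>M Q) (\<lambda>p. \<eta> (fst p) * \<eta> (snd p))"
  proof (rule QQ.P.integrable_const_bound[of _ 1, OF AE_I2 m])
    show "norm (\<eta> (fst p) * \<eta> (snd p)) \<le> 1" for p unfolding real_norm_def by (rule b)
  qed
  from QQ.integral_fst'[OF this, symmetric]
  show "(\<integral>p. \<eta> (fst p) * \<eta> (snd p) \<partial>(Q \<Otimes>\<^sub>M Q)) = 0"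
   by (simp only: fst_conv snd_conv integral_mult_right_zero \<eta>_mean mult_zero_right integral_zero)
qed

lemma char_normalized_sum:
  fixes X Y :: "nat \<Rightarrow> 'a \<Rightarrow> real"
  assumes iid: "iid_pairs M n X Y (tilt Q \<eta> 1) (tilt Q \<eta> (-1))"
    and k: "k \<in> borel_measurable borel"
  shows "char (distr M borel (\<lambda>z. (\<Sum>i = 1..n. k (X i z, Y i z)) / sqrt n)) t
    = (CLINT p|pair_law. iexp (t / sqrt n * k p)) ^ n"
proof -
  interpret M: prob_space M using iid by (simp add: iid_pairs_def)
  have ind: "M.indep_vars (\<lambda>_. borel \<Otimes>\<^sub>M borel) (\<lambda>i z. (X i z, Y i z)) {1..n}"
    and law: "\<And>i. i \<in> {1..n} \<Longrightarrow> distr M (borel \<Otimes>\<^sub>M borel) (\<lambda>z. (X i z, Y i z)) = pair_law"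
    using iid by (simp_all add: iid_pairs_def)
  have km: "(\<lambda>p. k p / sqrt n) \<in> borel_measurable (borel \<Otimes>\<^sub>M borel)" using k by (simp add: borel_prod)
  have W: "(\<lambda>z. (X i z, Y i z)) \<in> M \<rightarrow>\<^sub>M borel \<Otimes>\<^sub>M borel" if "i \<in> {1..n}" for i
    using ind that by (auto simp: M.indep_vars_def)
  have "char (distr M borel (\<lambda>z. (\<Sum>i = 1..n. k (X i z, Y i z)) / sqrt n)) t
      = char (distr M borel (\<lambda>z. \<Sum>i\<in>{1..n}. k (X i z, Y i z) / sqrt n)) t"
    by (simp only: sum_divide_distrib)
  also have "\<dots> = (\<Prod>i\<in>{1..n}. char (distr M borel (\<lambda>z. k (X i z, Y i z) / sqrt n)) t)"
  proof (rule M.char_distr_sum)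
    show "M.indep_vars (\<lambda>_. borel) (\<lambda>i z. k (X i z, Y i z) / sqrt n) {1..n}"
      by (rule M.indep_vars_compose2[where Y = "\<lambda>_ p. k p / sqrt n", OF ind]) (rule km)
  qed
  also have "\<dots> = (\<Prod>i\<in>{1..n}. (CLINT p|pair_law. iexp (t / sqrt n * k p)))"
  proof (rule prod.cong[OF refl])
    fix i assume i: "i \<in> {1..n}"
    have im: "(\<lambda>x. iexp (t * x)) \<in> borel_measurable borel" by measurable
    have e: "t * (k p / sqrt n) = t / sqrt n * k p" for p by simp
    show "char (distr M borel (\<lambda>z. k (X i z, Y i z) / sqrt n)) t = (CLINT p|pair_law. iexp (t / sqrt n * k p))"
    proof -
      have m1: "(\<lambda>z. k (X i z, Y i z) / sqrt n) \<in> borel_measurable M"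
        by (rule measurable_compose[OF W[OF i] km])
      have m2: "(\<lambda>p. iexp (t * (k p / sqrt n))) \<in> borel_measurable (borel \<Otimes>\<^sub>M borel)"
        by (rule measurable_compose[OF km im])
      have "char (distr M borel (\<lambda>z. k (X i z, Y i z) / sqrt n)) t = (CLINT z|M. iexp (t * (k (X i z, Y i z) / sqrt n)))"
        unfolding char_def by (rule integral_distr[OF m1 im])
      also have "\<dots> = (CLINT p|distr M (borel \<Otimes>\<^sub>M borel) (\<lambda>z. (X i z, Y i z)). iexp (t * (k p / sqrt n)))"
        by (rule integral_distr[OF W[OF i] m2, symmetric])
      finally show ?thesis by (simp only: law[OF i] e)
    qed
  qed
  also have "\<dots> = (CLINT p|pair_law. iexp (t / sqrt n * k p)) ^ n"
    by (simp only: prod_constant card_atLeastAtMost diff_Suc_1)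
  finally show ?thesis .
qed

lemma char_pair_law:
  assumes k: "k \<in> borel_measurable borel" and sym: "\<And>x y. k (x, y) = k (y, x)"
  shows "(CLINT p|pair_law. iexp (s * k p)) = (CLINT p|Q \<Otimes>\<^sub>M Q. iexp (s * k p))
    - (CLINT p|Q \<Otimes>\<^sub>M Q. (\<eta> (fst p) * \<eta> (snd p)) *\<^sub>R iexp (s * k p))" (is ?P1)
    and "cmod (CLINT p|pair_law. iexp (s * k p)) \<le> 1" (is ?P2)
proof -
  have kQ[measurable]: "k \<in> borel_measurable (Q \<Otimes>\<^sub>M Q)"
    using k measurable_cong_sets[OF sets_QQ refl] by blast
  have kP[measurable]: "k \<in> borel_measurable pair_law"
    using k measurable_cong_sets[OF sets_pair_law refl] by blast
  have i: "integrable (Q \<Otimes>\<^sub>M Q) (\<lambda>p. iexp (s * k p))"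
    by (rule QQ.P.integrable_const_bound[of _ 1]) auto
  show ?P1
    by (rule symmetric_integral_opposite_tilts[OF i]) (simp add: sym)
  have "cmod (CLINT p|pair_law. iexp (s * k p)) \<le> (\<integral>p. cmod (iexp (s * k p)) \<partial>pair_law)"
    by (rule integral_norm_bound)
  also have "\<dots> = 1" using P.P.prob_space by simp
  finally show ?P2 .
qed

end

text \<open>The function \<open>iexp\<close> is Lipschitz with constant \<open>1\<close>; this transfers limit laws between variables
  whose difference vanishes in mean.\<close>

lemma char_difference_bound:
  assumes M: "prob_space M" and m: "S \<in> borel_measurable M" "T \<in> borel_measurable M" and i: "integrable M (\<lambda>z. S z - T z)"
  shows "cmod (char (distr M borel S) t - char (distr M borel T) t) \<le> \<bar>t\<bar> * (\<integral>z. \<bar>S z - T z\<bar> \<partial>M)"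
proof -
  interpret prob_space M by fact
  note [measurable] = m
  have c: "char (distr M borel Z) t = (CLINT z|M. iexp (t * Z z))" if "Z \<in> borel_measurable M" for Z
    unfolding char_def using that by (subst integral_distr) auto
  have ii: "integrable M (\<lambda>z. iexp (t * Z z))" if [measurable]: "Z \<in> borel_measurable M" for Z
    by (rule integrable_const_bound[of _ 1]) auto
  have "cmod (char (distr M borel S) t - char (distr M borel T) t) = cmod (CLINT z|M. iexp (t * S z) - iexp (t * T z))"
    unfolding c[OF m(1)] c[OF m(2)] by (subst Bochner_Integration.integral_diff[OF ii[OF m(1)] ii[OF m(2)]]) simp
  also have "\<dots> \<le> (\<integral>z. cmod (iexp (t * S z) - iexp (t * T z)) \<partial>M)"
    by (rule integral_norm_bound)
  also have "\<dots> \<le> (\<integral>z. \<bar>t\<bar> * \<bar>S z - T z\<bar> \<partial>M)"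
  proof (rule integral_mono)
    show "integrable M (\<lambda>z. cmod (iexp (t * S z) - iexp (t * T z)))"
      using Bochner_Integration.integrable_diff[OF ii[OF m(1)] ii[OF m(2)]] by (rule integrable_norm)
    show "integrable M (\<lambda>z. \<bar>t\<bar> * \<bar>S z - T z\<bar>)" using i by simp
    fix z
    have "t * S z = t * T z + t * (S z - T z)" by (simp add: algebra_simps)
    then have "iexp (t * S z) = iexp (t * T z) * iexp (t * (S z - T z))"
      by (simp only: of_real_add distrib_left exp_add)
    then have "iexp (t * S z) - iexp (t * T z) = iexp (t * T z) * (iexp (t * (S z - T z)) - 1)"
      by (simp add: right_diff_distrib)
    then have "cmod (iexp (t * S z) - iexp (t * T z)) = cmod (iexp (t * (S z - T z)) - 1)"
      by (simp only: norm_mult norm_exp_i_times)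
    also have "\<dots> \<le> \<bar>t * (S z - T z)\<bar>" by (rule cmod_iexp_minus_one_le)
    finally show "cmod (iexp (t * S z) - iexp (t * T z)) \<le> \<bar>t\<bar> * \<bar>S z - T z\<bar>" by (simp add: abs_mult)
  qed
  finally show ?thesis using i by simp
qed

text \<open>The kernel \<open>g\<close> is the limit of the colour-blind perturbation \<open>\<eta>(x) \<eta>(y)\<close> at the scale \<open>sqrt n\<close>. The
  convergence is required only after integration against \<open>k\<close>. With \<open>\<eta> = 0\<close> and \<open>g = 0\<close> this is the limit
  under the null hypothesis, and the variance does not depend on \<open>g\<close>.\<close>

lemma cb_statistic_limit_law:
  fixes Q :: "real measure" and \<eta> :: "nat \<Rightarrow> real \<Rightarrow> real" and M :: "nat \<Rightarrow> 'a measure" and g :: "real \<times> real \<Rightarrow> real"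
  assumes tilts: "\<And>n. opposite_tilts Q (\<eta> n)"
    and iid: "\<And>n. iid_pairs (M n) n (X n) (Y n) (tilt Q (\<eta> n) 1) (tilt Q (\<eta> n) (-1))"
    and \<phi>: "\<phi> \<in> borel_measurable borel" "integrable (Q \<Otimes>\<^sub>M Q) (\<lambda>p. (\<phi> p)\<^sup>2)"
  defines "k \<equiv> degenerate_part Q (fold_triangle \<phi>)"
  assumes g: "g \<in> borel_measurable borel" "integrable (Q \<Otimes>\<^sub>M Q) (\<lambda>p. k p * g p)"
    and lim: "(\<lambda>n. \<integral>p. \<bar>k p * (sqrt n * (\<eta> n (fst p) * \<eta> n (snd p)) - g p)\<bar> \<partial>(Q \<Otimes>\<^sub>M Q)) \<longlonglongrightarrow> 0"
  shows "converges_in_law M (cb_stat_seq X Y \<phi>)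
      (gaussian (- (\<integral>p. k p * g p \<partial>(Q \<Otimes>\<^sub>M Q))) (L2_norm (Q \<Otimes>\<^sub>M Q) k))"
    and "(\<lambda>n. \<integral>z. \<bar>cb_stat_seq X Y \<phi> n z - (\<Sum>i = 1..n. k (X n i z, Y n i z)) / sqrt n\<bar> \<partial>M n) \<longlonglongrightarrow> 0" (is ?P1)
    and "integrable (M n) (\<lambda>z. cb_stat_seq X Y \<phi> n z - (\<Sum>i = 1..n. k (X n i z, Y n i z)) / sqrt n)" (is ?P2)
proof -
  let ?QQ = "Q \<Otimes>\<^sub>M Q"
  interpret T0: opposite_tilts Q "\<eta> 0" by (rule tilts)
  define f where "f = fold_triangle \<phi>"
  have fb: "f \<in> borel_measurable borel" unfolding f_def by (rule fold_triangle_measurable[OF \<phi>(1)])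
  have f2: "integrable ?QQ (\<lambda>p. (f p)\<^sup>2)" unfolding f_def by (rule fold_triangle_square_integrable[OF T0.Q \<phi>])
  have fsym: "f (x, y) = f (y, x)" for x y unfolding f_def by (rule fold_triangle_sym)
  note dp = degenerate_part_properties[OF T0.Q fb f2 fsym, unfolded f_def, folded k_def]
  have QQm: "u \<in> borel_measurable ?QQ" if "u \<in> borel_measurable borel" for u :: "real \<times> real \<Rightarrow> real"
    using that measurable_cong_sets[OF T0.sets_QQ refl] by blast
  define \<kappa> where "\<kappa> = (\<integral>p. (k p)\<^sup>2 \<partial>?QQ)"
  have \<kappa>: "\<kappa> \<ge> 0" unfolding \<kappa>_def by (intro integral_nonneg_AE) auto
  define S where "S n = cb_stat_seq X Y \<phi> n" for n
  define T where "T n z = (\<Sum>i = 1..n. k (X n i z, Y n i z)) / sqrt n" for n z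
  define C where "C = 4 * (\<integral>p. \<bar>f p / 2 - k p\<bar> \<partial>?QQ) + 1 / 8 + 32 * \<kappa>"
  have rem: "S n \<in> borel_measurable (M n)" "T n \<in> borel_measurable (M n)" "integrable (M n) (\<lambda>z. S n z - T n z)"
    "(\<integral>z. \<bar>S n z - T n z\<bar> \<partial>M n) \<le> C / sqrt n" for n
    using opposite_tilts.cb_statistic_remainder_bound[OF tilts iid \<phi>, of n]
    by (simp_all add: S_def T_def[abs_def] cb_stat_seq_def[abs_def] k_def C_def \<kappa>_def f_def)
  have Mp: "prob_space (M n)" for n using iid by (simp add: iid_pairs_def)
  have C0: "(\<lambda>n. C / sqrt (real n)) \<longlonglongrightarrow> 0"
    by (intro tendsto_divide_0[OF tendsto_const] filterlim_at_top_imp_at_infinity filterlim_compose[OF sqrt_at_top filterlim_real_sequentially])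
  have L1: "(\<lambda>n. \<integral>z. \<bar>S n z - T n z\<bar> \<partial>M n) \<longlonglongrightarrow> 0"
    by (rule tendsto_sandwich[OF _ _ tendsto_const C0]) (auto simp: rem)
  show ?P1
    using L1 by (simp add: S_def T_def[abs_def])
  show ?P2
    using rem(3) by (simp add: S_def T_def[abs_def])
  define \<beta> where "\<beta> = (\<integral>p. k p * g p \<partial>?QQ)"
  let ?L = "\<lambda>t. exp (\<i> * complex_of_real (t * - \<beta>) - complex_of_real (t\<^sup>2 * \<kappa> / 2))"
  have charT: "(\<lambda>n. char (distr (M n) borel (T n)) t) \<longlonglongrightarrow> ?L t" for t
  proof -
    define cf where "cf n = (CLINT p|tilt Q (\<eta> n) 1 \<Otimes>\<^sub>M tilt Q (\<eta> n) (-1). iexp (t / sqrt n * k p))" for n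
    have "(\<lambda>n. cf n ^ n) \<longlonglongrightarrow> ?L t"
      unfolding \<beta>_def \<kappa>_def
    proof (rule perturbed_characteristic_power_limit[where e = "\<lambda>n p. \<eta> n (fst p) * \<eta> n (snd p)"])
      show "prob_space ?QQ" by (rule T0.QQ.P.prob_space_axioms)
      show "k \<in> borel_measurable ?QQ" "g \<in> borel_measurable ?QQ"
        by (rule QQm, rule dp(1), rule QQm, rule g(1))
      show "(\<integral>p. k p \<partial>?QQ) = 0" by (rule dp(5))
      fix n
      interpret Tn: opposite_tilts Q "\<eta> n" by (rule tilts)
      show "cf n = (CLINT p|?QQ. iexp (t / sqrt n * k p)) - (CLINT p|?QQ. (\<eta> n (fst p) * \<eta> n (snd p)) *\<^sub>R iexp (t / sqrt n * k p))"
        unfolding cf_def by (rule Tn.char_pair_law[OF dp(1,4)])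
      show "cmod (cf n) \<le> 1" unfolding cf_def by (rule Tn.char_pair_law[OF dp(1,4)])
      show "(\<lambda>p. \<eta> n (fst p) * \<eta> n (snd p)) \<in> borel_measurable ?QQ" "(\<integral>p. \<eta> n (fst p) * \<eta> n (snd p) \<partial>?QQ) = 0"
        "\<bar>\<eta> n (fst p) * \<eta> n (snd p)\<bar> \<le> 1" for p by (rule Tn.\<eta>_product)+
    qed (use dp g lim in auto)
    moreover have "char (distr (M n) borel (T n)) t = cf n ^ n" for n
    proof -
      interpret Tn: opposite_tilts Q "\<eta> n" by (rule tilts)
      show ?thesis unfolding cf_def T_def[abs_def] by (rule Tn.char_normalized_sum[OF iid dp(1)])
    qed
    ultimately show ?thesis by simp
  qed
  show "converges_in_law M (cb_stat_seq X Y \<phi>)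
      (gaussian (- (\<integral>p. k p * g p \<partial>?QQ)) (L2_norm ?QQ k))"
    unfolding converges_in_law_def
  proof (intro conjI allI levy_continuity)
    show "cb_stat_seq X Y \<phi> n \<in> borel_measurable (M n)" for n using rem(1) by (simp add: S_def)
    show "real_distribution (distr (M n) borel (cb_stat_seq X Y \<phi> n))" for n
      using rem(1)[of n] by (intro prob_space.real_distribution_distr Mp) (simp add: S_def)
    have nn: "0 \<le> L2_norm ?QQ k" using \<kappa> by (simp add: L2_norm_def \<kappa>_def)
    have sq: "(L2_norm ?QQ k)\<^sup>2 = \<kappa>" using \<kappa> by (simp add: L2_norm_def \<kappa>_def)
    from nn show "real_distribution (gaussian (- (\<integral>p. k p * g p \<partial>?QQ)) (L2_norm ?QQ k))"
      by (rule real_distribution_gaussian)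
    fix t
    have "(\<lambda>n. \<bar>t\<bar> * (\<integral>z. \<bar>S n z - T n z\<bar> \<partial>M n)) \<longlonglongrightarrow> \<bar>t\<bar> * 0"
      by (intro tendsto_mult tendsto_const L1)
    then have L: "(\<lambda>n. \<bar>t\<bar> * (\<integral>z. \<bar>S n z - T n z\<bar> \<partial>M n)) \<longlonglongrightarrow> 0"
      by (simp only: mult_zero_right)
    have "(\<lambda>n. char (distr (M n) borel (S n)) t - char (distr (M n) borel (T n)) t) \<longlonglongrightarrow> 0"
      by (rule Lim_null_comparison[OF always_eventually L]) (rule allI, rule char_difference_bound[OF Mp rem(1-3)])
    from tendsto_add[OF this charT[of t]]
    have "(\<lambda>n. char (distr (M n) borel (S n)) t) \<longlonglongrightarrow> ?L t"
      by (simp only: diff_add_cancel add_0)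
    also have "?L t = char (gaussian (- \<beta>) (L2_norm ?QQ k)) t"
      by (simp only: char_gaussian[OF nn] sq)
    finally show "(\<lambda>n. char (distr (M n) borel (cb_stat_seq X Y \<phi> n)) t) \<longlonglongrightarrow>
        char (gaussian (- (\<integral>p. k p * g p \<partial>?QQ)) (L2_norm ?QQ k)) t"
      by (simp only: S_def \<beta>_def)
  qed
qed

section \<open>The optimal kernel\<close>

lemma tensor_product_square_integrable:
  fixes u v :: "real \<Rightarrow> real"
  assumes Q: "prob_space Q"
    and u: "u \<in> borel_measurable Q" "integrable Q (\<lambda>x. (u x)\<^sup>2)"
    and v: "v \<in> borel_measurable Q" "integrable Q (\<lambda>x. (v x)\<^sup>2)"
  shows "(\<lambda>p. u (fst p) * v (snd p)) \<in> borel_measurable (Q \<Otimes>\<^sub>M Q)"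
    and "integrable (Q \<Otimes>\<^sub>M Q) (\<lambda>p. (u (fst p) * v (snd p))\<^sup>2)"
    and "(\<integral>p. (u (fst p) * v (snd p))\<^sup>2 \<partial>(Q \<Otimes>\<^sub>M Q)) = (\<integral>x. (u x)\<^sup>2 \<partial>Q) * (\<integral>x. (v x)\<^sup>2 \<partial>Q)"
proof -
  let ?QQ = "Q \<Otimes>\<^sub>M Q"
  interpret Q: prob_space Q by fact
  interpret QQ: pair_prob_space Q Q ..
  note [measurable] = u(1) v(1)
  show m: "(\<lambda>p. u (fst p) * v (snd p)) \<in> borel_measurable ?QQ" by measurable
  show i: "integrable ?QQ (\<lambda>p. (u (fst p) * v (snd p))\<^sup>2)"
  proof (rule QQ.Fubini_integrable)
    show "(\<lambda>p. (u (fst p) * v (snd p))\<^sup>2) \<in> borel_measurable ?QQ" by measurable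
    show "integrable Q (\<lambda>x. \<integral>y. norm ((u (fst (x, y)) * v (snd (x, y)))\<^sup>2) \<partial>Q)"
      using u v by (simp add: power_mult_distrib)
    show "AE x in Q. integrable Q (\<lambda>y. (u (fst (x, y)) * v (snd (x, y)))\<^sup>2)"
      using u v by (simp add: power_mult_distrib)
  qed
  have "(\<integral>p. (u (fst p) * v (snd p))\<^sup>2 \<partial>?QQ) = (\<integral>x. (\<integral>y. (u x * v y)\<^sup>2 \<partial>Q) \<partial>Q)"
    using QQ.integral_fst'[OF i] by simp
  also have "\<dots> = (\<integral>x. (u x)\<^sup>2 \<partial>Q) * (\<integral>x. (v x)\<^sup>2 \<partial>Q)"
    by (simp add: power_mult_distrib)
  finally show "(\<integral>p. (u (fst p) * v (snd p))\<^sup>2 \<partial>?QQ) = (\<integral>x. (u x)\<^sup>2 \<partial>Q) * (\<integral>x. (v x)\<^sup>2 \<partial>Q)" .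
qed

lemma L2_norm_square: "(L2_norm M f)\<^sup>2 = (\<integral>x. (f x)\<^sup>2 \<partial>M)"
  by (simp add: L2_norm_def integral_nonneg_AE)

lemma L2_norm_nonneg: "0 \<le> L2_norm M f"
  by (simp add: L2_norm_def integral_nonneg_AE)

lemma cdf_std_normal_0: "cdf std_normal_distribution 0 = 1 / 2"
  using cdf_std_normal_minus[of 0] by simp

text \<open>In the degenerate case both laws are the same point mass; the quotient by \<open>0\<close> is \<open>0\<close>, and the formula
  remains correct.\<close>

lemma tv_dist_gaussian_zero_mean:
  assumes "0 \<le> \<sigma>" "\<sigma> = 0 \<Longrightarrow> b = 0"
  shows "tv_dist (gaussian 0 \<sigma>) (gaussian b \<sigma>) = 2 * cdf std_normal_distribution (\<bar>b\<bar> / (2 * \<sigma>)) - 1"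
proof (cases "\<sigma> = 0")
  case True
  then show ?thesis using assms by (simp add: tv_dist_refl cdf_std_normal_0)
next
  case False
  then show ?thesis using assms tv_dist_gaussian[of \<sigma> 0 b] by simp
qed

definition clamp_unit :: "real \<Rightarrow> real" where
  "clamp_unit x = max (-1) (min 1 x)"

text \<open>Nonnegativity of the two densities forces \<open>\<bar>u\<bar> \<le> 1\<close> almost everywhere, and clamping makes the bound
  hold everywhere without changing the laws. That the first density is a probability density says that
  \<open>u\<close> has mean \<open>0\<close>.\<close>

lemma opposite_tilts_of_densities:
  fixes Q A\<^sub>1 A\<^sub>2 :: "real measure" and u :: "real \<Rightarrow> real"
  assumes Q: "prob_space Q" "sets Q = sets borel" and A1: "prob_space A\<^sub>1"
    and u: "u \<in> borel_measurable Q"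
    and pos: "AE x in Q. 0 \<le> 1 + u x" "AE x in Q. 0 \<le> 1 - u x"
    and dens: "A\<^sub>1 = density Q (\<lambda>x. ennreal (1 + u x))" "A\<^sub>2 = density Q (\<lambda>x. ennreal (1 - u x))"
  defines "\<eta> \<equiv> \<lambda>x. clamp_unit (u x)"
  shows "AE x in Q. \<eta> x = u x" "opposite_tilts Q \<eta>" "A\<^sub>1 = tilt Q \<eta> 1" "A\<^sub>2 = tilt Q \<eta> (-1)"
proof -
  interpret Q: prob_space Q by fact
  show ae: "AE x in Q. \<eta> x = u x"
    using pos by eventually_elim (auto simp: \<eta>_def clamp_unit_def)
  have um[measurable]: "u \<in> borel_measurable Q" by fact
  have \<eta>m[measurable]: "\<eta> \<in> borel_measurable Q" unfolding \<eta>_def clamp_unit_def by measurable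
  have b: "\<bar>\<eta> x\<bar> \<le> 1" for x by (auto simp: \<eta>_def clamp_unit_def)
  show eq1: "A\<^sub>1 = tilt Q \<eta> 1" unfolding dens tilt_def
    by (rule density_cong) (use ae in \<open>auto\<close>)
  show "A\<^sub>2 = tilt Q \<eta> (-1)" unfolding dens tilt_def
    by (rule density_cong) (use ae in \<open>auto\<close>)
  have \<eta>i: "integrable Q \<eta>" by (rule Q.integrable_const_bound[of _ 1]) (use b in auto)
  \<comment> \<open>Total mass \<open>1\<close> of the first law determines the mean of \<open>\<eta>\<close>, since \<open>1 + \<eta>\<close> is nonnegative.\<close>
  have nn: "0 \<le> 1 + 1 * \<eta> x" for x using b[of x] by (simp add: abs_le_iff)
  have "1 = emeasure (tilt Q \<eta> 1) (space (tilt Q \<eta> 1))"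
    using prob_space.emeasure_space_1[OF A1] eq1 by simp
  also have "\<dots> = (\<integral>\<^sup>+x. ennreal (1 + 1 * \<eta> x) \<partial>Q)"
    unfolding tilt_def by (subst emeasure_density) (auto intro!: nn_integral_cong split: split_indicator)
  also have "\<dots> = ennreal (\<integral>x. 1 + 1 * \<eta> x \<partial>Q)"
    using \<eta>i nn by (intro nn_integral_eq_integral) auto
  also have "(\<integral>x. 1 + 1 * \<eta> x \<partial>Q) = 1 + (\<integral>x. \<eta> x \<partial>Q)" using \<eta>i Q.prob_space by simp
  finally have e: "ennreal (1 + (\<integral>x. \<eta> x \<partial>Q)) = 1" by simp
  have "\<bar>\<integral>x. \<eta> x \<partial>Q\<bar> \<le> (\<integral>x. \<bar>\<eta> x\<bar> \<partial>Q)" by (rule integral_abs_bound)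
  also have "\<dots> \<le> (\<integral>x. 1 \<partial>Q)" using \<eta>i b by (intro integral_mono) auto
  finally have "\<bar>\<integral>x. \<eta> x \<partial>Q\<bar> \<le> 1" using Q.prob_space by simp
  with e have "(\<integral>x. \<eta> x \<partial>Q) = 0" by (simp add: ennreal_eq_1)
  then show "opposite_tilts Q \<eta>"
    using Q \<eta>m b by unfold_locales (auto cong: measurable_cong_sets)
qed

lemma opposite_tilts_zero:
  assumes "prob_space Q" "sets Q = sets borel"
  shows "opposite_tilts Q (\<lambda>_. 0)" "tilt Q (\<lambda>_. 0) s = Q"
  using assms by (auto simp: opposite_tilts_def tilt_def density_1)

text \<open>Writing \<open>\<eta>\<^sub>n = \<epsilon>\<^sub>n v\<^sub>n\<close> with \<open>v\<^sub>n = h\<^sub>n\<close> almost everywhere, one splits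
  \<open>v\<^sub>n(x) v\<^sub>n(y) - h(x) h(y) = d\<^sub>n(x) v\<^sub>n(y) + h(x) d\<^sub>n(y)\<close> with \<open>d\<^sub>n = v\<^sub>n - h\<close> and applies the
  Cauchy-Schwarz inequality to each product; norms of tensor products are products of norms.\<close>

lemma tilt_products_converge:
  fixes Q :: "real measure" and \<epsilon> :: "nat \<Rightarrow> real" and hn \<eta> :: "nat \<Rightarrow> real \<Rightarrow> real" and h :: "real \<Rightarrow> real"
  assumes Q: "prob_space Q" "sets Q = sets borel"
    and \<epsilon>: "\<And>n. \<epsilon> n > 0" and c: "(\<lambda>n. sqrt (real n) * (\<epsilon> n)\<^sup>2) \<longlonglongrightarrow> c"
    and hn: "\<And>n. hn n \<in> borel_measurable Q"
    and h: "h \<in> borel_measurable Q" "integrable Q (\<lambda>x. (h x)\<^sup>2)"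
    and conv: "(\<lambda>n. \<integral>\<^sup>+x. ennreal ((hn n x - h x)\<^sup>2) \<partial>Q) \<longlonglongrightarrow> 0"
    and \<eta>: "\<And>n. \<eta> n \<in> borel_measurable Q" "\<And>n x. \<bar>\<eta> n x\<bar> \<le> 1" "\<And>n. AE x in Q. \<eta> n x = \<epsilon> n * hn n x"
    and k: "k \<in> borel_measurable (Q \<Otimes>\<^sub>M Q)" "integrable (Q \<Otimes>\<^sub>M Q) (\<lambda>p. (k p)\<^sup>2)"
  shows "(\<lambda>n. \<integral>p. \<bar>k p * (sqrt n * (\<eta> n (fst p) * \<eta> n (snd p)) - c * tensor_square h p)\<bar> \<partial>(Q \<Otimes>\<^sub>M Q)) \<longlonglongrightarrow> 0"
proof -
  let ?q = "\<lambda>n p. \<bar>k p * (sqrt (real n) * (\<eta> n (fst p) * \<eta> n (snd p)) - c * tensor_square h p)\<bar>"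
  let ?QQ = "Q \<Otimes>\<^sub>M Q"
  interpret Q: prob_space Q by fact
  interpret QQ: pair_prob_space Q Q ..
  note [measurable] = h(1) \<eta>(1) k(1)
  define v where "v n x = \<eta> n x / \<epsilon> n" for n x
  define d where "d n x = v n x - h x" for n x
  have vm[measurable]: "v n \<in> borel_measurable Q" for n unfolding v_def[abs_def] by measurable
  have dm[measurable]: "d n \<in> borel_measurable Q" for n unfolding d_def[abs_def] by measurable
  have v2: "integrable Q (\<lambda>x. (v n x)\<^sup>2)" for n
  proof (rule Q.integrable_const_bound[of _ "(1 / \<epsilon> n)\<^sup>2", OF AE_I2])
    show "norm ((v n x)\<^sup>2) \<le> (1 / \<epsilon> n)\<^sup>2" for x
    proof -
      have "(\<eta> n x)\<^sup>2 \<le> 1" using \<eta>(2)[of n x] by (simp add: abs_square_le_1)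
      then show ?thesis by (simp add: v_def power_divide divide_right_mono)
    qed
  qed measurable
  have d2: "integrable Q (\<lambda>x. (d n x)\<^sup>2)" for n
    unfolding d_def by (rule square_integrable_diff[OF vm v2 h])
  have ad: "AE x in Q. d n x = hn n x - h x" for n
    using \<eta>(3)[of n]
  proof eventually_elim
    case (elim x)
    then show ?case using \<epsilon>[of n] by (simp add: d_def v_def)
  qed
  define \<delta> where "\<delta> n = L2_norm Q (d n)" for n
  have "(\<integral>\<^sup>+x. ennreal ((hn n x - h x)\<^sup>2) \<partial>Q) = ennreal ((\<delta> n)\<^sup>2)" for n
  proof -
    have "(\<integral>\<^sup>+x. ennreal ((hn n x - h x)\<^sup>2) \<partial>Q) = (\<integral>\<^sup>+x. ennreal ((d n x)\<^sup>2) \<partial>Q)"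
      using ad[of n] by (intro nn_integral_cong_AE) auto
    also have "\<dots> = ennreal (\<integral>x. (d n x)\<^sup>2 \<partial>Q)"
      by (rule nn_integral_eq_integral[OF d2]) simp
    finally show ?thesis by (simp add: \<delta>_def L2_norm_square)
  qed
  with conv have "(\<lambda>n. ennreal ((\<delta> n)\<^sup>2)) \<longlonglongrightarrow> ennreal 0" by simp
  then have "(\<lambda>n. (\<delta> n)\<^sup>2) \<longlonglongrightarrow> 0"
    by (subst (asm) tendsto_ennreal_iff) auto
  then have "(\<lambda>n. sqrt ((\<delta> n)\<^sup>2)) \<longlonglongrightarrow> sqrt 0" by (rule tendsto_real_sqrt)
  then have \<delta>0: "\<delta> \<longlonglongrightarrow> 0" by (simp add: \<delta>_def[abs_def] L2_norm_nonneg)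
  define H where "H = L2_norm Q h"
  define B where "B = L2_norm ?QQ k"
  have vH: "L2_norm Q (v n) \<le> sqrt (2 * (\<delta> n)\<^sup>2 + 2 * H\<^sup>2)" for n
    unfolding L2_norm_def[of Q "v n"]
  proof (rule real_sqrt_le_mono)
    have le: "(v n x)\<^sup>2 \<le> 2 * (d n x)\<^sup>2 + 2 * (h x)\<^sup>2" for x
      using sum_squares_bound[of "d n x" "h x"] by (simp add: d_def power2_eq_square algebra_simps)
    have "(\<integral>x. (v n x)\<^sup>2 \<partial>Q) \<le> (\<integral>x. 2 * (d n x)\<^sup>2 + 2 * (h x)\<^sup>2 \<partial>Q)"
      using v2 d2 h le by (intro integral_mono) auto
    also have "\<dots> = 2 * (\<delta> n)\<^sup>2 + 2 * H\<^sup>2"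
      using d2 h by (simp add: \<delta>_def H_def L2_norm_square)
    finally show "(\<integral>x. (v n x)\<^sup>2 \<partial>Q) \<le> 2 * (\<delta> n)\<^sup>2 + 2 * H\<^sup>2" .
  qed
  define s where "s n = sqrt (real n) * (\<epsilon> n)\<^sup>2" for n
  have s0: "0 \<le> s n" for n by (simp add: s_def)
  have cs: "integrable ?QQ (\<lambda>p. \<bar>k p * (u (fst p) * w (snd p))\<bar>)" (is ?P1)
    "(\<integral>p. \<bar>k p * (u (fst p) * w (snd p))\<bar> \<partial>?QQ) \<le> B * (L2_norm Q u * L2_norm Q w)" (is ?P2)
    if uw: "u \<in> borel_measurable Q" "integrable Q (\<lambda>x. (u x)\<^sup>2)" "w \<in> borel_measurable Q" "integrable Q (\<lambda>x. (w x)\<^sup>2)" for u w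
  proof -
    note t = tensor_product_square_integrable[OF Q(1) uw]
    show ?P1
      using square_integrable_mult[OF k t(1,2)] by (rule integrable_abs)
    have "L2_norm ?QQ (\<lambda>p. u (fst p) * w (snd p)) = L2_norm Q u * L2_norm Q w"
      unfolding L2_norm_def t(3) by (simp add: real_sqrt_mult)
    then show ?P2
      using integral_abs_mult_le_L2_norm[OF k t(1,2)] by (simp add: B_def)
  qed
  define U where "U n p = s n * (\<bar>k p * (d n (fst p) * v n (snd p))\<bar> + \<bar>k p * (h (fst p) * d n (snd p))\<bar>)
      + \<bar>s n - c\<bar> * \<bar>k p * (h (fst p) * h (snd p))\<bar>" for n p
  note c1 = cs[OF dm d2 vm v2] and c2 = cs[OF h dm d2] and c3 = cs[OF h h]
  have Ui: "integrable ?QQ (U n)" for n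
    unfolding U_def by (intro Bochner_Integration.integrable_add integrable_mult_right c1(1) c2(1) c3(1))
  let ?bound = "\<lambda>n. s n * (B * (\<delta> n * sqrt (2 * (\<delta> n)\<^sup>2 + 2 * H\<^sup>2)) + B * (H * \<delta> n)) + \<bar>s n - c\<bar> * (B * (H * H))"
  have U_le: "(\<integral>p. U n p \<partial>?QQ) \<le> ?bound n" for n
  proof -
    have "(\<integral>p. U n p \<partial>?QQ) = s n * ((\<integral>p. \<bar>k p * (d n (fst p) * v n (snd p))\<bar> \<partial>?QQ) + (\<integral>p. \<bar>k p * (h (fst p) * d n (snd p))\<bar> \<partial>?QQ))
      + \<bar>s n - c\<bar> * (\<integral>p. \<bar>k p * (h (fst p) * h (snd p))\<bar> \<partial>?QQ)"
      unfolding U_def using c1(1)[of n n] c2(1)[of n] c3(1)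
      by (subst Bochner_Integration.integral_add; simp)
    also have "\<dots> \<le> s n * (B * (\<delta> n * L2_norm Q (v n)) + B * (H * \<delta> n)) + \<bar>s n - c\<bar> * (B * (H * H))"
      unfolding \<delta>_def H_def by (intro add_mono mult_left_mono c1(2) c2(2) c3(2) s0 abs_ge_zero)
    also have "\<dots> \<le> ?bound n"
      using s0[of n] by (intro add_mono mult_left_mono vH order_refl) (auto simp: B_def \<delta>_def L2_norm_nonneg)
    finally show ?thesis .
  qed
  have sc: "s \<longlonglongrightarrow> c" using c by (simp add: s_def[abs_def])
  have "?bound
    \<longlonglongrightarrow> c * (B * (0 * sqrt (2 * 0\<^sup>2 + 2 * H\<^sup>2)) + B * (H * 0)) + \<bar>c - c\<bar> * (B * (H * H))"
    by (intro tendsto_intros sc \<delta>0)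
  then have lim: "?bound \<longlonglongrightarrow> 0"
    by simp
  have pt: "?q n p \<le> U n p" for n p
  proof -
    have \<eta>v: "\<eta> n x = \<epsilon> n * v n x" for x using \<epsilon>[of n] by (simp add: v_def)
    have vd: "v n x = d n x + h x" for x by (simp add: d_def)
    have "sqrt n * (\<eta> n (fst p) * \<eta> n (snd p)) = s n * (v n (fst p) * v n (snd p))"
      by (simp add: \<eta>v s_def power2_eq_square)
    also have "\<dots> = s n * (d n (fst p) * v n (snd p) + h (fst p) * d n (snd p)) + s n * (h (fst p) * h (snd p))"
      by (simp add: vd algebra_simps)
    finally have "k p * (sqrt n * (\<eta> n (fst p) * \<eta> n (snd p)) - c * tensor_square h p)
      = s n * (k p * (d n (fst p) * v n (snd p)) + k p * (h (fst p) * d n (snd p))) + (s n - c) * (k p * (h (fst p) * h (snd p)))"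
      by (simp add: tensor_square_def case_prod_beta' algebra_simps)
    also have "\<bar>\<dots>\<bar> \<le> s n * \<bar>k p * (d n (fst p) * v n (snd p)) + k p * (h (fst p) * d n (snd p))\<bar> + \<bar>s n - c\<bar> * \<bar>k p * (h (fst p) * h (snd p))\<bar>"
      by (rule order_trans[OF abs_triangle_ineq]) (simp only: abs_mult[of "s n"] abs_mult[of "s n - c"] abs_of_nonneg[OF s0] order_refl)
    also have "\<dots> \<le> U n p"
      unfolding U_def by (intro add_mono mult_left_mono abs_triangle_ineq s0 order_refl)
    finally show ?thesis .
  qed
  show ?thesis
  proof (rule tendsto_sandwich[OF always_eventually always_eventually tendsto_const lim]; intro allI)
    fix n
    show "0 \<le> (\<integral>p. ?q n p \<partial>?QQ)"
      by simp
    have tm: "tensor_square h \<in> borel_measurable ?QQ" unfolding tensor_square_def by measurable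
    have "(\<integral>p. ?q n p \<partial>?QQ) \<le> (\<integral>p. U n p \<partial>?QQ)"
    proof (rule integral_mono[OF _ Ui pt])
      show "integrable ?QQ (\<lambda>p. ?q n p)"
      proof (rule Bochner_Integration.integrable_bound[OF Ui[of n]])
        show "(\<lambda>p. ?q n p) \<in> borel_measurable ?QQ"
          using tm by measurable
        show "AE p in ?QQ. norm (?q n p) \<le> norm (U n p)"
          using pt[of _ n] by (intro AE_I2) (simp only: real_norm_def abs_idempotent, rule order_trans[OF _ abs_ge_self])
      qed
    qed
    also note U_le
    finally show "(\<integral>p. ?q n p \<partial>?QQ)
      \<le> ?bound n" .
  qed
qed

lemma continuous_distr_no_atoms:
  assumes "continuous_distr_on_unit Q"
  shows "AE y in Q. y \<noteq> x"
proof -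
  interpret real_distribution Q using assms by (simp add: continuous_distr_on_unit_def)
  have "isCont (cdf Q) x"
    using assms by (simp add: continuous_distr_on_unit_def continuous_on_eq_continuous_at)
  then have "measure Q {x} = 0" by (simp add: isCont_cdf)
  then have "emeasure Q {x} = 0" by (simp add: emeasure_eq_measure)
  then show ?thesis by (intro AE_I[of _ _ "{x}"]) auto
qed

text \<open>Continuity of \<open>Q\<close> makes the diagonal a null set, so that symmetrising the restriction to the
  triangle restores the kernel \<open>h \<times> h\<close>; since \<open>h\<close> has mean \<open>0\<close>, that kernel is degenerate already.\<close>

lemma degenerate_part_tensor_square:
  assumes cQ: "continuous_distr_on_unit Q"
    and h: "h \<in> borel_measurable borel" "integrable Q (\<lambda>x. (h x)\<^sup>2)" "(\<integral>x. h x \<partial>Q) = 0"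
  shows "AE p in Q \<Otimes>\<^sub>M Q. degenerate_part Q (fold_triangle (tensor_square h)) p = tensor_square h p"
proof -
  let ?QQ = "Q \<Otimes>\<^sub>M Q"
  have rd: "real_distribution Q" and unit: "measure Q {0..1} = 1" using cQ by (simp_all add: continuous_distr_on_unit_def)
  interpret Q: real_distribution Q by (rule rd)
  interpret QQ: pair_prob_space Q Q ..
  have sQ: "sets Q = sets borel" by simp
  note [measurable] = h(1)
  define f where "f = fold_triangle (tensor_square h)"
  have tb: "tensor_square h \<in> borel_measurable borel"
    unfolding tensor_square_def borel_prod[symmetric] by measurable
  have fb: "f \<in> borel_measurable borel" unfolding f_def by (rule fold_triangle_measurable[OF tb])
  have fQ: "f \<in> borel_measurable ?QQ" and tQ: "tensor_square h \<in> borel_measurable ?QQ"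
    using fb tb measurable_cong_sets[OF sets_pair_borel[OF sQ sQ] refl] by blast+
  have in_unit: "AE x in Q. x \<in> {0..1}"
    using Q.prob_eq_1[of "{0..1}"] unit by simp
  have val: "f (x, y) = h x * h y" if "x \<in> {0..1}" "y \<in> {0..1}" "y \<noteq> x" for x y
    using that by (auto simp: f_def fold_triangle_def tensor_square_def triangle_def indicator_def)
  have ae: "AE x in Q. AE y in Q. f (x, y) = tensor_square h (x, y)"
    using in_unit
  proof eventually_elim
    case (elim x)
    show ?case using in_unit continuous_distr_no_atoms[OF cQ, of x]
      by eventually_elim (use val elim in \<open>auto simp: tensor_square_def\<close>)
  qed
  have ae2: "AE p in ?QQ. f p = tensor_square h p"
    by (rule QQ.AE_pair_measure[OF _ ae]) (use fQ tQ in measurable)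
  have G: "AE x in Q. marginal_mean Q f x = 0"
    using ae
  proof eventually_elim
    case (elim x)
    have "marginal_mean Q f x = (\<integral>y. h x * h y \<partial>Q)"
      unfolding marginal_mean_def
    proof (rule integral_cong_AE)
      show "AE y in Q. f (x, y) = h x * h y" using elim by (simp add: tensor_square_def)
      show "(\<lambda>y. f (x, y)) \<in> borel_measurable Q" using measurable_Pair2[OF fQ, of x] by simp
    qed measurable
    then show ?case by (simp add: h(3))
  qed
  have hi: "integrable Q h" by (rule Q.square_integrable_imp_integrable[OF _ h(2)]) measurable
  have t2: "integrable ?QQ (\<lambda>p. (tensor_square h p)\<^sup>2)"
    using tensor_product_square_integrable(2)[OF Q.prob_space_axioms _ h(2) _ h(2)] h(1)
    by (simp add: tensor_square_def case_prod_beta')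
  have ti: "integrable ?QQ (tensor_square h)"
    by (rule QQ.P.square_integrable_imp_integrable[OF tQ t2])
  have "integral\<^sup>L ?QQ f = integral\<^sup>L ?QQ (tensor_square h)"
    by (rule integral_cong_AE[OF fQ tQ ae2])
  also have "\<dots> = (\<integral>x. (\<integral>y. tensor_square h (x, y) \<partial>Q) \<partial>Q)" by (rule QQ.integral_fst'[OF ti, symmetric])
  also have "\<dots> = 0" by (simp add: tensor_square_def h(3))
  finally have m: "integral\<^sup>L ?QQ f = 0" .
  interpret T: opposite_tilts Q "\<lambda>_. 0" by (rule opposite_tilts_zero[OF Q.prob_space_axioms sQ])
  have "AE p in ?QQ. marginal_mean Q f (fst p) = 0 \<and> marginal_mean Q f (snd p) = 0"
    using T.AE_pair_tilt[OF G, of 1 1] by (simp only: opposite_tilts_zero(2)[OF Q.prob_space_axioms sQ] abs_one order_refl simp_thms)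
  with ae2 have "AE p in ?QQ. degenerate_part Q f p = tensor_square h p"
  proof eventually_elim
    case (elim p)
    then show ?case by (cases p) (simp add: degenerate_part_def m)
  qed
  then show ?thesis by (simp add: f_def)
qed

lemma oP1_I_L1:
  assumes M: "\<And>n. prob_space (M n)" and Z: "\<And>n. Z n \<in> borel_measurable (M n)"
    and Z': "\<And>n. integrable (M n) (Z' n)" "(\<lambda>n. \<integral>z. \<bar>Z' n z\<bar> \<partial>M n) \<longlonglongrightarrow> 0"
    and ae: "\<And>n. AE z in M n. Z n z = Z' n z"
  shows "oP1 M Z"
  unfolding oP1_def
proof (intro conjI allI impI Z)
  fix \<delta> :: real assume \<delta>: "\<delta> > 0"
  have le: "measure (M n) {z \<in> space (M n). \<bar>Z n z\<bar> > \<delta>} \<le> (\<integral>z. \<bar>Z' n z\<bar> \<partial>M n) / \<delta>" for n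
  proof -
    interpret prob_space "M n" by (rule M)
    have [measurable]: "Z' n \<in> borel_measurable (M n)" using Z'(1) by auto
    have "measure (M n) {z \<in> space (M n). \<bar>Z n z\<bar> > \<delta>} \<le> measure (M n) {z \<in> space (M n). \<bar>Z' n z\<bar> \<ge> \<delta>}"
      using ae[of n] by (intro finite_measure_mono_AE) auto
    also have "\<dots> \<le> (\<integral>z. \<bar>Z' n z\<bar> \<partial>M n) / \<delta>"
      using Z'(1)[of n] \<delta> by (intro integral_Markov_inequality_measure[of _ _ "space (M n)"]) auto
    finally show ?thesis .
  qed
  have "(\<lambda>n. (\<integral>z. \<bar>Z' n z\<bar> \<partial>M n) / \<delta>) \<longlonglongrightarrow> 0 / \<delta>"
    by (intro tendsto_divide Z'(2) tendsto_const) (use \<delta> in simp)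
  then have "(\<lambda>n. (\<integral>z. \<bar>Z' n z\<bar> \<partial>M n) / \<delta>) \<longlonglongrightarrow> 0" by simp
  then show "(\<lambda>n. measure (M n) {z \<in> space (M n). \<bar>Z n z\<bar> > \<delta>}) \<longlonglongrightarrow> 0"
    by (rule tendsto_sandwich[OF always_eventually always_eventually tendsto_const, rotated 2])
       (auto simp: le)
qed

theorem proposition4p3:
  fixes Q :: "real measure"
    and A\<^sub>1 A\<^sub>2 :: "nat \<Rightarrow> real measure"
    and \<epsilon> :: "nat \<Rightarrow> real"
    and hn :: "nat \<Rightarrow> real \<Rightarrow> real"
    and h :: "real \<Rightarrow> real"
    and M\<^sub>0 M\<^sub>a :: "nat \<Rightarrow> 'a measure"
    and X Y :: "nat \<Rightarrow> nat \<Rightarrow> 'a \<Rightarrow> real"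
  assumes "continuous_distr_on_unit Q"
    and "\<And>n. \<epsilon> n > 0"
    and "\<epsilon> \<longlonglongrightarrow> 0"
    and "convergent (\<lambda>n. sqrt (real n) * (\<epsilon> n)\<^sup>2)"
    and "\<And>n. continuous_distr_on_unit (A\<^sub>1 n)"
    and "\<And>n. continuous_distr_on_unit (A\<^sub>2 n)"
    and "\<And>n. hn n \<in> borel_measurable Q"
    and "\<And>n. AE x in Q. 0 \<le> 1 + \<epsilon> n * hn n x"
    and "\<And>n. AE x in Q. 0 \<le> 1 - \<epsilon> n * hn n x"
    and "\<And>n. A\<^sub>1 n = density Q (\<lambda>x. ennreal (1 + \<epsilon> n * hn n x))"
    and "\<And>n. A\<^sub>2 n = density Q (\<lambda>x. ennreal (1 - \<epsilon> n * hn n x))"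
    and "h \<in> L2_space Q"
    and "(\<integral>x. h x \<partial>Q) = 0"
    and "(\<lambda>n. \<integral>\<^sup>+x. ennreal ((hn n x - h x)\<^sup>2) \<partial>Q) \<longlonglongrightarrow> 0"
    and "\<And>n. iid_pairs (M\<^sub>0 n) n (X n) (Y n) Q Q"
    and "\<And>n. iid_pairs (M\<^sub>a n) n (X n) (Y n) (A\<^sub>1 n) (A\<^sub>2 n)"
  shows "asymptotically_most_powerful M\<^sub>0 M\<^sub>a X Y Q (tensor_square h)
    \<and> (\<forall>M \<in> {M\<^sub>0, M\<^sub>a}. oP1 M (\<lambda>n \<omega>. cb_stat_seq X Y (tensor_square h) n \<omega>
          - (1 / sqrt (real n)) *
            (\<Sum>i = 1..n. h (max (X n i \<omega>) (Y n i \<omega>)) * h (min (X n i \<omega>) (Y n i \<omega>)))))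
    \<and> (let T = lim (\<lambda>n. sqrt (real n) * (\<epsilon> n)\<^sup>2 * L2_norm (Q \<Otimes>\<^sub>M Q) (tensor_square h))
       in has_asymptotic_power M\<^sub>0 M\<^sub>a (cb_stat_seq X Y (tensor_square h))
            (2 * cdf std_normal_distribution (T / 2) - 1))"
proof -
  let ?QQ = "Q \<Otimes>\<^sub>M Q"
  let ?L2 = "L2_space ?QQ"
  note cQ = assms(1) and \<epsilon> = assms(2) and hn = assms(7)
  have rdQ: "real_distribution Q" using cQ by (simp add: continuous_distr_on_unit_def)
  interpret Q: real_distribution Q by (rule rdQ)
  interpret QQ: pair_prob_space Q Q ..
  have pQ: "prob_space Q" and sQ: "sets Q = sets borel" by (auto intro: Q.prob_space_axioms)
  obtain c where c: "(\<lambda>n. sqrt (real n) * (\<epsilon> n)\<^sup>2) \<longlonglongrightarrow> c"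
    using assms(4) by (auto simp: convergent_def)
  have c0: "0 \<le> c" by (rule LIMSEQ_le_const[OF c]) simp
  have hQ: "h \<in> borel_measurable Q" and h2: "integrable Q (\<lambda>x. (h x)\<^sup>2)"
    using assms(12) by (simp_all add: L2_space_def)
  have hb: "h \<in> borel_measurable borel" using hQ measurable_cong_sets[OF sQ refl] by blast
  define hh where "hh = tensor_square h"
  have hh_eq: "hh = (\<lambda>p. h (fst p) * h (snd p))" by (simp add: hh_def tensor_square_def case_prod_beta')
  have hhQ: "hh \<in> borel_measurable ?QQ" and hh2: "integrable ?QQ (\<lambda>p. (hh p)\<^sup>2)"
    unfolding hh_eq by (rule tensor_product_square_integrable[OF pQ hQ h2 hQ h2])+
  have QQb: "u \<in> borel_measurable borel" if "u \<in> borel_measurable ?QQ" for u :: "real \<times> real \<Rightarrow> real"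
    using that measurable_cong_sets[OF sets_pair_borel[OF sQ sQ] refl] by blast
  have bQQ: "u \<in> borel_measurable ?QQ" if "u \<in> borel_measurable borel" for u :: "real \<times> real \<Rightarrow> real"
    using that measurable_cong_sets[OF sets_pair_borel[OF sQ sQ] refl] by blast
  define \<eta> where "\<eta> n x = clamp_unit (\<epsilon> n * hn n x)" for n x
  have tilts: "AE x in Q. \<eta> n x = \<epsilon> n * hn n x" "opposite_tilts Q (\<eta> n)"
    "A\<^sub>1 n = tilt Q (\<eta> n) 1" "A\<^sub>2 n = tilt Q (\<eta> n) (-1)" for n
  proof -
    have A1: "prob_space (A\<^sub>1 n)" using assms(5)[of n] by (simp add: continuous_distr_on_unit_def real_distribution_def)
    have um: "(\<lambda>x. \<epsilon> n * hn n x) \<in> borel_measurable Q" using hn by measurable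
    note o = opposite_tilts_of_densities[OF pQ sQ A1 um assms(8,9,10,11), folded \<eta>_def]
    show "AE x in Q. \<eta> n x = \<epsilon> n * hn n x" "opposite_tilts Q (\<eta> n)"
      "A\<^sub>1 n = tilt Q (\<eta> n) 1" "A\<^sub>2 n = tilt Q (\<eta> n) (-1)" by (rule o)+
  qed
  have \<eta>m: "\<eta> n \<in> borel_measurable Q" and \<eta>b: "\<bar>\<eta> n x\<bar> \<le> 1" for n x
    using tilts(2)[of n] measurable_cong_sets[OF sQ refl] by (auto simp: opposite_tilts_def)
  have iida: "iid_pairs (M\<^sub>a n) n (X n) (Y n) (tilt Q (\<eta> n) 1) (tilt Q (\<eta> n) (-1))" for n
    using assms(16)[of n] by (simp add: tilts(3,4))
  note zero = opposite_tilts_zero[OF pQ sQ]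
  have iid0: "iid_pairs (M\<^sub>0 n) n (X n) (Y n) (tilt Q (\<lambda>_. 0) 1) (tilt Q (\<lambda>_. 0) (-1))" for n
    using assms(15)[of n] by (simp add: zero(2))
  \<comment> \<open>Under the null hypothesis the limit law is \<open>N(0, \<sigma>\<^sup>2)\<close>, under the alternatives \<open>N(-b, \<sigma>\<^sup>2)\<close>.\<close>
  define k where "k \<phi> = degenerate_part Q (fold_triangle \<phi>)" for \<phi>
  define b where "b \<phi> = c * (\<integral>p. k \<phi> p * hh p \<partial>?QQ)" for \<phi>
  define \<sigma> where "\<sigma> \<phi> = L2_norm ?QQ (k \<phi>)" for \<phi>
  define pow where "pow \<phi> = 2 * cdf std_normal_distribution (\<bar>b \<phi>\<bar> / (2 * \<sigma> \<phi>)) - 1" for \<phi>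
  have L2: "\<phi> \<in> borel_measurable borel" "integrable ?QQ (\<lambda>p. (\<phi> p)\<^sup>2)" if "\<phi> \<in> ?L2" for \<phi>
    by (rule QQb) (use that in \<open>simp_all add: L2_space_def\<close>)
  have kL2: "k \<phi> \<in> borel_measurable ?QQ" "integrable ?QQ (\<lambda>p. (k \<phi> p)\<^sup>2)" if "\<phi> \<in> ?L2" for \<phi>
  proof -
    note d = degenerate_part_properties[OF pQ sQ fold_triangle_measurable[OF L2(1)[OF that]]
        fold_triangle_square_integrable[OF pQ sQ L2[OF that]] fold_triangle_sym, folded k_def]
    show "k \<phi> \<in> borel_measurable ?QQ" by (rule bQQ[OF d(1)])
    show "integrable ?QQ (\<lambda>p. (k \<phi> p)\<^sup>2)" by (rule d(2))
  qed
  have limitsa: "(\<lambda>n. \<integral>p. \<bar>k \<phi> p * (sqrt n * (\<eta> n (fst p) * \<eta> n (snd p)) - c * hh p)\<bar> \<partial>?QQ) \<longlonglongrightarrow> 0"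
    if "\<phi> \<in> ?L2" for \<phi>
    unfolding hh_def
    by (rule tilt_products_converge[OF pQ sQ \<epsilon> c hn hQ h2 assms(14) \<eta>m \<eta>b tilts(1) kL2[OF that]])
  have khi: "integrable ?QQ (\<lambda>p. k \<phi> p * hh p)" if "\<phi> \<in> ?L2" for \<phi>
    by (rule square_integrable_mult[OF kL2[OF that] hhQ hh2])
  have law0: "converges_in_law M\<^sub>0 (cb_stat_seq X Y \<phi>) (gaussian 0 (\<sigma> \<phi>))" if "\<phi> \<in> ?L2" for \<phi>
    using cb_statistic_limit_law(1)[where g = "\<lambda>_. 0", OF zero(1) iid0 L2[OF that]]
    by (simp add: \<sigma>_def k_def)
  have lawa: "converges_in_law M\<^sub>a (cb_stat_seq X Y \<phi>) (gaussian (- b \<phi>) (\<sigma> \<phi>))" if "\<phi> \<in> ?L2" for \<phi>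
  proof -
    have i: "integrable ?QQ (\<lambda>p. k \<phi> p * (c * hh p))"
      using integrable_mult_right[OF khi[OF that], of c] by (simp add: mult.left_commute)
    have "(\<integral>p. k \<phi> p * (c * hh p) \<partial>?QQ) = b \<phi>"
      unfolding b_def by (simp add: mult.left_commute)
    then show ?thesis
      using cb_statistic_limit_law(1)[where g = "\<lambda>p. c * hh p", OF tilts(2) iida L2[OF that], folded k_def, OF _ i limitsa[OF that]]
        borel_measurable_times[OF borel_measurable_const QQb[OF hhQ], of c]
      by (simp add: \<sigma>_def)
  qed
  \<comment> \<open>The only inequality behind optimality: the shift, measured in standard deviations, is at most \<open>c\<close> times the norm of \<open>h \<times> h\<close>, with equality when the degenerate part of the kernel is \<open>h \<times> h\<close>.\<close>
  have CS: "\<bar>b \<phi>\<bar> \<le> c * (\<sigma> \<phi> * L2_norm ?QQ hh)" if "\<phi> \<in> ?L2" for \<phi>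
  proof -
    have "\<bar>\<integral>p. k \<phi> p * hh p \<partial>?QQ\<bar> \<le> (\<integral>p. \<bar>k \<phi> p * hh p\<bar> \<partial>?QQ)" by (rule integral_abs_bound)
    also have "\<dots> \<le> \<sigma> \<phi> * L2_norm ?QQ hh"
      unfolding \<sigma>_def by (rule integral_abs_mult_le_L2_norm[OF kL2[OF that] hhQ hh2])
    finally show ?thesis using c0 by (simp add: b_def abs_mult mult_left_mono)
  qed
  have \<sigma>0: "0 \<le> \<sigma> \<phi>" for \<phi> by (simp add: \<sigma>_def L2_norm_nonneg)
  have power: "has_asymptotic_power M\<^sub>0 M\<^sub>a (cb_stat_seq X Y \<phi>) (pow \<phi>)" if "\<phi> \<in> ?L2" for \<phi>
    unfolding has_asymptotic_power_def
  proof (intro exI conjI)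
    show "0 \<le> \<sigma> \<phi>" by (rule \<sigma>0)
    show "converges_in_law M\<^sub>0 (cb_stat_seq X Y \<phi>) (gaussian 0 (\<sigma> \<phi>))" by (rule law0[OF that])
    show "converges_in_law M\<^sub>a (cb_stat_seq X Y \<phi>) (gaussian (- b \<phi>) (\<sigma> \<phi>))" by (rule lawa[OF that])
    have "\<sigma> \<phi> = 0 \<Longrightarrow> - b \<phi> = 0" using CS[OF that] by simp
    from tv_dist_gaussian_zero_mean[OF \<sigma>0 this]
    show "pow \<phi> = tv_dist (gaussian 0 (\<sigma> \<phi>)) (gaussian (- b \<phi>) (\<sigma> \<phi>))" by (simp add: pow_def)
  qed
  have hhL2: "hh \<in> ?L2" using hhQ hh2 by (simp add: L2_space_def)
  have khh: "AE p in ?QQ. k hh p = hh p"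
    unfolding k_def hh_def by (rule degenerate_part_tensor_square[OF cQ hb h2 assms(13)])
  define \<tau> where "\<tau> = L2_norm ?QQ hh"
  have \<tau>0: "0 \<le> \<tau>" by (simp add: \<tau>_def L2_norm_nonneg)
  have \<sigma>hh: "\<sigma> hh = \<tau>"
  proof -
    have "(\<integral>p. (k hh p)\<^sup>2 \<partial>?QQ) = (\<integral>p. (hh p)\<^sup>2 \<partial>?QQ)"
      using khh kL2[OF hhL2] hhQ by (intro integral_cong_AE) auto
    then show ?thesis by (simp add: \<sigma>_def \<tau>_def L2_norm_def)
  qed
  have bhh: "b hh = c * \<tau>\<^sup>2"
  proof -
    have "(\<integral>p. k hh p * hh p \<partial>?QQ) = (\<integral>p. (hh p)\<^sup>2 \<partial>?QQ)"
      using khh kL2[OF hhL2] hhQ by (intro integral_cong_AE) (auto simp: power2_eq_square)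
    then show ?thesis by (simp add: b_def \<tau>_def L2_norm_square)
  qed
  have pow_hh: "pow hh = 2 * cdf std_normal_distribution (c * \<tau> / 2) - 1"
  proof -
    have "\<bar>b hh\<bar> / (2 * \<sigma> hh) = c * \<tau> / 2"
      using c0 \<tau>0 by (simp add: bhh \<sigma>hh power2_eq_square)
    then show ?thesis by (simp only: pow_def)
  qed
  have optimal: "pow \<phi> \<le> pow hh" if "\<phi> \<in> ?L2" for \<phi>
  proof -
    have "\<bar>b \<phi>\<bar> / (2 * \<sigma> \<phi>) \<le> c * \<tau> / 2"
    proof (cases "\<sigma> \<phi> = 0")
      case False
      then show ?thesis using CS[OF that] \<sigma>0[of \<phi>] by (simp add: divide_le_eq \<tau>_def mult_ac)
    qed (use c0 \<tau>0 in simp)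
    then have "cdf std_normal_distribution (\<bar>b \<phi>\<bar> / (2 * \<sigma> \<phi>)) \<le> cdf std_normal_distribution (c * \<tau> / 2)"
      by (rule finite_borel_measure.cdf_nondecreasing[OF real_distribution.finite_borel_measure_M[OF real_dist_normal_dist]])
    then show ?thesis unfolding pow_hh by (simp add: pow_def)
  qed
  have best: "asymptotically_most_powerful M\<^sub>0 M\<^sub>a X Y Q hh"
    unfolding asymptotically_most_powerful_def
  proof (rule conjI[OF hhL2], rule exI[of _ "pow hh"], intro conjI ballI)
    show "has_asymptotic_power M\<^sub>0 M\<^sub>a (cb_stat_seq X Y hh) (pow hh)" by (rule power[OF hhL2])
    fix \<phi> assume "\<phi> \<in> ?L2"
    then show "\<exists>d'. has_asymptotic_power M\<^sub>0 M\<^sub>a (cb_stat_seq X Y \<phi>) d' \<and> d' \<le> pow hh"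
      using power optimal by blast
  qed
  let ?remainder = "(\<lambda>n z. cb_stat_seq X Y hh n z
        - (1 / sqrt (real n)) * (\<Sum>i = 1..n. h (max (X n i z) (Y n i z)) * h (min (X n i z) (Y n i z))))"
  have representation: "oP1 M ?remainder"
    if tl: "\<And>n. opposite_tilts Q (\<theta> n)"
      and iid: "\<And>n. iid_pairs (M n) n (X n) (Y n) (tilt Q (\<theta> n) 1) (tilt Q (\<theta> n) (-1))"
      and g: "g \<in> borel_measurable borel" "integrable ?QQ (\<lambda>p. k hh p * g p)"
      and lim: "(\<lambda>n. \<integral>p. \<bar>k hh p * (sqrt n * (\<theta> n (fst p) * \<theta> n (snd p)) - g p)\<bar> \<partial>?QQ) \<longlonglongrightarrow> 0"
    for M :: "nat \<Rightarrow> 'a measure" and \<theta> g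
  proof -
    note L = cb_statistic_limit_law[OF tl iid L2[OF hhL2], folded k_def, OF g lim]
    \<comment> \<open>The product is symmetric, so ordering the pair is immaterial.\<close>
    have e: "h (max x y) * h (min x y) = hh (x, y)" for x y
      by (simp add: hh_eq max_def min_def mult.commute)
    have Mp: "prob_space (M n)" for n using iid by (simp add: iid_pairs_def)
    have Wm: "(\<lambda>z. (X n i z, Y n i z)) \<in> M n \<rightarrow>\<^sub>M borel \<Otimes>\<^sub>M borel" if "i \<in> {1..n}" for n i
    proof -
      interpret prob_space "M n" by (rule Mp)
      show ?thesis using iid[of n] that by (auto simp: iid_pairs_def indep_vars_def)
    qed
    have hhP: "hh \<in> borel_measurable (borel \<Otimes>\<^sub>M borel)" using QQb[OF hhQ] by (simp add: borel_prod)
    have T: "(\<lambda>z. (1 / sqrt (real n)) * (\<Sum>i = 1..n. hh (X n i z, Y n i z))) \<in> borel_measurable (M n)" for n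
      by (intro borel_measurable_times borel_measurable_const borel_measurable_sum measurable_compose[OF Wm hhP])
    have Sm: "cb_stat_seq X Y hh n \<in> borel_measurable (M n)" for n
      using L(1) by (simp add: converges_in_law_def)
    have aeW: "AE z in M n. k hh (X n i z, Y n i z) = hh (X n i z, Y n i z)" if i: "i \<in> {1..n}" for n i
    proof -
      interpret Tn: opposite_tilts Q "\<theta> n" by (rule tl)
      have "AE p in Tn.pair_law. k hh p = hh p"
        using khh by (subst Tn.tilt_pair_density) (auto simp: AE_density)
      moreover have "distr (M n) (borel \<Otimes>\<^sub>M borel) (\<lambda>z. (X n i z, Y n i z)) = Tn.pair_law"
        using iid[of n] i by (simp only: iid_pairs_def)
      ultimately have "AE p in distr (M n) (borel \<Otimes>\<^sub>M borel) (\<lambda>z. (X n i z, Y n i z)). k hh p = hh p"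
        by (simp only:)
      then show ?thesis by (rule AE_distrD[OF Wm[OF i]])
    qed
    show ?thesis
      unfolding e
    proof (rule oP1_I_L1[OF Mp])
      show "(\<lambda>z. cb_stat_seq X Y hh n z - (1 / sqrt (real n)) * (\<Sum>i = 1..n. hh (X n i z, Y n i z))) \<in> borel_measurable (M n)" for n
        by (rule borel_measurable_diff[OF Sm T])
      show "integrable (M n) (\<lambda>z. cb_stat_seq X Y hh n z - (\<Sum>i = 1..n. k hh (X n i z, Y n i z)) / sqrt n)" for n
        by (rule L(3))
      show "(\<lambda>n. \<integral>z. \<bar>cb_stat_seq X Y hh n z - (\<Sum>i = 1..n. k hh (X n i z, Y n i z)) / sqrt n\<bar> \<partial>M n) \<longlonglongrightarrow> 0"
        by (rule L(2))
      show "AE z in M n. cb_stat_seq X Y hh n z - (1 / sqrt (real n)) * (\<Sum>i = 1..n. hh (X n i z, Y n i z))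
          = cb_stat_seq X Y hh n z - (\<Sum>i = 1..n. k hh (X n i z, Y n i z)) / sqrt n" for n
      proof -
        have "AE z in M n. \<forall>i\<in>{1..n}. k hh (X n i z, Y n i z) = hh (X n i z, Y n i z)"
          using aeW by (intro AE_finite_allI) auto
        then show ?thesis by eventually_elim simp
      qed
    qed
  qed
  have o0: "oP1 M\<^sub>0 ?remainder"
    by (rule representation[of "\<lambda>_ _. 0" M\<^sub>0 "\<lambda>_. 0", OF zero(1) iid0]) simp_all
  have oa: "oP1 M\<^sub>a ?remainder"
  proof (rule representation[of \<eta> M\<^sub>a "\<lambda>p. c * hh p", OF tilts(2) iida _ _ limitsa[OF hhL2]])
    show "(\<lambda>p. c * hh p) \<in> borel_measurable borel" by (intro borel_measurable_times borel_measurable_const QQb[OF hhQ])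
    show "integrable ?QQ (\<lambda>p. k hh p * (c * hh p))"
      using integrable_mult_right[OF khi[OF hhL2], of c] by (simp add: mult.left_commute)
  qed
  have "lim (\<lambda>n. sqrt (real n) * (\<epsilon> n)\<^sup>2 * \<tau>) = c * \<tau>"
    by (intro limI tendsto_mult c tendsto_const)
  then have "let T = lim (\<lambda>n. sqrt (real n) * (\<epsilon> n)\<^sup>2 * L2_norm ?QQ hh)
       in has_asymptotic_power M\<^sub>0 M\<^sub>a (cb_stat_seq X Y hh) (2 * cdf std_normal_distribution (T / 2) - 1)"
    using power[OF hhL2] by (simp add: Let_def \<tau>_def[symmetric] pow_hh)
  then show ?thesis
    using best o0 oa unfolding hh_def by blast
qed

end
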